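(* There exists a constant $\varepsilon>0$ (independent of $n$, $m$, $\Omega$, $F$) with the following property. Let $n,m\ge1$, let $\Omega\subset\mathbb{R}^n$ be a domain, and let $F:\Omega\to\mathbb{R}^m$ be a smooth map whose graph is a minimal submanifold of $\mathbb{R}^{n+m}$, with $r=\sup_{x\in\Omega}\operatorname{rank}(\mathrm{d}F|_x)\ge2$. If at every point of $\Omega$ the singular values $\lambda_1\ge\lambda_2\ge\cdots$ of $\mathrm{d}F$ satisfy $$\lambda_j\lambda_k\le\frac{\varepsilon}{r-1}\qquad\text{for all }1\le j<k\le r,$$ then the $n$-form $\Theta(F)$ on $\Omega\times\mathbb{R}^m$ is a calibration.
   Context: Minimal means that the mean curvature vector vanishes identically. Singular values are the eigenvalues of $\sqrt{(\mathrm{d}F)^*\mathrm{d}F}$, listed in decreasing order. Comass and calibrations. The comass of an $n$-form at a point is the supremum of its values on all oriented unit $n$-planes (i.e. on all orthonormal $n$-tuples). A calibration is a closed form whose comass is at most one at every point. Definition of $\Theta(F)$ for a smooth map $F:\Omega\subset\mathbb{R}^n\to\mathbb{R}^m$. Fix the standard orientation of $\mathbb{R}^n$; let $\Sigma=\{(x,F(x)):x\in\Omega\}$ be the graph, oriented so that the projection $\pi_1:\Sigma\to\Omega$ preserves orientation, and let $\operatorname{vol}_\Sigma$ be the induced volume form. For $p\in\Sigma$ put $D=\mathrm{d}F|_{\pi_1(p)}:\mathbb{R}^n\to\mathbb{R}^m$, $G=\mathbf{I}_n+D^*D$, $H=\mathbf{I}_m+DD^*$. Define isometric isomorphisms $L_p:\mathbb{R}^n\to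 T_p\Sigma$, $L_p(v)=(G^{-1/2}v,\,DG^{-1/2}v)$, and $L_p^\perp:\mathbb{R}^m\to N_p\Sigma$, $L_p^\perp(w)=(-D^*H^{-1/2}w,\,H^{-1/2}w)$, onto the tangent and normal spaces, and set $J_p=L_p^\perp\circ D\circ L_p^{-1}:T_p\Sigma\to N_p\Sigma$. For $\xi\in\Lambda^k(\mathbb{R}^n\times\mathbb{R}^m)^*$ at $p$ put $\Psi(\xi)=\sum_{i=1}^n (J_p(e_i))^\flat\wedge\iota_{e_i}\xi$, where $e_1,\dots,e_n$ is any orthonormal basis of $T_p\Sigma$ (the result is independent of the basis), $\iota$ is interior multiplication, and $\flat$ is the metric dual. View $\operatorname{vol}_\Sigma$ at $p$ as the $n$-form on $\mathbb{R}^{n+m}$ that vanishes when contracted with normal vectors, and set $\Psi^\ell(F)=\Psi^{\ell}(\operatorname{vol}_\Sigma)$ ($\ell$-fold iterate). This is defined along $\Sigma$ and is extended to an $n$-form on $\Omega\times\mathbb{R}^m$ by parallel transport along the $\mathbb{R}^m$ factor, i.e. its value at $(x,y)$ is its value at $(x,F(x))$. Finally $$\Theta(F)=\Psi^0(F)-\sum_{\ell\ge1}(-1)^\ell\,\frac{\ell-1}{\ell!}\,\Psi^\ell(F).$$ *)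

theory Defs
  imports "HOL-Analysis.Analysis"
begin

section \<open>Euclidean spaces of variable dimension\<close>

text \<open>
  The dimensions \<open>n\<close> and \<open>m\<close> have to be quantified inside a formula, so they cannot be types.
  All vectors live in one inner product space, the finitely supported real sequences, which
  contains every \<open>\<real>\<^sup>n\<close> as the subspace of sequences vanishing from index \<open>n\<close> on; \<open>\<real>\<^sup>n \<times> \<real>\<^sup>m\<close> is a
  subspace of the product type with its usual inner product.
\<close>

typedef rseq = "{f :: nat \<Rightarrow> real. finite {i. f i \<noteq> 0}}"
  morphisms coord Abs_rseq
  by (rule exI[of _ "\<lambda>_. 0"]) simp

setup_lifting type_definition_rseq

lemma rseq_eqI: "(\<And>i. coord x i = coord y i) \<Longrightarrow> x = y"
  by (metis coord_inject ext)

lemma finite_supp_coord: "finite {i. coord x i \<noteq> 0}"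
  using coord[of x] by simp

instantiation rseq :: real_vector
begin

lift_definition zero_rseq :: rseq is "\<lambda>_. 0" by simp
lift_definition plus_rseq :: "rseq \<Rightarrow> rseq \<Rightarrow> rseq" is "\<lambda>f g i. f i + g i"
  subgoal for f g by (rule finite_subset[of _ "{i. f i \<noteq> 0} \<union> {i. g i \<noteq> 0}"]) auto
  done
lift_definition minus_rseq :: "rseq \<Rightarrow> rseq \<Rightarrow> rseq" is "\<lambda>f g i. f i - g i"
  subgoal for f g by (rule finite_subset[of _ "{i. f i \<noteq> 0} \<union> {i. g i \<noteq> 0}"]) auto
  done
lift_definition uminus_rseq :: "rseq \<Rightarrow> rseq" is "\<lambda>f i. - f i" by simp
lift_definition scaleR_rseq :: "real \<Rightarrow> rseq \<Rightarrow> rseq" is "\<lambda>c f i. c * f i" by simp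

instance
  by standard (transfer, simp add: algebra_simps fun_eq_iff)+

end

instantiation rseq :: real_inner
begin

definition inner_rseq :: "rseq \<Rightarrow> rseq \<Rightarrow> real"
  where "inner_rseq x y = (\<Sum>i | coord x i \<noteq> 0. coord x i * coord y i)"
definition norm_rseq :: "rseq \<Rightarrow> real" where "norm_rseq x = sqrt (inner x x)"
definition dist_rseq :: "rseq \<Rightarrow> rseq \<Rightarrow> real" where "dist_rseq x y = norm (x - y)"
definition sgn_rseq :: "rseq \<Rightarrow> rseq" where "sgn_rseq x = x /\<^sub>R norm x"
definition uniformity_rseq :: "(rseq \<times> rseq) filter"
  where "uniformity_rseq = (INF e\<in>{0<..}. principal {(x, y). dist x y < e})"
definition open_rseq :: "rseq set \<Rightarrow> bool"
  where "open_rseq U = (\<forall>x\<in>U. \<forall>\<^sub>F (x', y) in uniformity. x' = x \<longrightarrow> y \<in> U)"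

lemma inner_rseq_superset:
  assumes "finite S" "{i. coord x i \<noteq> 0} \<subseteq> S"
  shows "inner x y = (\<Sum>i\<in>S. coord x i * coord y i)"
  unfolding inner_rseq_def using assms by (intro sum.mono_neutral_left) auto

instance
proof
  fix x y z :: rseq and r :: real
  let ?S = "{i. coord x i \<noteq> 0} \<union> {i. coord y i \<noteq> 0}"
  have fin: "finite ?S"
    by (simp add: finite_supp_coord)
  show "inner x y = inner y x"
    using inner_rseq_superset[OF fin, of x y] inner_rseq_superset[OF fin, of y x]
    by (simp add: mult.commute)
  have "inner (x + y) z = (\<Sum>i\<in>?S. coord (x + y) i * coord z i)"
    by (rule inner_rseq_superset[OF fin]) (auto simp: plus_rseq.rep_eq)
  then show "inner (x + y) z = inner x z + inner y z"
    using inner_rseq_superset[OF fin, of x z] inner_rseq_superset[OF fin, of y z]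
    by (simp add: plus_rseq.rep_eq algebra_simps sum.distrib)
  have "inner (r *\<^sub>R x) y = (\<Sum>i\<in>?S. coord (r *\<^sub>R x) i * coord y i)"
    by (rule inner_rseq_superset[OF fin]) (auto simp: scaleR_rseq.rep_eq)
  then show "inner (r *\<^sub>R x) y = r * inner x y"
    using inner_rseq_superset[OF fin, of x y]
    by (simp add: scaleR_rseq.rep_eq sum_distrib_left mult.assoc)
  show "0 \<le> inner x x"
    by (simp add: inner_rseq_def sum_nonneg)
  show "inner x x = 0 \<longleftrightarrow> x = 0"
    by (auto simp: inner_rseq_def finite_supp_coord sum_nonneg_eq_0_iff zero_rseq.rep_eq
        intro: rseq_eqI)
qed (simp_all add: norm_rseq_def dist_rseq_def sgn_rseq_def uniformity_rseq_def open_rseq_def)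

end

lift_definition unit_vec :: "nat \<Rightarrow> rseq" is "\<lambda>k i. if i = k then 1 else 0" by simp

definition Rn :: "nat \<Rightarrow> rseq set"
  where "Rn n = {x. \<forall>i\<ge>n. coord x i = 0}"

definition proj_Rn :: "nat \<Rightarrow> rseq \<Rightarrow> rseq"
  where "proj_Rn n v = (\<Sum>i<n. (v \<bullet> unit_vec i) *\<^sub>R unit_vec i)"

lemma subspace_Rn: "subspace (Rn n)"
  by (auto simp: subspace_def Rn_def zero_rseq.rep_eq plus_rseq.rep_eq scaleR_rseq.rep_eq)

lemma inner_Rn: "x \<in> Rn n \<Longrightarrow> x \<bullet> y = (\<Sum>i<n. coord x i * coord y i)"
  by (rule inner_rseq_superset) (auto simp: Rn_def not_less[symmetric])

lemma proj_Rn_id: "v \<in> Rn n \<Longrightarrow> proj_Rn n v = v"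
proof (rule rseq_eqI)
  fix j assume v: "v \<in> Rn n"
  have c: "coord (sum f A) j = (\<Sum>a\<in>A. coord (f a) j)" for f and A :: "nat set"
    by (induction A rule: infinite_finite_induct) (auto simp: zero_rseq.rep_eq plus_rseq.rep_eq)
  have i: "v \<bullet> unit_vec i = coord v i" if "i < n" for i
    using that by (simp add: inner_Rn[OF v] unit_vec.rep_eq if_distrib cong: if_cong)
  show "coord (proj_Rn n v) j = coord v j"
    using v by (simp add: proj_Rn_def c i scaleR_rseq.rep_eq unit_vec.rep_eq Rn_def if_distrib
        cong: if_cong)
qed


section \<open>Calculus on relatively open subsets of a subspace\<close>

text \<open>
  Let \<open>U\<close> be relatively open in a finite-dimensional subspace \<open>W\<close>. A Frechet derivative within \<open>U\<close>
  is determined on \<open>W\<close> only (its values on a complement of \<open>W\<close> are arbitrary), so only its values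
  on \<open>W\<close> are ever used.
\<close>

primrec Ck_on :: "nat \<Rightarrow> 'a::real_normed_vector set \<Rightarrow> 'a set \<Rightarrow> ('a \<Rightarrow> 'b::real_normed_vector) \<Rightarrow> bool"
  where
    "Ck_on 0 W U f \<longleftrightarrow> continuous_on U f"
  | "Ck_on (Suc k) W U f \<longleftrightarrow>
      (\<forall>x\<in>U. f differentiable (at x within U)) \<and>
      (\<forall>v\<in>W. Ck_on k W U (\<lambda>x. frechet_derivative f (at x within U) v))"

definition smooth_on :: "'a::real_normed_vector set \<Rightarrow> 'a set \<Rightarrow> ('a \<Rightarrow> 'b::real_normed_vector) \<Rightarrow> bool"
  where "smooth_on W U f \<longleftrightarrow> (\<forall>k. Ck_on k W U f)"

definition euclid_domain :: "nat \<Rightarrow> rseq set \<Rightarrow> bool"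
  where "euclid_domain n \<Omega> \<longleftrightarrow>
    \<Omega> \<noteq> {} \<and> connected \<Omega> \<and> openin (top_of_set (Rn n)) \<Omega>"

text \<open>The differential \<open>\<real>\<^sup>n \<rightarrow> \<dots>\<close>, extended by zero to the orthogonal complement of \<open>\<real>\<^sup>n\<close>.\<close>

definition differential :: "nat \<Rightarrow> rseq set \<Rightarrow> (rseq \<Rightarrow> 'b::real_normed_vector) \<Rightarrow> rseq \<Rightarrow> rseq \<Rightarrow> 'b"
  where "differential n \<Omega> f x v = frechet_derivative f (at x within \<Omega>) (proj_Rn n v)"

definition second_differential ::
    "nat \<Rightarrow> rseq set \<Rightarrow> (rseq \<Rightarrow> 'b::real_normed_vector) \<Rightarrow> rseq \<Rightarrow> rseq \<Rightarrow> rseq \<Rightarrow> 'b"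
  where "second_differential n \<Omega> f x u v = differential n \<Omega> (\<lambda>y. differential n \<Omega> f y v) x u"


section \<open>Linear algebra\<close>

text \<open>
  The nonnegative self-adjoint square root. It is applied only to nonnegative self-adjoint
  operators that differ by a finite-rank one from \<open>0\<close> or from the identity; for these it exists
  and is unique.
\<close>

definition op_sqrt :: "('a::real_inner \<Rightarrow> 'a) \<Rightarrow> 'a \<Rightarrow> 'a"
  where "op_sqrt A = (THE S. linear S \<and> (\<forall>x y. S x \<bullet> y = x \<bullet> S y) \<and> (\<forall>x. 0 \<le> S x \<bullet> x) \<and> S \<circ> S = A)"

text \<open>
  The \<open>n\<close> singular values of an operator on \<open>\<real>\<^sup>n\<close>, in decreasing order and with multiplicity; the
  list starts at index \<open>0\<close>, so \<open>\<lambda>\<^sub>j\<close> is its entry at \<open>j - 1\<close>.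
\<close>

definition singular_values :: "nat \<Rightarrow> (rseq \<Rightarrow> rseq) \<Rightarrow> real list"
  where "singular_values n D = (THE \<sigma>. sorted_wrt (\<ge>) \<sigma> \<and>
    (\<forall>\<mu>. count_list \<sigma> \<mu> = dim {v \<in> Rn n. op_sqrt (adjoint D \<circ> D) v = \<mu> *\<^sub>R v}))"

definition op_rank :: "nat \<Rightarrow> (rseq \<Rightarrow> rseq) \<Rightarrow> nat"
  where "op_rank n D = dim (D ` Rn n)"

definition orthonormal_list :: "'a::real_inner list \<Rightarrow> bool"
  where "orthonormal_list vs \<longleftrightarrow>
    (\<forall>i<length vs. \<forall>j<length vs. vs ! i \<bullet> vs ! j = (if i = j then 1 else 0))"

definition normal_part :: "'a::real_inner set \<Rightarrow> 'a \<Rightarrow> 'a"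
  where "normal_part T Z = (THE Y. (\<forall>X\<in>T. X \<bullet> Y = 0) \<and> Z - Y \<in> T)"


section \<open>Alternating forms\<close>

text \<open>
  A \<open>k\<close>-form at a point is represented by its values on lists of \<open>k\<close> vectors; the values on lists
  of other lengths are irrelevant.
\<close>

type_synonym 'a form = "'a list \<Rightarrow> real"

definition delete_nth :: "nat \<Rightarrow> 'a list \<Rightarrow> 'a list"
  where "delete_nth i vs = take i vs @ drop (Suc i) vs"

definition alternating_form :: "'a::real_vector set \<Rightarrow> nat \<Rightarrow> 'a form \<Rightarrow> bool"
  where "alternating_form W k \<xi> \<longleftrightarrow>
    (\<forall>vs i. length vs = k \<and> set vs \<subseteq> W \<and> i < k \<longrightarrow>
      (\<forall>a\<in>W. \<forall>b\<in>W. \<forall>c. \<xi> (vs[i := a + c *\<^sub>R b]) = \<xi> (vs[i := a]) + c * \<xi> (vs[i := b]))) \<and>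
    (\<forall>vs i j. length vs = k \<and> set vs \<subseteq> W \<and> i < j \<and> j < k \<and> vs ! i = vs ! j \<longrightarrow> \<xi> vs = 0)"

definition flat :: "'a::real_inner \<Rightarrow> 'a \<Rightarrow> real"
  where "flat v = (\<lambda>w. v \<bullet> w)"

definition interior_mult :: "'a \<Rightarrow> 'a form \<Rightarrow> 'a form"
  where "interior_mult v \<xi> = (\<lambda>vs. \<xi> (v # vs))"

text \<open>
  Wedge product of a covector with a form, normalised so that \<open>\<alpha>\<^sub>1 \<and> \<dots> \<and> \<alpha>\<^sub>k\<close> takes the value
  \<open>det (\<alpha>\<^sub>i (v\<^sub>j))\<close>.
\<close>

definition wedge1 :: "('a \<Rightarrow> real) \<Rightarrow> 'a form \<Rightarrow> 'a form"
  where "wedge1 \<alpha> \<xi> = (\<lambda>vs. \<Sum>i<length vs. (-1) ^ i * \<alpha> (vs ! i) * \<xi> (delete_nth i vs))"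

definition wedge_covectors :: "('a \<Rightarrow> real) list \<Rightarrow> 'a form"
  where "wedge_covectors \<alpha>s = foldr wedge1 \<alpha>s (\<lambda>_. 1)"

definition smooth_form ::
    "'a::real_normed_vector set \<Rightarrow> 'a set \<Rightarrow> nat \<Rightarrow> ('a \<Rightarrow> 'a form) \<Rightarrow> bool"
  where "smooth_form W U k \<omega> \<longleftrightarrow>
    (\<forall>p\<in>U. alternating_form W k (\<omega> p)) \<and>
    (\<forall>vs. length vs = k \<and> set vs \<subseteq> W \<longrightarrow> smooth_on W U (\<lambda>p. \<omega> p vs))"

text \<open>For constant vector fields the Lie bracket terms of the invariant formula vanish.\<close>

definition ext_deriv :: "'a::real_normed_vector set \<Rightarrow> ('a \<Rightarrow> 'a form) \<Rightarrow> 'a \<Rightarrow> 'a form"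
  where "ext_deriv U \<omega> p = (\<lambda>vs. \<Sum>i<length vs.
    (-1) ^ i * frechet_derivative (\<lambda>q. \<omega> q (delete_nth i vs)) (at p within U) (vs ! i))"

definition closed_form :: "'a::real_normed_vector set \<Rightarrow> 'a set \<Rightarrow> nat \<Rightarrow> ('a \<Rightarrow> 'a form) \<Rightarrow> bool"
  where "closed_form W U k \<omega> \<longleftrightarrow>
    (\<forall>p\<in>U. \<forall>vs. length vs = Suc k \<and> set vs \<subseteq> W \<longrightarrow> ext_deriv U \<omega> p vs = 0)"

definition comass :: "'a::real_inner set \<Rightarrow> nat \<Rightarrow> 'a form \<Rightarrow> real"
  where "comass W k \<xi> = (SUP vs\<in>{vs. length vs = k \<and> set vs \<subseteq> W \<and> orthonormal_list vs}. \<xi> vs)"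

definition calibration :: "'a::real_inner set \<Rightarrow> 'a set \<Rightarrow> nat \<Rightarrow> ('a \<Rightarrow> 'a form) \<Rightarrow> bool"
  where "calibration W U k \<omega> \<longleftrightarrow>
    smooth_form W U k \<omega> \<and> closed_form W U k \<omega> \<and> (\<forall>p\<in>U. comass W k (\<omega> p) \<le> 1)"


section \<open>The graph of a map\<close>

text \<open>Below, \<open>D\<close> stands for the differential of \<open>F\<close> at the point \<open>x\<close> under consideration.\<close>

definition G_op :: "(rseq \<Rightarrow> rseq) \<Rightarrow> rseq \<Rightarrow> rseq"
  where "G_op D v = v + adjoint D (D v)"

definition H_op :: "(rseq \<Rightarrow> rseq) \<Rightarrow> rseq \<Rightarrow> rseq"
  where "H_op D w = w + D (adjoint D w)"

definition tangent_iso :: "(rseq \<Rightarrow> rseq) \<Rightarrow> rseq \<Rightarrow> rseq \<times> rseq"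
  where "tangent_iso D v = (inv (op_sqrt (G_op D)) v, D (inv (op_sqrt (G_op D)) v))"

definition normal_iso :: "(rseq \<Rightarrow> rseq) \<Rightarrow> rseq \<Rightarrow> rseq \<times> rseq"
  where "normal_iso D w = (- adjoint D (inv (op_sqrt (H_op D)) w), inv (op_sqrt (H_op D)) w)"

definition tangent_space :: "nat \<Rightarrow> (rseq \<Rightarrow> rseq) \<Rightarrow> (rseq \<times> rseq) set"
  where "tangent_space n D = {(v, D v) | v. v \<in> Rn n}"

text \<open>
  An orthonormal basis of the tangent space. It is positively oriented, because its projection
  to \<open>\<real>\<^sup>n\<close> is the image of the standard basis under \<open>G\<^sup>-\<^sup>1\<^sup>/\<^sup>2\<close>, which has positive determinant.
\<close>

definition tangent_frame :: "(rseq \<Rightarrow> rseq) \<Rightarrow> nat \<Rightarrow> rseq \<times> rseq"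
  where "tangent_frame D i = tangent_iso D (unit_vec i)"

definition J_op :: "nat \<Rightarrow> (rseq \<Rightarrow> rseq) \<Rightarrow> rseq \<times> rseq \<Rightarrow> rseq \<times> rseq"
  where "J_op n D X = normal_iso D (D (inv_into (Rn n) (tangent_iso D) X))"

definition vol_form :: "nat \<Rightarrow> (rseq \<Rightarrow> rseq) \<Rightarrow> (rseq \<times> rseq) form"
  where "vol_form n D = wedge_covectors (map (\<lambda>i. flat (tangent_frame D i)) [0..<n])"

definition Psi_op :: "nat \<Rightarrow> (rseq \<Rightarrow> rseq) \<Rightarrow> (rseq \<times> rseq) form \<Rightarrow> (rseq \<times> rseq) form"
  where "Psi_op n D \<xi> = (\<lambda>vs. \<Sum>i<n.
    wedge1 (flat (J_op n D (tangent_frame D i))) (interior_mult (tangent_frame D i) \<xi>) vs)"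

text \<open>The value at \<open>(x, y)\<close> depends on \<open>x\<close> only: parallel extension along the second factor.\<close>

definition Psi_form ::
    "nat \<Rightarrow> rseq set \<Rightarrow> (rseq \<Rightarrow> rseq) \<Rightarrow> nat \<Rightarrow> rseq \<times> rseq \<Rightarrow> (rseq \<times> rseq) form"
  where "Psi_form n \<Omega> F l p =
    (let D = differential n \<Omega> F (fst p) in (Psi_op n D ^^ l) (vol_form n D))"

text \<open>On lists of length \<open>n\<close> the series is a finite sum, as \<open>\<Psi>\<^sup>l(F) = 0\<close> for \<open>l > n\<close>.\<close>

definition Theta ::
    "nat \<Rightarrow> rseq set \<Rightarrow> (rseq \<Rightarrow> rseq) \<Rightarrow> rseq \<times> rseq \<Rightarrow> (rseq \<times> rseq) form"
  where "Theta n \<Omega> F p = (\<lambda>vs. Psi_form n \<Omega> F 0 p vs -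
    (\<Sum>k. let l = Suc k in (-1) ^ l * ((real l - 1) / fact l) * Psi_form n \<Omega> F l p vs))"

definition graph_map :: "(rseq \<Rightarrow> rseq) \<Rightarrow> rseq \<Rightarrow> rseq \<times> rseq"
  where "graph_map F x = (x, F x)"

text \<open>
  The second fundamental form of the graph at \<open>(x, F x)\<close>, for tangent vectors \<open>X\<close>, \<open>Y\<close>: the
  normal part of the second derivative of the parametrisation in the directions that it maps
  to \<open>X\<close> and \<open>Y\<close>, which are their first components.
\<close>

definition second_fundamental_form ::
    "nat \<Rightarrow> rseq set \<Rightarrow> (rseq \<Rightarrow> rseq) \<Rightarrow> rseq \<Rightarrow> rseq \<times> rseq \<Rightarrow> rseq \<times> rseq \<Rightarrow> rseq \<times> rseq"
  where "second_fundamental_form n \<Omega> F x X Y =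
    normal_part (tangent_space n (differential n \<Omega> F x))
      (second_differential n \<Omega> (graph_map F) x (fst X) (fst Y))"

definition mean_curvature ::
    "nat \<Rightarrow> rseq set \<Rightarrow> (rseq \<Rightarrow> rseq) \<Rightarrow> rseq \<Rightarrow> rseq \<times> rseq"
  where "mean_curvature n \<Omega> F x =
    (let e = tangent_frame (differential n \<Omega> F x)
     in \<Sum>i<n. second_fundamental_form n \<Omega> F x (e i) (e i))"

definition minimal_graph :: "nat \<Rightarrow> rseq set \<Rightarrow> (rseq \<Rightarrow> rseq) \<Rightarrow> bool"
  where "minimal_graph n \<Omega> F \<longleftrightarrow> (\<forall>x\<in>\<Omega>. mean_curvature n \<Omega> F x = 0)"

definition max_rank :: "nat \<Rightarrow> rseq set \<Rightarrow> (rseq \<Rightarrow> rseq) \<Rightarrow> nat"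
  where "max_rank n \<Omega> F = (SUP x\<in>\<Omega>. op_rank n (differential n \<Omega> F x))"

end

theory Submission
  imports Defs "Jordan_Normal_Form.Determinant"
begin

text \<open>
  Since \<open>\<Psi>\<close> acts as a derivation with \<open>e\<^sub>i \<mapsto> J e\<^sub>i \<mapsto> 0\<close>, the numbers \<open>\<Psi>\<^sup>l(F) / l!\<close> are the
  coefficients of the polynomial \<open>p(t) = det \<langle>e\<^sub>i + t J e\<^sub>i, v\<^sub>j\<rangle>\<close>, and \<open>\<Theta>(F) = p(-1) + p'(-1)\<close>.

  Closedness: \<open>e - J e = (G\<^sup>1\<^sup>/\<^sup>2, 0)\<close>, so \<open>\<Theta>(F)\<close> is the Poincare-Cartan form
  \<open>L dx + \<Sum> (\<partial>L/\<partial>p\<^sub>a\<^sub>k) (dy\<^sub>a - p\<^sub>a\<^sub>j dx\<^sub>j) \<and> \<iota>\<^sub>k dx\<close> of the area integrand \<open>L = (det G)\<^sup>1\<^sup>/\<^sup>2\<close>, and its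
  exterior derivative is the Euler-Lagrange expression of \<open>F\<close>.

  Comass: in singular bases the form involves only products with one factor from each orthonormal
  pair of a tangent and a normal vector, so by the torus lemma it suffices to evaluate it at
  \<open>\<Prod>(cos t\<^sub>i e\<^sub>i + sin t\<^sub>i \<nu>\<^sub>i)\<close>. There it equals \<open>\<Prod>cos t\<^sub>i\<close> plus terms of order at least two in the
  \<open>\<lambda>\<^sub>i sin t\<^sub>i\<close>, which \<open>1 - \<Prod>cos t\<^sub>i\<close> dominates if the products \<open>\<lambda>\<^sub>j \<lambda>\<^sub>k\<close> are small.
\<close>

text \<open>The hypothesis bounds only products, so the first singular value may be arbitrarily
  large. It is harmless because every error monomial has factors
  \<open>\<lambda>\<^sub>i sin t\<^sub>i\<close> for at least two distinct indices, so the large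
  value always meets a partner that tames it. With tau^2 = eps / (r - 1) at most one singular value
  exceeds tau. Cauchy-Schwarz bounds the square of the sum of tau |sin t_i| by tau^2 r times the sum
  S of the squared sines, and r <= 2 (r - 1) makes tau^2 r at most 2 eps, whatever the rank: hence
  the denominator r - 1. The choice eps = 1/200 gives 1/100, small enough both for S <= 1 and for S
  > 1.

  The torus lemma is stated for an arbitrary linear functional of the polynomial p, so the weights
  of the series enter only the scalar estimate. As the dimensions are variables, all operators act
  on one infinite-dimensional, incomplete space; adjoints, square roots and singular vectors are
  built from the factorisation of the differential through \<open>Rn n\<close>.\<close>

section \<open>Determinants of functions\<close>

text \<open>With index functions a row or column replacement is an \<open>if\<close>, and the size
  may be a variable. The ring is general because determinants of real polynomials in t occur beside
  real ones.\<close>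

definition dt :: "nat \<Rightarrow> (nat \<Rightarrow> nat \<Rightarrow> 'a::comm_ring_1) \<Rightarrow> 'a"
  where "dt n M = Determinant.det (Matrix.mat n n (\<lambda>(i, j). M i j))"

lemma dt_leibniz:
  "dt n M = (\<Sum>p | p permutes {0..<n}. signof p * (\<Prod>i\<in>{0..<n}. M i (p i)))"
proof -
  have "(\<Prod>i\<in>{0..<n}. Matrix.mat n n (\<lambda>(i, j). M i j) $$ (i, p i)) = (\<Prod>i\<in>{0..<n}. M i (p i))"
    if "p permutes {0..<n}" for p
    using that by (intro prod.cong) (auto dest: permutes_in_image)
  then show ?thesis
    unfolding dt_def by (subst det_def'[where n = n]) (auto intro!: sum.cong)
qed

lemma dt_cong: "(\<And>i j. i < n \<Longrightarrow> j < n \<Longrightarrow> M i j = N i j) \<Longrightarrow> dt n M = dt n N"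
  unfolding dt_def by (rule arg_cong[where f = Determinant.det]) (auto intro!: eq_matI)

lemma dt_0 [simp]: "dt 0 M = 1"
  by (simp add: dt_def det_dim_zero)

lemma dt_transpose: "dt n (\<lambda>i j. M j i) = dt n M"
proof -
  have "Matrix.mat n n (\<lambda>(i, j). M j i) = Matrix.transpose_mat (Matrix.mat n n (\<lambda>(i, j). M i j))"
    by (auto intro!: eq_matI)
  then show ?thesis
    unfolding dt_def by (metis det_transpose mat_carrier)
qed

lemma dt_mult: "dt n (\<lambda>i j. \<Sum>k<n. A i k * B k j) = dt n A * dt n B"
proof -
  have "Matrix.mat n n (\<lambda>(i, j). \<Sum>k<n. A i k * B k j)
      = Matrix.mat n n (\<lambda>(i, j). A i j) * Matrix.mat n n (\<lambda>(i, j). B i j)"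
    by (auto intro!: eq_matI sum.cong simp: scalar_prod_def lessThan_atLeast0)
  then show ?thesis
    unfolding dt_def by (metis det_mult mat_carrier)
qed

lemma dt_id [simp]: "dt n (\<lambda>i j. if i = j then 1 else 0) = 1"
proof -
  have "Matrix.mat n n (\<lambda>(i, j). if i = j then 1 else (0::'a)) = 1\<^sub>m n"
    by (auto intro!: eq_matI)
  then show ?thesis
    by (simp add: dt_def)
qed

lemma dt_orthogonal_square:
  assumes "\<And>i j. i < n \<Longrightarrow> j < n \<Longrightarrow> (\<Sum>k<n. Q i k * Q j k) = (if i = j then 1 else 0)"
  shows "dt n Q * dt n Q = 1"
proof -
  have "dt n Q * dt n Q = dt n (\<lambda>i j. \<Sum>k<n. Q i k * Q j k)"
    using dt_mult[of n Q "\<lambda>i j. Q j i"] dt_transpose[of n Q] by metis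
  also have "\<dots> = dt n (\<lambda>i j. if i = j then 1 else 0)"
    by (rule dt_cong) (use assms in auto)
  finally show ?thesis by simp
qed

text \<open>Every permutation meets row \<open>k\<close> once, and the remaining product does not
  involve \<open>f\<close>. Linearity in a row and the derivative of a determinant both reduce to
  this form.\<close>

lemma dt_row_split:
  assumes "k < n"
  shows "dt n (\<lambda>i j. if i = k then f j else M i j)
    = (\<Sum>p | p permutes {0..<n}. f (p k) * (signof p * (\<Prod>i\<in>{0..<n} - {k}. M i (p i))))"
proof -
  have "(\<Prod>i\<in>{0..<n}. if i = k then f (p i) else M i (p i))
      = f (p k) * (\<Prod>i\<in>{0..<n} - {k}. M i (p i))" for p
    using assms by (subst prod.remove[of _ k]) (auto intro!: arg_cong2[where f = "(*)"] prod.cong)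
  then show ?thesis
    by (simp add: dt_leibniz mult_ac)
qed

lemma dt_row_sum:
  assumes "k < n"
  shows "dt n (\<lambda>i j. if i = k then (\<Sum>l\<in>S. c l * R l j) else M i j)
    = (\<Sum>l\<in>S. c l * dt n (\<lambda>i j. if i = k then R l j else M i j))"
  by (simp add: dt_row_split[OF assms] sum_distrib_left sum_distrib_right mult_ac sum.swap[of _ S])

lemma dt_row_add:
  assumes "k < n"
  shows "dt n (\<lambda>i j. if i = k then f j + c * g j else M i j)
    = dt n (\<lambda>i j. if i = k then f j else M i j) + c * dt n (\<lambda>i j. if i = k then g j else M i j)"
  by (simp add: dt_row_split[OF assms] algebra_simps sum.distrib sum_distrib_left)

lemma dt_col_add:
  assumes "k < n"
  shows "dt n (\<lambda>i j. if j = k then f i + c * g i else M i j)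
    = dt n (\<lambda>i j. if j = k then f i else M i j) + c * dt n (\<lambda>i j. if j = k then g i else M i j)"
  using dt_row_add[OF assms, of f c g "\<lambda>i j. M j i"]
  by (simp only: dt_transpose[of n "\<lambda>i j. if j = k then _ i else M i j", symmetric])

lemma dt_equal_rows:
  assumes "a < n" "b < n" "a \<noteq> b" "\<And>j. j < n \<Longrightarrow> M a j = M b j"
  shows "dt n M = 0"
  unfolding dt_def using assms
  by (intro det_identical_rows[of _ n a b]) (auto intro!: eq_vecI)

lemma dt_equal_cols:
  assumes "a < n" "b < n" "a \<noteq> b" "\<And>i. i < n \<Longrightarrow> M i a = M i b"
  shows "dt n M = 0"
  using dt_equal_rows[OF assms(1-3), of "\<lambda>i j. M j i"] assms(4) dt_transpose[of n M] by metis

text \<open>All summands except \<open>l = k\<close> repeat a row. Combined with an inverse matrix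
  this yields Cramer's rule and Jacobi's formula.\<close>

lemma dt_row_combination:
  assumes "k < n"
  shows "dt n (\<lambda>i j. if i = k then (\<Sum>l<n. c l * M l j) else M i j) = c k * dt n M"
proof -
  have "dt n (\<lambda>i j. if i = k then M l j else M i j) = (if l = k then dt n M else 0)" if "l < n" for l
    using assms that by (auto intro!: dt_cong intro: dt_equal_rows[of k _ l])
  then have "dt n (\<lambda>i j. if i = k then (\<Sum>l<n. c l * M l j) else M i j)
      = (\<Sum>l<n. c l * (if l = k then dt n M else 0))"
    using assms by (subst dt_row_sum) (auto intro!: sum.cong)
  also have "\<dots> = c k * dt n M"
    using assms by (subst sum.remove[of _ k]) auto
  finally show ?thesis .
qed

text \<open>The increasing enumeration of the indices other than \<open>j\<close>, which numbers the
  rows or columns of a minor.\<close>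

definition skip :: "nat \<Rightarrow> nat \<Rightarrow> nat"
  where "skip j k = (if k < j then k else Suc k)"

lemma skip_0 [simp]: "skip 0 k = Suc k" and skip_neq [simp]: "skip j k \<noteq> j"
  by (simp_all add: skip_def)

lemma dt_laplace_row:
  "dt (Suc n) M = (\<Sum>j<Suc n. (-1) ^ j * M 0 j * dt n (\<lambda>i k. M (Suc i) (skip j k)))"
proof -
  have "mat_delete (Matrix.mat (Suc n) (Suc n) (\<lambda>(i, j). M i j)) 0 j
      = Matrix.mat n n (\<lambda>(i, k). M (Suc i) (skip j k))" if "j < Suc n" for j
    using that by (auto intro!: eq_matI simp: mat_delete_def skip_def)
  then show ?thesis
    unfolding dt_def
    by (subst laplace_expansion_row[where n = "Suc n" and i = 0]) (auto simp: cofactor_def intro!: sum.cong)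
qed

lemma dt_laplace_col:
  assumes "j < Suc n"
  shows "dt (Suc n) M = (\<Sum>i<Suc n. (-1) ^ (i + j) * M i j * dt n (\<lambda>l k. M (skip i l) (skip j k)))"
proof -
  have "mat_delete (Matrix.mat (Suc n) (Suc n) (\<lambda>(i, j). M i j)) i j
      = Matrix.mat n n (\<lambda>(l, k). M (skip i l) (skip j k))" if "i < Suc n" for i
    using that assms by (auto intro!: eq_matI simp: mat_delete_def skip_def)
  then show ?thesis
    unfolding dt_def using assms
    by (subst laplace_expansion_column[where n = "Suc n" and j = j])
      (auto simp: cofactor_def mult_ac intro!: sum.cong)
qed

text \<open>Both determinants are expanded along the column \<open>f\<close>: the minors agree and
  only the sign of the position differs. It is the sign in \<open>wedge1\<close> when interior
  multiplication has put a vector in front.\<close>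

lemma dt_move_col:
  assumes "j < n"
  shows "dt n (\<lambda>i k. case k of 0 \<Rightarrow> f i | Suc k \<Rightarrow> M i (skip j k))
    = (-1) ^ j * dt n (\<lambda>i k. if k = j then f i else M i k)"
proof -
  obtain m where n: "n = Suc m" using assms by (cases n) auto
  have "dt n (\<lambda>i k. if k = j then f i else M i k)
      = (\<Sum>i<Suc m. (-1) ^ (i + j) * f i * dt m (\<lambda>l k. M (skip i l) (skip j k)))"
    using assms unfolding n
    by (subst dt_laplace_col[of j]) (auto simp del: sum.lessThan_Suc)
  moreover have "dt n (\<lambda>i k. case k of 0 \<Rightarrow> f i | Suc k \<Rightarrow> M i (skip j k))
      = (\<Sum>i<Suc m. (-1) ^ i * f i * dt m (\<lambda>l k. M (skip i l) (skip j k)))"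
    unfolding n
    by (subst dt_laplace_col[of 0]) (auto simp del: sum.lessThan_Suc)
  moreover have "(-1) ^ j * ((-1) ^ (i + j) * x * y) = (-1) ^ i * x * y" for i and x y :: 'a
    by (metis (no_types) add.commute left_minus_one_mult_self mult.assoc power_add)
  ultimately show ?thesis
    by (simp only: sum_distrib_left)
qed

section \<open>Derivatives of determinants\<close>

lemma pderiv_dt_row:
  fixes M :: "nat \<Rightarrow> nat \<Rightarrow> real poly"
  shows "pderiv (dt n M) = (\<Sum>k<n. dt n (\<lambda>i j. if i = k then pderiv (M i j) else M i j))"
proof -
  have sm: "pderiv (\<Sum>p\<in>A. f p) = (\<Sum>p\<in>A. pderiv (f p))" for A :: "(nat \<Rightarrow> nat) set" and f :: "_ \<Rightarrow> real poly"
    using higher_pderiv_sum[of 1 f A] by simp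
  have s: "pderiv (signof p * q) = signof p * pderiv q" for p :: "nat \<Rightarrow> nat" and q :: "real poly"
    by (simp add: sign_def pderiv_minus)
  have "pderiv (dt n M) = (\<Sum>p | p permutes {0..<n}. \<Sum>k<n. pderiv (M k (p k)) *
      (signof p * (\<Prod>i\<in>{0..<n} - {k}. M i (p i))))"
    unfolding dt_leibniz sm s pderiv_prod sum_distrib_left lessThan_atLeast0
    by (intro sum.cong) (auto simp only: mult_ac)
  also have "\<dots> = (\<Sum>k<n. dt n (\<lambda>i j. if i = k then pderiv (M k j) else M i j))"
    by (subst sum.swap) (auto simp: dt_row_split intro!: sum.cong)
  finally show ?thesis
    by (simp cong: if_cong)
qed

lemma pderiv_dt_col:
  fixes M :: "nat \<Rightarrow> nat \<Rightarrow> real poly"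
  shows "pderiv (dt n M) = (\<Sum>k<n. dt n (\<lambda>i j. if j = k then pderiv (M i j) else M i j))"
  using pderiv_dt_row[of n "\<lambda>i j. M j i"]
  by (simp only: dt_transpose[of n M] dt_transpose[of n "\<lambda>i j. if j = _ then _ i j else M i j", symmetric])

lemma poly_dt: "poly (dt n M) t = dt n (\<lambda>i j. poly (M i j) t)" for t :: real
proof -
  have "poly (signof p * q) t = signof p * poly q t" for p :: "nat \<Rightarrow> nat" and q
    by (simp add: sign_def)
  then show ?thesis
    by (simp only: dt_leibniz poly_sum poly_prod)
qed

lemma dt_scale_rows: "dt n (\<lambda>i j. c i * M i j) = (\<Prod>i<n. c i) * dt n M"
  by (simp add: dt_leibniz prod.distrib sum_distrib_left lessThan_atLeast0 mult_ac)

lemma dt_col_sum: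
  assumes "k < n"
  shows "dt n (\<lambda>i j. if j = k then (\<Sum>l\<in>S. c l * R l i) else M i j)
    = (\<Sum>l\<in>S. c l * dt n (\<lambda>i j. if j = k then R l i else M i j))"
  using dt_row_sum[OF assms, of c R S "\<lambda>i j. M j i"]
  by (simp only: dt_transpose[of n "\<lambda>i j. if j = k then _ i else M i j", symmetric])

lemma has_derivative_dt:
  fixes M :: "'a::real_normed_vector \<Rightarrow> nat \<Rightarrow> nat \<Rightarrow> real"
  assumes "\<And>i j. i < n \<Longrightarrow> j < n \<Longrightarrow> ((\<lambda>x. M x i j) has_derivative M' i j) (at x within S)"
  shows "((\<lambda>x. dt n (M x)) has_derivative
    (\<lambda>h. \<Sum>k<n. dt n (\<lambda>i j. if i = k then M' i j h else M x i j))) (at x within S)"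
proof -
  have "((\<lambda>x. \<Prod>i\<in>{0..<n}. M x i (p i)) has_derivative
      (\<lambda>h. \<Sum>k\<in>{0..<n}. M' k (p k) h * (\<Prod>i\<in>{0..<n} - {k}. M x i (p i)))) (at x within S)"
    if "p permutes {0..<n}" for p
    using that by (intro has_derivative_prod assms) (auto dest: permutes_in_image)
  then have "((\<lambda>x. dt n (M x)) has_derivative (\<lambda>h. \<Sum>p | p permutes {0..<n}. signof p *
      (\<Sum>k\<in>{0..<n}. M' k (p k) h * (\<Prod>i\<in>{0..<n} - {k}. M x i (p i))))) (at x within S)"
    unfolding dt_leibniz by (intro has_derivative_sum has_derivative_mult_right) auto
  moreover have "(\<Sum>p | p permutes {0..<n}. signof p *
      (\<Sum>k\<in>{0..<n}. M' k (p k) h * (\<Prod>i\<in>{0..<n} - {k}. M x i (p i))))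
      = (\<Sum>k<n. dt n (\<lambda>i j. if i = k then M' i j h else M x i j))" for h
  proof -
    have "(\<Sum>k<n. dt n (\<lambda>i j. if i = k then M' i j h else M x i j))
        = (\<Sum>k<n. dt n (\<lambda>i j. if i = k then M' k j h else M x i j))"
      by (simp cong: if_cong)
    also have "\<dots> = (\<Sum>k<n. \<Sum>p | p permutes {0..<n}. M' k (p k) h *
        (signof p * (\<Prod>i\<in>{0..<n} - {k}. M x i (p i))))"
      by (auto simp: dt_row_split intro!: sum.cong)
    finally show ?thesis
      by (subst (asm) sum.swap) (simp add: sum_distrib_left lessThan_atLeast0 mult_ac)
  qed
  ultimately show ?thesis
    by (simp only:)
qed

section \<open>The scalar estimate\<close>

text \<open>
  For \<open>q(t) = \<Prod>(a i + t b i)\<close>, \<open>Nf\<close> is \<open>q'(1)\<close> and \<open>Ef\<close> is \<open>q(0) - q(1) + q'(1)\<close>, the sum of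
  \<open>l - 1\<close> times the coefficient of \<open>t\<^sup>l\<close> over \<open>l \<ge> 2\<close>.
\<close>

definition Nf :: "('i \<Rightarrow> real) \<Rightarrow> ('i \<Rightarrow> real) \<Rightarrow> 'i set \<Rightarrow> real"
  where "Nf a b A = (\<Sum>k\<in>A. b k * (\<Prod>i\<in>A - {k}. a i + b i))"

definition Ef :: "('i \<Rightarrow> real) \<Rightarrow> ('i \<Rightarrow> real) \<Rightarrow> 'i set \<Rightarrow> real"
  where "Ef a b A = (\<Prod>i\<in>A. a i) - (\<Prod>i\<in>A. a i + b i) + Nf a b A"

lemma Nf_empty [simp]: "Nf a b {} = 0" and Ef_empty [simp]: "Ef a b {} = 0"
  by (simp_all add: Nf_def Ef_def)

lemma Nf_insert:
  assumes "finite A" "x \<notin> A"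
  shows "Nf a b (insert x A) = b x * (\<Prod>i\<in>A. a i + b i) + (a x + b x) * Nf a b A"
proof -
  have "(\<Prod>i\<in>insert x A - {k}. a i + b i) = (a x + b x) * (\<Prod>i\<in>A - {k}. a i + b i)" if "k \<in> A" for k
    using assms that by (subst insert_Diff_if) auto
  then show ?thesis
    using assms by (auto simp: Nf_def sum_distrib_left mult_ac intro!: sum.cong)
qed

text \<open>The new value \<open>b x\<close> occurs only against \<open>Nf\<close>, each summand of
  which already has a factor from \<open>b\<close>; so the error has no terms linear in
  \<open>b\<close>.\<close>

lemma Ef_insert:
  assumes "finite A" "x \<notin> A"
  shows "Ef a b (insert x A) = a x * Ef a b A + b x * Nf a b A"
  using assms by (simp add: Ef_def Nf_insert algebra_simps)

text \<open>Each summand of \<open>Nf\<close> has one factor \<open>b k\<close> outside the product.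
  The extra factor \<open>\<mu>\<close> is charged to it, so a bound on pairwise products
  suffices.\<close>

lemma Nf_scaled_dominated:
  assumes "finite A" "\<And>i. i \<in> A \<Longrightarrow> \<bar>a i\<bar> \<le> a' i" "\<And>i. i \<in> A \<Longrightarrow> \<bar>b i\<bar> \<le> b' i"
    and "\<And>i. i \<in> A \<Longrightarrow> \<bar>\<mu> * b i\<bar> \<le> \<tau> * b' i"
  shows "\<bar>\<mu> * Nf a b A\<bar> \<le> \<tau> * Nf a' b' A"
proof -
  have "\<bar>\<mu> * Nf a b A\<bar> \<le> (\<Sum>k\<in>A. \<bar>\<mu> * b k\<bar> * (\<Prod>i\<in>A - {k}. \<bar>a i + b i\<bar>))"
    unfolding Nf_def sum_distrib_left
    by (rule order_trans[OF sum_abs]) (simp add: abs_mult abs_prod mult_ac)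
  also have "\<dots> \<le> (\<Sum>k\<in>A. (\<tau> * b' k) * (\<Prod>i\<in>A - {k}. a' i + b' i))"
  proof (intro sum_mono mult_mono prod_mono)
    fix k i assume "i \<in> A - {k}"
    then show "0 \<le> \<bar>a i + b i\<bar> \<and> \<bar>a i + b i\<bar> \<le> a' i + b' i"
      using assms(2)[of i] assms(3)[of i] by auto
  qed (use assms(4) in \<open>auto intro: order_trans[OF abs_ge_zero] prod_nonneg\<close>)
  also have "\<dots> = \<tau> * Nf a' b' A"
    by (simp add: Nf_def sum_distrib_left mult_ac)
  finally show ?thesis .
qed

lemma Nf_dominated:
  assumes "finite A" "\<And>i. i \<in> A \<Longrightarrow> \<bar>a i\<bar> \<le> a' i" "\<And>i. i \<in> A \<Longrightarrow> \<bar>b i\<bar> \<le> b' i"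
  shows "\<bar>Nf a b A\<bar> \<le> Nf a' b' A"
  using Nf_scaled_dominated[of A a a' b b' 1 1] assms by simp

text \<open>As a polynomial in the entries of \<open>a\<close> and \<open>b\<close>,
  \<open>Ef\<close> has nonnegative coefficients; the recursions for \<open>Ef\<close> and
  \<open>Nf\<close> make this usable.\<close>

lemma Ef_dominated:
  assumes "finite A" "\<And>i. i \<in> A \<Longrightarrow> \<bar>a i\<bar> \<le> a' i" "\<And>i. i \<in> A \<Longrightarrow> \<bar>b i\<bar> \<le> b' i"
  shows "\<bar>Ef a b A\<bar> \<le> Ef a' b' A"
  using assms
proof (induction A rule: finite_induct)
  case (insert x A)
  have "\<bar>Ef a b (insert x A)\<bar> \<le> \<bar>a x\<bar> * \<bar>Ef a b A\<bar> + \<bar>b x\<bar> * \<bar>Nf a b A\<bar>"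
    unfolding Ef_insert[OF insert(1,2)] by (metis abs_mult abs_triangle_ineq)
  also have "\<dots> \<le> a' x * Ef a' b' A + b' x * Nf a' b' A"
    using insert Nf_dominated[of A a a' b b']
    by (intro add_mono mult_mono) (auto intro: order_trans[OF abs_ge_zero])
  finally show ?case
    by (simp add: Ef_insert insert)
qed simp

lemma Nf_zero:
  assumes "finite B" "finite A" "A \<inter> B = {}" "\<And>i. i \<in> B \<Longrightarrow> b i = 0"
  shows "Nf a b (A \<union> B) = (\<Prod>i\<in>B. a i) * Nf a b A"
  using assms
proof (induction B rule: finite_induct)
  case (insert x B)
  then have "Nf a b (insert x (A \<union> B)) = a x * Nf a b (A \<union> B)"
    by (subst Nf_insert) auto
  with insert show ?case by auto
qed simp

text \<open>
  At most one \<open>l x\<close> exceeds \<open>\<tau>\<close>. It enters the error linearly and only through products with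
  another \<open>l k\<close>, so it may be treated as if it were \<open>\<tau>\<close>.
\<close>

lemma Ef_pairwise_small:
  assumes "finite A" "x \<notin> A" "\<tau> \<ge> 0" "l x \<ge> 0"
    and l: "\<And>k. k \<in> A \<Longrightarrow> 0 \<le> l k \<and> l k \<le> \<tau> \<and> l x * l k \<le> \<tau>\<^sup>2"
  shows "\<bar>Ef c (\<lambda>i. - (l i * s i)) (insert x A)\<bar> \<le> Ef (\<lambda>i. \<bar>c i\<bar>) (\<lambda>i. \<tau> * \<bar>s i\<bar>) (insert x A)"
proof -
  let ?b = "\<lambda>i. - (l i * s i)" and ?c' = "\<lambda>i. \<bar>c i\<bar>" and ?b' = "\<lambda>i. \<tau> * \<bar>s i\<bar>"
  have b: "\<bar>?b i\<bar> \<le> ?b' i" if "i \<in> A" for i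
    using l[OF that] by (simp add: abs_mult mult_right_mono)
  have xb: "\<bar>l x * ?b i\<bar> \<le> \<tau> * ?b' i" if "i \<in> A" for i
    using l[OF that] \<open>l x \<ge> 0\<close> mult_right_mono[of "l x * l i" "\<tau>\<^sup>2" "\<bar>s i\<bar>"]
    by (simp add: abs_mult power2_eq_square mult_ac)
  have "\<bar>Ef c ?b (insert x A)\<bar> \<le> \<bar>c x\<bar> * \<bar>Ef c ?b A\<bar> + \<bar>s x\<bar> * \<bar>l x * Nf c ?b A\<bar>"
    unfolding Ef_insert[OF assms(1,2)]
    by (rule order_trans[OF abs_triangle_ineq]) (simp add: abs_mult mult_ac)
  also have "\<dots> \<le> \<bar>c x\<bar> * Ef ?c' ?b' A + \<bar>s x\<bar> * (\<tau> * Nf ?c' ?b' A)"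
    using Ef_dominated[of A c ?c' ?b ?b'] Nf_scaled_dominated[of A c ?c' ?b ?b' "l x" \<tau>] b xb assms
    by (intro add_mono mult_left_mono) auto
  finally show ?thesis
    unfolding Ef_insert[OF assms(1,2)] by (simp add: mult_ac)
qed

text \<open>Since \<open>a i + y i\<close> is at most \<open>exp (y i)\<close>, a product costs one
  exponential of the sum; the two distinguished indices of an error term cost one factor
  \<open>sum y A\<close> each.\<close>

lemma Ef_le_exp:
  assumes "finite A" "\<And>i. i \<in> A \<Longrightarrow> 0 \<le> a i \<and> a i \<le> 1" "\<And>i. i \<in> A \<Longrightarrow> 0 \<le> y i"
  shows "Ef a y A \<le> (sum y A)\<^sup>2 * exp (sum y A)"
proof -
  \<comment> \<open>The recursion of \<open>Ef\<close> uses \<open>Nf\<close>, and that of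
    \<open>Nf\<close> uses the product, so all bounds share one induction.\<close>
  have "0 \<le> Nf a y A \<and> (\<Prod>i\<in>A. a i + y i) \<le> exp (sum y A) \<and> Nf a y A \<le> sum y A * exp (sum y A)
      \<and> 0 \<le> Ef a y A \<and> Ef a y A \<le> (sum y A)\<^sup>2 * exp (sum y A)"
    using assms
  proof (induction A rule: finite_induct)
    case (insert x A)
    define Y where "Y = sum y A"
    define Q where "Q = (\<Prod>i\<in>A. a i + y i)"
    have Y: "Y \<ge> 0" and x: "0 \<le> a x" "a x \<le> 1" "0 \<le> y x" and Q0: "Q \<ge> 0"
      using insert by (auto simp: Y_def Q_def sum_nonneg prod_nonneg)
    have IH: "0 \<le> Nf a y A" "Q \<le> exp Y" "Nf a y A \<le> Y * exp Y" "0 \<le> Ef a y A" "Ef a y A \<le> Y\<^sup>2 * exp Y"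
      using insert by (auto simp: Y_def Q_def)
    have e: "a x + y x \<le> exp (y x)" and e1: "1 \<le> exp (y x)"
      using x exp_ge_add_one_self[of "y x"] by linarith+
    have Q: "(a x + y x) * Q \<le> exp (y x) * exp Y"
      using e IH Q0 x by (intro mult_mono) auto
    have "y x * Q \<le> y x * (exp (y x) * exp Y)"
      using IH e1 x by (intro mult_left_mono) (auto intro: order_trans[OF IH(2)])
    moreover have "(a x + y x) * Nf a y A \<le> exp (y x) * (Y * exp Y)"
      using e IH x Y by (intro mult_mono) auto
    ultimately have N: "y x * Q + (a x + y x) * Nf a y A \<le> (y x + Y) * exp (y x + Y)"
      by (simp add: exp_add algebra_simps)
    have "a x * Ef a y A \<le> 1 * (Y\<^sup>2 * exp Y)"
      using IH x by (intro mult_mono) auto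
    moreover have "y x * Nf a y A \<le> y x * (Y * exp Y)"
      using IH x by (intro mult_left_mono) auto
    ultimately have "a x * Ef a y A + y x * Nf a y A \<le> (Y\<^sup>2 + y x * Y) * exp Y"
      by (simp add: algebra_simps)
    also have "\<dots> \<le> (y x + Y)\<^sup>2 * (exp (y x) * exp Y)"
      using x Y e1 by (intro mult_mono) (auto simp: power2_eq_square algebra_simps)
    finally have E: "a x * Ef a y A + y x * Nf a y A \<le> (y x + Y)\<^sup>2 * exp (y x + Y)"
      by (simp add: exp_add)
    show ?case
      unfolding Nf_insert[OF insert(1,2)] Ef_insert[OF insert(1,2)] sum.insert[OF insert(1,2)]
        prod.insert[OF insert(1,2)] Y_def[symmetric] Q_def[symmetric]
      using Q N E IH x Q0 by (auto simp: exp_add)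
  qed simp
  then show ?thesis
    by auto
qed

section \<open>Comparison of the error with the product of cosines\<close>

lemma unit_squares_le_1:
  fixes c s :: real
  assumes "c\<^sup>2 + s\<^sup>2 = 1"
  shows "c\<^sup>2 \<le> 1" "s\<^sup>2 \<le> 1"
  using assms zero_le_power2[of c] zero_le_power2[of s] by linarith+

lemma sum_squared_le_card: "(\<Sum>i\<in>A. f i)\<^sup>2 \<le> real (card A) * (\<Sum>i\<in>A. (f i :: real)\<^sup>2)"
  using Cauchy_Schwarz_ineq_sum[of "\<lambda>_. 1" f A] by simp

lemma exp_minus_le: "x \<ge> 0 \<Longrightarrow> exp (- x) \<le> 1 / (1 + x)" for x :: real
  using exp_ge_add_one_self[of x] by (simp add: exp_minus field_simps)

text \<open>Let S be the sum of the squared sines. For S <= 1 the product of cosines is at most 1 -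
  S/3, while the error is at most 3 S/100. For S > 1 the product is at most 2/3, and
  \<open>Ef\<close> is at most \<open>Nf\<close> because increasing every factor increases the
  product; exponential decay in S keeps \<open>Nf\<close> below 1/3.\<close>

lemma torus_error_bound:
  fixes c s :: "'i \<Rightarrow> real"
  assumes A: "finite A" and cs: "\<And>i. i \<in> A \<Longrightarrow> (c i)\<^sup>2 + (s i)\<^sup>2 = 1"
    and \<tau>: "\<tau> \<ge> 0" "\<tau>\<^sup>2 * real (card A) \<le> 1/100"
  shows "(\<Prod>i\<in>A. \<bar>c i\<bar>) + Ef (\<lambda>i. \<bar>c i\<bar>) (\<lambda>i. \<tau> * \<bar>s i\<bar>) A \<le> 1"
proof -
  let ?a = "\<lambda>i. \<bar>c i\<bar>" and ?y = "\<lambda>i. \<tau> * \<bar>s i\<bar>"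
  define S where "S = (\<Sum>i\<in>A. (s i)\<^sup>2)"
  define Y where "Y = (\<Sum>i\<in>A. ?y i)"
  have S0: "S \<ge> 0" and Y0: "Y \<ge> 0"
    using \<tau> by (auto simp: S_def Y_def intro!: sum_nonneg)
  have c1: "0 \<le> ?a i \<and> ?a i \<le> 1" if "i \<in> A" for i
    using cs[OF that] zero_le_power2[of "s i"] abs_square_le_1[of "c i"] by linarith
  have "Y\<^sup>2 = \<tau>\<^sup>2 * (\<Sum>i\<in>A. \<bar>s i\<bar>)\<^sup>2"
    by (simp add: Y_def power_mult_distrib flip: sum_distrib_left)
  also have "\<dots> \<le> \<tau>\<^sup>2 * (real (card A) * S)"
    using sum_squared_le_card[of "\<lambda>i. \<bar>s i\<bar>" A] by (intro mult_left_mono) (auto simp: S_def)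
  also have "\<dots> \<le> S / 100"
    using mult_right_mono[OF \<tau>(2) S0] by (simp add: mult_ac)
  finally have Y2: "Y\<^sup>2 \<le> S / 100" .
  have "(\<Prod>i\<in>A. \<bar>c i\<bar>)\<^sup>2 = (\<Prod>i\<in>A. 1 - (s i)\<^sup>2)"
    unfolding prod_power_distrib using cs by (intro prod.cong) (auto simp: algebra_simps)
  also have "\<dots> \<le> (\<Prod>i\<in>A. exp (- (s i)\<^sup>2))"
  proof (intro prod_mono conjI)
    fix i assume "i \<in> A"
    then show "0 \<le> 1 - (s i)\<^sup>2"
      using cs[of i] zero_le_power2[of "c i"] by linarith
    show "1 - (s i)\<^sup>2 \<le> exp (- (s i)\<^sup>2)"
      using exp_ge_add_one_self[of "- (s i)\<^sup>2"] by simp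
  qed
  also have "\<dots> = (exp (- (S / 2)))\<^sup>2"
    using A by (simp add: exp_sum[symmetric] S_def sum_negf power2_eq_square exp_add[symmetric])
  finally have "(\<Prod>i\<in>A. \<bar>c i\<bar>) \<le> exp (- (S / 2))"
    by (rule power2_le_imp_le) simp
  also have "\<dots> \<le> 1 / (1 + S / 2)"
    using S0 by (intro exp_minus_le) auto
  finally have P: "(\<Prod>i\<in>A. \<bar>c i\<bar>) \<le> 1 / (1 + S / 2)" .
  show ?thesis
  proof (cases "S \<le> 1")
    case True
    have "Y\<^sup>2 \<le> 1\<^sup>2"
      using Y2 True by simp
    then have "Y \<le> 1"
      by (rule power2_le_imp_le) simp
    then have "exp Y \<le> exp 1"
      by simp
    with exp_le have "exp Y \<le> 3"
      by (rule order_trans[rotated])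
    then have "Ef ?a ?y A \<le> Y\<^sup>2 * 3"
      using Ef_le_exp[of A ?a ?y] c1 \<tau> A mult_left_mono[of "exp Y" 3 "Y\<^sup>2"] unfolding Y_def[symmetric]
      by (auto intro: order_trans)
    then have "Ef ?a ?y A \<le> S * 3 / 100"
      using Y2 by simp
    moreover have "1 / (1 + S / 2) \<le> 1 - S / 3"
      using S0 True by (simp add: field_simps mult_left_le)
    ultimately show ?thesis
      using P S0 by linarith
  next
    case False
    \<comment> \<open>After c^2 = 1 - s^2, the cross term is bounded by 2 tau |s| <= s^2/2 + 2
      tau^2, so half of the decay in s^2 survives.\<close>
    have factor: "?a i + ?y i \<le> exp (3/2 * \<tau>\<^sup>2 - (s i)\<^sup>2 / 4)" if "i \<in> A" for i
    proof (rule power2_le_imp_le)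
      have "2 * (?a i * ?y i) \<le> 2 * (1 * ?y i)"
        using c1[OF that] \<tau> by (intro mult_left_mono mult_right_mono) auto
      moreover have "2 * ?y i \<le> (s i)\<^sup>2 / 2 + 2 * \<tau>\<^sup>2"
        using zero_le_power2[of "\<bar>s i\<bar> - 2 * \<tau>"] by (simp add: power2_eq_square algebra_simps)
      moreover have "(?y i)\<^sup>2 \<le> \<tau>\<^sup>2"
      proof -
        have "(s i)\<^sup>2 \<le> 1"
          using cs[OF that] zero_le_power2[of "c i"] by linarith
        then show ?thesis
          by (simp add: power_mult_distrib mult_left_le)
      qed
      ultimately have "(?a i + ?y i)\<^sup>2 \<le> 1 + (3 * \<tau>\<^sup>2 - (s i)\<^sup>2 / 2)"
        using cs[OF that] by (simp add: power2_sum)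
      also have "\<dots> \<le> exp (3 * \<tau>\<^sup>2 - (s i)\<^sup>2 / 2)"
        by (rule exp_ge_add_one_self)
      also have "\<dots> = (exp (3/2 * \<tau>\<^sup>2 - (s i)\<^sup>2 / 4))\<^sup>2"
        by (simp add: power2_eq_square exp_add[symmetric])
      finally show "(?a i + ?y i)\<^sup>2 \<le> (exp (3/2 * \<tau>\<^sup>2 - (s i)\<^sup>2 / 4))\<^sup>2" .
    qed simp
    have prod: "(\<Prod>i\<in>A - {k}. ?a i + ?y i) \<le> exp (1/2 - S / 4)" if k: "k \<in> A" for k
    proof -
      have "(\<Prod>i\<in>A - {k}. ?a i + ?y i) \<le> (\<Prod>i\<in>A - {k}. exp (3/2 * \<tau>\<^sup>2 - (s i)\<^sup>2 / 4))"
        using factor \<tau> by (intro prod_mono) auto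
      also have "\<dots> = exp (3/2 * \<tau>\<^sup>2 * real (card (A - {k})) - (\<Sum>i\<in>A - {k}. (s i)\<^sup>2) / 4)"
        using A by (simp add: exp_sum[symmetric] sum_subtractf sum_divide_distrib)
      \<comment> \<open>Omitting \<open>k\<close> lowers S by at most 1, which costs 1/4, and the
        tau term adds at most 3/200. Rounding up to 1/2 leaves \<open>exp 1\<close>, at most 3,
        after squaring.\<close>
      also have "\<dots> \<le> exp (1/2 - S / 4)"
      proof -
        have "(\<Sum>i\<in>A - {k}. (s i)\<^sup>2) \<ge> S - 1"
          using A k unit_squares_le_1[OF cs[OF k]] by (simp add: S_def sum_diff1)
        moreover have "\<tau>\<^sup>2 * real (card (A - {k})) \<le> 1/100"
          using A by (intro order_trans[OF mult_left_mono \<tau>(2)]) (auto intro: card_mono)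
        ultimately show ?thesis
          by simp
      qed
      finally show ?thesis .
    qed
    have "Nf ?a ?y A \<le> (\<Sum>k\<in>A. ?y k * exp (1/2 - S / 4))"
      unfolding Nf_def using prod \<tau> by (intro sum_mono mult_left_mono) auto
    also have "\<dots> = Y * exp (1/2 - S / 4)"
      by (simp add: Y_def sum_distrib_right)
    also have "\<dots> \<le> 1/3"
    proof (rule power2_le_imp_le)
      have "(Y * exp (1/2 - S / 4))\<^sup>2 = Y\<^sup>2 * (exp 1 * exp (- (S / 2)))"
        by (simp add: power_mult_distrib power2_eq_square[of "exp _"] flip: exp_add)
      also have "\<dots> \<le> S / 100 * (3 * (1 / (1 + S / 2)))"
        using Y2 S0 exp_le exp_minus_le[of "S / 2"] by (intro mult_mono) auto
      \<comment> \<open>Since S / (1 + S/2) < 2, the left side is below 6/100.\<close>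
      also have "\<dots> \<le> (1/3)\<^sup>2"
        using S0 by (simp add: field_simps)
      finally show "(Y * exp (1/2 - S / 4))\<^sup>2 \<le> (1/3)\<^sup>2" .
    qed simp
    finally have "Nf ?a ?y A \<le> 1/3" .
    moreover have "(\<Prod>i\<in>A. ?a i) \<le> (\<Prod>i\<in>A. ?a i + ?y i)"
      using \<tau> by (intro prod_mono) auto
    moreover have "1 / (1 + S / 2) \<le> 2/3"
      using False by (simp add: field_simps)
    ultimately show ?thesis
      using P by (simp add: Ef_def)
  qed
qed

text \<open>On the indices below \<open>r\<close> the expression is the product of the
  \<open>c i\<close> minus \<open>Ef\<close>, with index 0 in the part of the possibly large value.
  The other indices contribute cosines only, a factor of absolute value at most 1.\<close>

theorem torus_bound:
  fixes l c s :: "nat \<Rightarrow> real"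
  assumes r: "2 \<le> r" "r \<le> n" and l0: "\<And>i. i < n \<Longrightarrow> 0 \<le> l i"
    and anti: "\<And>i j. i \<le> j \<Longrightarrow> j < n \<Longrightarrow> l j \<le> l i" and zero: "\<And>i. r \<le> i \<Longrightarrow> i < n \<Longrightarrow> l i = 0"
    and small: "\<And>j k. j < k \<Longrightarrow> k < r \<Longrightarrow> l j * l k \<le> (1/200) / (real r - 1)"
    and cs: "\<And>i. i < n \<Longrightarrow> (c i)\<^sup>2 + (s i)\<^sup>2 = 1"
  shows "\<bar>(\<Prod>i<n. c i - l i * s i) + (\<Sum>k<n. l k * s k * (\<Prod>i\<in>{..<n} - {k}. c i - l i * s i))\<bar> \<le> 1"
proof -
  let ?b = "\<lambda>i. - (l i * s i)"
  define \<tau> where "\<tau> = sqrt ((1/200) / (real r - 1))"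
  have \<tau>2: "\<tau>\<^sup>2 = (1/200) / (real r - 1)" and \<tau>0: "\<tau> \<ge> 0"
    using r by (simp_all add: \<tau>_def)
  have ins: "{..<r} = insert 0 {1..<r}" and split: "{..<n} = {..<r} \<union> {r..<n}"
    using r by auto
  have "\<bar>Ef c ?b {..<r}\<bar> \<le> Ef (\<lambda>i. \<bar>c i\<bar>) (\<lambda>i. \<tau> * \<bar>s i\<bar>) {..<r}"
    unfolding ins
  proof (rule Ef_pairwise_small)
    fix k assume k: "k \<in> {1..<r}"
    have "l 0 * l k \<le> \<tau>\<^sup>2"
      using small[of 0 k] k by (simp add: \<tau>2)
    \<comment> \<open>Every value after the first is at most \<open>\<tau>\<close>, because its
      square is at most its product with the larger \<open>l 0\<close>.\<close>
    moreover have "l k * l k \<le> l 0 * l k"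
      using k r l0 anti by (intro mult_right_mono) auto
    ultimately show "0 \<le> l k \<and> l k \<le> \<tau> \<and> l 0 * l k \<le> \<tau>\<^sup>2"
      using k r l0 \<tau>0 by (auto intro!: power2_le_imp_le[of "l k" \<tau>] simp: power2_eq_square)
  qed (use r l0 \<tau>0 in auto)
  moreover have "(\<Prod>i<r. \<bar>c i\<bar>) + Ef (\<lambda>i. \<bar>c i\<bar>) (\<lambda>i. \<tau> * \<bar>s i\<bar>) {..<r} \<le> 1"
    using r cs \<tau>0 by (intro torus_error_bound) (auto simp: \<tau>2 field_simps)
  ultimately have V: "\<bar>(\<Prod>i<r. c i + ?b i) - Nf c ?b {..<r}\<bar> \<le> 1"
    unfolding Ef_def abs_prod[symmetric] by linarith
  have "(\<Prod>i<n. c i - l i * s i) + (\<Sum>k<n. l k * s k * (\<Prod>i\<in>{..<n} - {k}. c i - l i * s i))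
      = (\<Prod>i<n. c i + ?b i) - Nf c ?b {..<n}"
    by (simp add: Nf_def sum_negf)
  also have "\<dots> = (\<Prod>i\<in>{r..<n}. c i) * ((\<Prod>i<r. c i + ?b i) - Nf c ?b {..<r})"
  proof -
    have "Nf c ?b ({..<r} \<union> {r..<n}) = (\<Prod>i\<in>{r..<n}. c i) * Nf c ?b {..<r}"
      using zero by (intro Nf_zero) auto
    moreover have "(\<Prod>i\<in>{..<r} \<union> {r..<n}. c i + ?b i) = (\<Prod>i<r. c i + ?b i) * (\<Prod>i\<in>{r..<n}. c i)"
      using zero by (subst prod.union_disjoint) auto
    ultimately show ?thesis
      by (simp only: split) (simp add: algebra_simps)
  qed
  also have "\<bar>\<dots>\<bar> \<le> 1 * 1"
    unfolding abs_mult abs_prod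
  proof (intro mult_mono prod_le_1)
    fix i assume "i \<in> {r..<n}"
    then have "(c i)\<^sup>2 \<le> 1"
      using unit_squares_le_1[OF cs[of i]] by auto
    then show "0 \<le> \<bar>c i\<bar> \<and> \<bar>c i\<bar> \<le> 1"
      by (simp add: abs_square_le_1)
  qed (use V in auto)
  finally show ?thesis by simp
qed

section \<open>The torus lemma\<close>

definition orthonormal_fam :: "nat \<Rightarrow> (nat \<Rightarrow> 'a::real_inner) \<Rightarrow> bool"
  where "orthonormal_fam n v \<longleftrightarrow> (\<forall>i<n. \<forall>j<n. inner (v i) (v j) = (if i = j then 1 else 0))"

lemma orthonormal_famD:
  "orthonormal_fam n v \<Longrightarrow> i < n \<Longrightarrow> j < n \<Longrightarrow> inner (v i) (v j) = (if i = j then 1 else 0)"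
  by (simp add: orthonormal_fam_def)

lemma square_one_cases: "(x::'a::idom) * x = 1 \<Longrightarrow> x = 1 \<or> x = -1"
  by (simp add: square_eq_1_iff)

text \<open>One determinant with these entries stores all iterates of \<open>\<Psi>\<close> in its
  coefficients, so the geometry can be settled before the alternating series is formed.\<close>

definition pencil :: "(nat \<Rightarrow> 'a::real_inner) \<Rightarrow> (nat \<Rightarrow> 'a) \<Rightarrow> 'a \<Rightarrow> nat \<Rightarrow> real poly"
  where "pencil e h x i = [:inner (e i) x, inner (h i) x:]"

lemma pencil_add: "pencil e h (x + y) i = pencil e h x i + pencil e h y i"
  and pencil_scaleR: "pencil e h (c *\<^sub>R x) i = Polynomial.smult c (pencil e h x i)"
  and pencil_0: "pencil e h 0 i = 0"
  by (simp_all add: pencil_def inner_add_right)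

lemma pencil_sum: "pencil e h (\<Sum>k\<in>A. f k) i = (\<Sum>k\<in>A. pencil e h (f k) i)"
  by (induction A rule: infinite_finite_induct) (simp_all add: pencil_add pencil_0)

lemma sum_pCons: "(\<Sum>k\<in>A. [:f k, g k:]) = [:\<Sum>k\<in>A. f k, \<Sum>k\<in>A. g k:]"
  by (induction A rule: infinite_finite_induct) simp_all

lemma sum_const_poly: "(\<Sum>k\<in>A. [:f k:]) = [:\<Sum>k\<in>A. f k:]"
  by (induction A rule: infinite_finite_induct) simp_all

lemma dt_poly_orthogonal:
  fixes Q :: "nat \<Rightarrow> nat \<Rightarrow> real"
  assumes "\<And>i j. i < n \<Longrightarrow> j < n \<Longrightarrow> (\<Sum>k<n. Q i k * Q j k) = (if i = j then 1 else 0)"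
  shows "dt n (\<lambda>i j. [:Q i j:]) = 1 \<or> dt n (\<lambda>i j. [:Q i j:]) = - 1"
proof (rule square_one_cases, rule dt_orthogonal_square)
  fix i j assume "i < n" "j < n"
  have "(\<Sum>k<n. [:Q i k:] * [:Q j k:]) = [:\<Sum>k<n. Q i k * Q j k:]"
    by (simp add: sum_const_poly mult.commute)
  then show "(\<Sum>k<n. [:Q i k:] * [:Q j k:]) = (if i = j then 1 else 0)"
    using assms \<open>i < n\<close> \<open>j < n\<close> by (simp add: one_pCons)
qed

text \<open>An orthogonal matrix has determinant 1 or -1. The sign is left open, since the estimates
  concern absolute values.\<close>

lemma dt_pencil_columns:
  assumes "\<And>i j. i < n \<Longrightarrow> j < n \<Longrightarrow> (\<Sum>k<n. Q i k * Q j k) = (if i = j then 1 else 0)"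
    and "\<And>j. j < n \<Longrightarrow> w j = (\<Sum>k<n. Q j k *\<^sub>R v k)"
  shows "dt n (\<lambda>i j. pencil e h (w j) i) = dt n (\<lambda>i j. pencil e h (v j) i)
    \<or> dt n (\<lambda>i j. pencil e h (w j) i) = - dt n (\<lambda>i j. pencil e h (v j) i)"
proof -
  have "dt n (\<lambda>i j. pencil e h (w j) i) = dt n (\<lambda>i j. \<Sum>k<n. pencil e h (v k) i * [:Q j k:])"
    by (rule dt_cong) (simp add: assms(2) pencil_sum pencil_scaleR)
  also have "\<dots> = dt n (\<lambda>i j. pencil e h (v j) i) * dt n (\<lambda>i j. [:Q i j:])"
    by (simp only: dt_mult dt_transpose[of n "\<lambda>i j. [:Q i j:]"])
  finally show ?thesis
    using dt_poly_orthogonal[OF assms(1)] by auto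
qed

text \<open>
  A Householder reflection in the span of the vectors from index \<open>p\<close> on turns the functional
  \<open>x\<close> into one that sees only the vector with index \<open>p\<close>.
\<close>

lemma householder:
  fixes v :: "nat \<Rightarrow> 'a::real_inner"
  assumes v: "orthonormal_fam n v" and p: "p < n"
  obtains w where "orthonormal_fam n w" "\<And>j. p < j \<Longrightarrow> j < n \<Longrightarrow> inner x (w j) = 0"
    and "\<And>j. j < p \<Longrightarrow> w j = v j"
    and "\<And>y j. (\<And>k. p \<le> k \<Longrightarrow> k < n \<Longrightarrow> inner y (v k) = 0) \<Longrightarrow> p \<le> j \<Longrightarrow> j < n \<Longrightarrow> inner y (w j) = 0"
    and "\<And>e h. dt n (\<lambda>i j. pencil e h (w j) i) = dt n (\<lambda>i j. pencil e h (v j) i)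
      \<or> dt n (\<lambda>i j. pencil e h (w j) i) = - dt n (\<lambda>i j. pencil e h (v j) i)"
proof -
  define \<alpha> where "\<alpha> = sqrt (\<Sum>k\<in>{p..<n}. (inner x (v k))\<^sup>2)"
  define c where "c k = (if p \<le> k then inner x (v k) - (if k = p then \<alpha> else 0) else 0)" for k
  define N where "N = (\<Sum>k<n. (c k)\<^sup>2)"
  \<comment> \<open>For \<open>N = 0\<close> division by zero makes \<open>\<beta>\<close> zero and
    \<open>Q\<close> the identity. This is the right value: then all \<open>c k\<close> vanish and
    \<open>x\<close> already sees only \<open>v p\<close> from index \<open>p\<close> on.\<close>
  define \<beta> where "\<beta> = 2 / N"
  define Q where "Q i k = (if i = k then 1 else 0) - \<beta> * c i * c k" for i k
  define w where "w j = (\<Sum>k<n. Q j k *\<^sub>R v k)" for j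
  have \<alpha>2: "\<alpha>\<^sup>2 = (\<Sum>k\<in>{p..<n}. (inner x (v k))\<^sup>2)"
    by (simp add: \<alpha>_def sum_nonneg)
  have sub: "(\<Sum>k<n. c k * f k) = (\<Sum>k\<in>{p..<n}. inner x (v k) * f k) - \<alpha> * f p" for f
  proof -
    have "(\<Sum>k<n. c k * f k) = (\<Sum>k\<in>{p..<n}. c k * f k)"
      by (rule sum.mono_neutral_right) (auto simp: c_def)
    also have "\<dots> = (\<Sum>k\<in>{p..<n}. inner x (v k) * f k - (if k = p then \<alpha> * f p else 0))"
      by (rule sum.cong) (auto simp: c_def algebra_simps)
    finally show ?thesis
      using p by (simp add: sum_subtractf)
  qed
  have ca: "(\<Sum>k<n. c k * inner x (v k)) = \<alpha>\<^sup>2 - \<alpha> * inner x (v p)"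
    using sub[of "\<lambda>k. inner x (v k)"] unfolding \<alpha>2 by (simp add: power2_eq_square)
  \<comment> \<open>The part of \<open>x\<close> in the span from index \<open>p\<close> on has
    length \<open>\<alpha>\<close>. For vectors of equal length, the squared norm of the difference
    is twice its inner product with the first one, which makes the reflection carry one to the
    other.\<close>
  have N: "N = 2 * (\<Sum>k<n. c k * inner x (v k))"
  proof -
    have "N = (\<Sum>k\<in>{p..<n}. inner x (v k) * c k) - \<alpha> * c p"
      using sub[of c] by (simp add: N_def power2_eq_square)
    also have "(\<Sum>k\<in>{p..<n}. inner x (v k) * c k) = (\<Sum>k<n. c k * inner x (v k))"
      by (rule sum.mono_neutral_cong_left) (auto simp: c_def)
    finally show ?thesis
      unfolding ca by (simp add: c_def power2_eq_square algebra_simps)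
  qed
  have c0: "c k = 0" if "N = 0" "k < n" for k
    using that by (simp add: N_def sum_nonneg_eq_0_iff)
  have QQ: "(\<Sum>k<n. Q i k * Q j k) = (if i = j then 1 else 0)" if "i < n" "j < n" for i j
  proof -
    have \<beta>: "\<beta> * (\<beta> * N) = 2 * \<beta>"
      by (simp add: \<beta>_def)
    have "(\<Sum>k<n. Q i k * Q j k) = (\<Sum>k<n. (if i = k then (if i = j then 1 else 0) else 0)
        - (if i = k then \<beta> * c j * c i else 0) - (if j = k then \<beta> * c i * c j else 0)
        + \<beta> * \<beta> * c i * c j * (c k)\<^sup>2)"
      by (rule sum.cong) (auto simp: Q_def algebra_simps power2_eq_square)
    also have "\<dots> = (if i = j then 1 else 0) - \<beta> * c j * c i - \<beta> * c i * c j + \<beta> * (\<beta> * N) * c i * c j"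
      using that by (simp add: sum.distrib sum_subtractf N_def mult_ac flip: sum_distrib_left)
    finally show ?thesis
      unfolding \<beta> by (simp add: algebra_simps)
  qed
  have inner_w: "inner y (w j) = inner y (v j) - \<beta> * c j * (\<Sum>k<n. c k * inner y (v k))" if "j < n" for y j
  proof -
    have "inner y (w j) = (\<Sum>k<n. (if j = k then inner y (v k) else 0) - \<beta> * c j * (c k * inner y (v k)))"
      unfolding w_def inner_sum_right by (rule sum.cong) (auto simp: Q_def algebra_simps)
    then show ?thesis
      using that by (simp add: sum_subtractf sum_distrib_left)
  qed
  show ?thesis
  proof (rule that[of w])
    show "orthonormal_fam n w"
    proof -
      have "inner (w i) (w j) = (\<Sum>k<n. Q i k * Q j k)" if "i < n" "j < n" for i j
      proof -
        have "inner (w i) (w j) = (\<Sum>k<n. \<Sum>l<n. Q i k * (Q j l * (if k = l then 1 else 0)))"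
          unfolding w_def inner_sum_left inner_sum_right
          by (subst sum.swap) (auto simp: orthonormal_famD[OF v] intro!: sum.cong)
        then show ?thesis
          by (simp add: if_distrib cong: if_cong)
      qed
      then show ?thesis
        using QQ by (simp add: orthonormal_fam_def)
    qed
    show "inner x (w j) = 0" if "p < j" "j < n" for j
      proof (cases "N = 0")
      case True
      then show ?thesis
        using that c0[of j] by (simp add: inner_w \<beta>_def c_def)
    next
      case False
      then have "\<beta> * (\<Sum>k<n. c k * inner x (v k)) = 1"
        using N by (simp add: \<beta>_def)
      then have "inner x (w j) = inner x (v j) - c j"
        using that by (simp add: inner_w mult.assoc mult.left_commute[of \<beta>])
      then show ?thesis
        using that by (simp add: c_def)
    qed
    show "w j = v j" if "j < p" for j
    proof -
      have "w j = (\<Sum>k<n. if j = k then v k else 0)"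
        unfolding w_def using that by (intro sum.cong) (auto simp: Q_def c_def)
      then show ?thesis
        using that p by simp
    qed
    show "inner y (w j) = 0" if "\<And>k. p \<le> k \<Longrightarrow> k < n \<Longrightarrow> inner y (v k) = 0" "p \<le> j" "j < n" for y j
    proof -
      have "(\<Sum>k<n. c k * inner y (v k)) = 0"
        using that(1) by (intro sum.neutral) (auto simp: c_def)
      then show ?thesis
        using that by (simp add: inner_w)
    qed
  qed (rule dt_pencil_columns[OF QQ], simp_all add: w_def)
qed

text \<open>For sines \<open>\<bar>x\<bar>\<close> and \<open>\<bar>y\<bar>\<close> this is the sine
  of the sum of the angles. The two cofactor terms in the torus lemma add up to such an
  expression.\<close>

lemma scaled_sum_le_1:
  fixes x y :: real
  assumes "x\<^sup>2 \<le> 1" "y\<^sup>2 \<le> 1"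
  shows "\<bar>x\<bar> * sqrt (1 - y\<^sup>2) + \<bar>y\<bar> * sqrt (1 - x\<^sup>2) \<le> 1"
proof -
  have *: "2 * (\<bar>a\<bar> * sqrt b) \<le> a\<^sup>2 + b" if "b \<ge> 0" for a b :: real
    using zero_le_power2[of "\<bar>a\<bar> - sqrt b"] that by (simp add: power2_diff)
  show ?thesis
    using *[of "1 - y\<^sup>2" x] *[of "1 - x\<^sup>2" y] assms by linarith
qed

lemma polar_coordinates:
  fixes a b :: real
  obtains c s where "a = sqrt (a\<^sup>2 + b\<^sup>2) * c" "b = sqrt (a\<^sup>2 + b\<^sup>2) * s" "c\<^sup>2 + s\<^sup>2 = 1"
proof (cases "a\<^sup>2 + b\<^sup>2 = 0")
  case True
  then show ?thesis
    using that[of 1 0] by (simp add: sum_power2_eq_zero_iff)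
next
  case False
  then show ?thesis
    using that[of "a / sqrt (a\<^sup>2 + b\<^sup>2)" "b / sqrt (a\<^sup>2 + b\<^sup>2)"]
    by (simp add: power_divide add_divide_distrib[symmetric])
qed

text \<open>A vanishing \<open>\<nu> i\<close> stands for a tangent direction without normal
  partner, as happens beyond the rank of the differential.\<close>

definition split_frame :: "nat \<Rightarrow> (nat \<Rightarrow> 'a::real_inner) \<Rightarrow> (nat \<Rightarrow> 'a) \<Rightarrow> bool"
  where "split_frame n e \<nu> \<longleftrightarrow> orthonormal_fam n e \<and>
    (\<forall>i<n. \<forall>j<n. inner (e i) (\<nu> j) = 0) \<and>
    (\<forall>i<n. \<forall>j<n. inner (\<nu> i) (\<nu> j) = (if i = j \<and> \<nu> i \<noteq> 0 then 1 else 0))"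

lemma split_frame_Suc: "split_frame (Suc n) e \<nu> \<Longrightarrow> split_frame n (\<lambda>i. e (Suc i)) (\<lambda>i. \<nu> (Suc i))"
  by (simp add: split_frame_def orthonormal_fam_def)

text \<open>
  The form lies in the span of the products with one factor from each pair
  \<open>(e i, \<nu> i)\<close>. Its maximum over all orthonormal tuples is attained on planes spanned by one
  vector from each of the planes \<open>span {e i, \<nu> i}\<close> (the torus lemma of Dadok, Harvey and Morgan).
\<close>

lemma torus_lemma:
  fixes L :: "real poly \<Rightarrow> real" and e \<nu> v :: "nat \<Rightarrow> 'a::real_inner"
  assumes add: "\<And>p q. L (p + q) = L p + L q" and scale: "\<And>c p. L (Polynomial.smult c p) = c * L p"
    and fr: "split_frame n e \<nu>" and v: "orthonormal_fam n v"
    and K: "\<And>c s. (\<And>i. i < n \<Longrightarrow> (c i)\<^sup>2 + (s i)\<^sup>2 = 1) \<Longrightarrow> \<bar>L (g * (\<Prod>i<n. [:c i, l i * s i:]))\<bar> \<le> K"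
  shows "\<bar>L (g * dt n (\<lambda>i j. pencil e (\<lambda>i. l i *\<^sub>R \<nu> i) (v j) i))\<bar> \<le> K"
  using fr v K
\<comment> \<open>The multiplier \<open>g\<close> absorbs the linear factor of the row just
  expanded, so that a minor satisfies the same kind of hypothesis.\<close>
proof (induction n arbitrary: g e \<nu> l v)
  case 0
  then show ?case by simp
next
  case (Suc n)
  let ?h = "\<lambda>i. l i *\<^sub>R \<nu> i"
  have minus: "L (- p) = - L p" for p
    using scale[of "-1" p] by simp
  have L0: "L 0 = 0"
    using scale[of 0 0] by simp
  have diff: "L (p - q) = L p - L q" for p q
    using add[of p "- q"] by (simp add: minus)
  have K0: "K \<ge> 0"
    using Suc.prems(3)[of "\<lambda>_. 1" "\<lambda>_. 0"] by (simp add: order_trans[OF abs_ge_zero])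
  \<comment> \<open>Two reflections clear the first row: afterwards \<open>e 0\<close> sees only
    vector 0 and \<open>\<nu> 0\<close> only vectors 0 and 1, so the Laplace expansion has at most
    two terms.\<close>
  obtain w where w: "orthonormal_fam (Suc n) w" "\<And>j. 0 < j \<Longrightarrow> j < Suc n \<Longrightarrow> inner (e 0) (w j) = 0"
    and w_dt: "dt (Suc n) (\<lambda>i j. pencil e ?h (w j) i) = dt (Suc n) (\<lambda>i j. pencil e ?h (v j) i)
      \<or> dt (Suc n) (\<lambda>i j. pencil e ?h (w j) i) = - dt (Suc n) (\<lambda>i j. pencil e ?h (v j) i)"
    by (rule householder[OF Suc.prems(2), of 0 "e 0"]) auto
  obtain u where u: "orthonormal_fam (Suc n) u" "\<And>j. 0 < j \<Longrightarrow> j < Suc n \<Longrightarrow> inner (e 0) (u j) = 0"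
      "\<And>j. 1 < j \<Longrightarrow> j < Suc n \<Longrightarrow> inner (\<nu> 0) (u j) = 0"
    and u_dt: "dt (Suc n) (\<lambda>i j. pencil e ?h (u j) i) = dt (Suc n) (\<lambda>i j. pencil e ?h (v j) i)
      \<or> dt (Suc n) (\<lambda>i j. pencil e ?h (u j) i) = - dt (Suc n) (\<lambda>i j. pencil e ?h (v j) i)"
  proof (cases "n = 0")
    case True
    then show ?thesis
      using that[of w] w w_dt by auto
  next
    case False
    obtain u where u: "orthonormal_fam (Suc n) u" "\<And>j. 1 < j \<Longrightarrow> j < Suc n \<Longrightarrow> inner (\<nu> 0) (u j) = 0"
      and u_keep: "\<And>y j. (\<And>k. 1 \<le> k \<Longrightarrow> k < Suc n \<Longrightarrow> inner y (w k) = 0) \<Longrightarrow> 1 \<le> j \<Longrightarrow> j < Suc n \<Longrightarrow> inner y (u j) = 0"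
      and u_dt: "dt (Suc n) (\<lambda>i j. pencil e ?h (u j) i) = dt (Suc n) (\<lambda>i j. pencil e ?h (w j) i)
        \<or> dt (Suc n) (\<lambda>i j. pencil e ?h (u j) i) = - dt (Suc n) (\<lambda>i j. pencil e ?h (w j) i)"
      using False by (rule_tac householder[OF w(1), of 1 "\<nu> 0"]) auto
    have "inner (e 0) (u j) = 0" if "0 < j" "j < Suc n" for j
      using that w(2) by (intro u_keep) auto
    then show ?thesis
      using that[of u] u u_dt w_dt by auto
  qed
  have \<nu>0: "inner (\<nu> 0) (\<nu> 0) = 1 \<or> \<nu> 0 = 0" and e0: "inner (e 0) (e 0) = 1"
    and e\<nu>: "inner (e 0) (\<nu> 0) = 0" "inner (\<nu> 0) (e 0) = 0"
    using Suc.prems(1) by (auto simp: split_frame_def orthonormal_fam_def inner_commute)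
  define e' where "e' i = e (Suc i)" for i
  define h' where "h' i = ?h (Suc i)" for i
  define d where "d x = dt n (\<lambda>i k. pencil e' h' (x k) i)" for x :: "nat \<Rightarrow> 'a"
  \<comment> \<open>The lower rows do not see \<open>e 0\<close> and \<open>\<nu> 0\<close>, so
    these components may be removed from the arguments of a minor.\<close>
  have perp: "pencil e' h' (x - b *\<^sub>R \<nu> 0) i = pencil e' h' x i"
      "pencil e' h' (x - b *\<^sub>R e 0) i = pencil e' h' x i" if "i < n" for x b i
    using Suc.prems(1) that
    by (auto simp: pencil_def e'_def h'_def split_frame_def orthonormal_fam_def inner_diff_right
        inner_commute[of "\<nu> _" "e 0"])
  \<comment> \<open>The pair \<open>(a, b)\<close> is a length times a point of the circle. The
    point extends the torus parameters of the minor, and the length comes out by linearity.\<close>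
  have IH: "\<bar>L (g * ([:a, l 0 * b:] * d x))\<bar> \<le> sqrt (a\<^sup>2 + b\<^sup>2) * K"
    if x: "orthonormal_fam n x" for a b x
  proof -
    obtain c s where cs: "a = sqrt (a\<^sup>2 + b\<^sup>2) * c" "b = sqrt (a\<^sup>2 + b\<^sup>2) * s" "c\<^sup>2 + s\<^sup>2 = 1"
      by (rule polar_coordinates)
    have "\<bar>L (g * [:c, l 0 * s:] * d x)\<bar> \<le> K"
      unfolding d_def e'_def[abs_def] h'_def[abs_def]
    proof (rule Suc.IH[OF split_frame_Suc[OF Suc.prems(1)] x])
      fix c' s' :: "nat \<Rightarrow> real"
      assume "\<And>i. i < n \<Longrightarrow> (c' i)\<^sup>2 + (s' i)\<^sup>2 = 1"
      then have "\<bar>L (g * (\<Prod>i<Suc n. [:case_nat c c' i, l i * case_nat s s' i:]))\<bar> \<le> K"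
        using cs(3) by (intro Suc.prems(3)) (auto simp: less_Suc_eq_0_disj)
      then show "\<bar>L (g * [:c, l 0 * s:] * (\<Prod>i<n. [:c' i, l (Suc i) * s' i:]))\<bar> \<le> K"
        by (simp only: prod.lessThan_Suc_shift nat.case mult.assoc)
    qed
    moreover have "[:a, l 0 * b:] = Polynomial.smult (sqrt (a\<^sup>2 + b\<^sup>2)) [:c, l 0 * s:]"
      using cs(1,2) by (simp add: mult_ac)
    then have "g * ([:a, l 0 * b:] * d x) = Polynomial.smult (sqrt (a\<^sup>2 + b\<^sup>2)) (g * [:c, l 0 * s:] * d x)"
      by (simp only: mult_smult_left mult_smult_right mult.assoc)
    ultimately show ?thesis
      by (simp only: scale abs_mult) (simp add: mult_left_mono)
  qed
  \<comment> \<open>The removal of components leaves one argument that need not have length 1; its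
    length factors out of the first column.\<close>
  have IH0: "\<bar>L (g * ([:a, l 0 * b:] * d x))\<bar> \<le> norm (x 0) * (sqrt (a\<^sup>2 + b\<^sup>2) * K)"
    if n: "n \<noteq> 0" and x: "\<And>i j. 0 < i \<Longrightarrow> i < n \<Longrightarrow> j < n \<Longrightarrow> inner (x i) (x j) = (if i = j then 1 else 0)"
    for a b x
  proof -
    define x' where "x' = x(0 := x 0 /\<^sub>R norm (x 0))"
    have "d x = dt n (\<lambda>i k. if k = 0 then 0 + [:norm (x 0):] * pencil e' h' (x' 0) i else pencil e' h' (x' k) i)"
      unfolding d_def
      by (rule dt_cong, cases "x 0 = 0") (auto simp: x'_def pencil_def)
    also have "\<dots> = Polynomial.smult (norm (x 0)) (d x')"
    proof -
      have "dt n (\<lambda>i k. if k = 0 then (0::real poly) else pencil e' h' (x' k) i) = 0"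
        using dt_col_add[of 0 n "\<lambda>_. 0" 1 "\<lambda>_. 0" "\<lambda>i k. pencil e' h' (x' k) i"] n
        by (simp cong: if_cong)
      moreover have "dt n (\<lambda>i k. if k = 0 then pencil e' h' (x' 0) i else pencil e' h' (x' k) i) = d x'"
        unfolding d_def by (rule dt_cong) auto
      ultimately show ?thesis
        using n by (subst dt_col_add) auto
    qed
    finally have d: "d x = Polynomial.smult (norm (x 0)) (d x')" .
    show ?thesis
    proof (cases "x 0 = 0")
      case False
      have "orthonormal_fam n x'"
        unfolding orthonormal_fam_def
      proof (intro allI impI)
        fix i j assume ij: "i < n" "j < n"
        have "inverse (norm (x 0)) * (inverse (norm (x 0)) * inner (x 0) (x 0)) = 1"
          using False by (simp add: dot_square_norm power2_eq_square field_simps)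
        then show "inner (x' i) (x' j) = (if i = j then 1 else 0)"
          using False ij x[of i j] x[of j i] n by (auto simp: x'_def inner_commute)
      qed
      from IH[OF this, of a b] show ?thesis
        by (simp add: d scale abs_mult mult_left_mono)
    qed (simp add: d L0)
  qed
  define a where "a = inner (e 0) (u 0)"
  define b where "b = inner (\<nu> 0) (u 0)"
  define b1 where "b1 = (if n = 0 then 0 else inner (\<nu> 0) (u 1))"
  have "L (g * dt (Suc n) (\<lambda>i j. pencil e ?h (u j) i))
      = L (g * ([:a, l 0 * b:] * d (\<lambda>k. u (Suc k)))) - L (g * ([:0, l 0 * b1:] * d (\<lambda>k. u (skip 1 k))))"
  proof -
    have "dt (Suc n) (\<lambda>i j. pencil e ?h (u j) i)
        = (\<Sum>j<Suc n. (-1) ^ j * pencil e ?h (u j) 0 * d (\<lambda>k. u (skip j k)))"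
      by (simp add: dt_laplace_row d_def pencil_def e'_def h'_def del: sum.lessThan_Suc)
    also have "\<dots> = (\<Sum>j\<in>{..<Suc n} \<inter> {0, 1}. (-1) ^ j * pencil e ?h (u j) 0 * d (\<lambda>k. u (skip j k)))"
    proof (intro sum.mono_neutral_right ballI)
      fix j assume "j \<in> {..<Suc n} - {..<Suc n} \<inter> {0, 1}"
      then have "pencil e ?h (u j) 0 = 0"
        using u(2,3)[of j] by (auto simp: pencil_def)
      then show "(-1) ^ j * pencil e ?h (u j) 0 * d (\<lambda>k. u (skip j k)) = 0"
        by simp
    qed auto
    also have "\<dots> = [:a, l 0 * b:] * d (\<lambda>k. u (Suc k)) - [:0, l 0 * b1:] * d (\<lambda>k. u (skip 1 k))"
    proof (cases "n = 0")
      case True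
      then have "{..<Suc n} \<inter> {0, 1} = {0}" by auto
      then show ?thesis
        using True by (simp add: pencil_def a_def b_def b1_def)
    next
      case False
      then have "{..<Suc n} \<inter> {0, 1} = {0, 1}" by auto
      then show ?thesis
        using False u(2)[of 1] by (simp add: pencil_def a_def b_def b1_def)
    qed
    finally show ?thesis
      by (simp only: right_diff_distrib diff)
  qed
  then have "\<bar>L (g * dt (Suc n) (\<lambda>i j. pencil e ?h (u j) i))\<bar>
      \<le> \<bar>L (g * ([:a, l 0 * b:] * d (\<lambda>k. u (Suc k))))\<bar> + \<bar>L (g * ([:0, l 0 * b1:] * d (\<lambda>k. u (skip 1 k))))\<bar>"
    by simp
  also have "\<dots> \<le> K"
  proof (cases "n = 0")
    case True
    have "inner (u 0) (u 0) = 1"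
      using u(1) by (simp add: orthonormal_fam_def)
    then have "inner (u 0 - a *\<^sub>R e 0 - b *\<^sub>R \<nu> 0) (u 0 - a *\<^sub>R e 0 - b *\<^sub>R \<nu> 0) = 1 - a\<^sup>2 - b\<^sup>2"
      using \<nu>0 e0 e\<nu> by (auto simp: inner_diff_left inner_diff_right a_def b_def inner_commute power2_eq_square)
    then have "a\<^sup>2 + b\<^sup>2 \<le> 1"
      using inner_ge_zero[of "u 0 - a *\<^sub>R e 0 - b *\<^sub>R \<nu> 0"] by linarith
    then have "sqrt (a\<^sup>2 + b\<^sup>2) * K \<le> 1 * K"
      using K0 by (intro mult_right_mono) auto
    moreover have "orthonormal_fam n (\<lambda>k. u (Suc k))"
      using True by (simp add: orthonormal_fam_def)
    ultimately show ?thesis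
      using IH[of "\<lambda>k. u (Suc k)" a b] True by (simp add: b1_def L0)
  next
    case False
    define w0 where "w0 = u 0 - a *\<^sub>R e 0 - b *\<^sub>R \<nu> 0"
    define w1 where "w1 = u 1 - b1 *\<^sub>R \<nu> 0"
    have uu: "inner (u i) (u j) = (if i = j then 1 else 0)" if "i \<le> n" "j \<le> n" for i j
      using u(1) that by (simp add: orthonormal_fam_def)
    \<comment> \<open>By Pythagoras the shortened vectors have lengths complementary to the entries
      of the first row, as cosine and sine, which is the form \<open>scaled_sum_le_1\<close>
      needs.\<close>
    have n0: "(norm w0)\<^sup>2 = 1 - (a\<^sup>2 + b\<^sup>2)"
      using \<nu>0 e0 e\<nu> uu[of 0 0] unfolding power2_norm_eq_inner w0_def
      by (auto simp: inner_diff_left inner_diff_right a_def b_def inner_commute power2_eq_square)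
    have n1: "(norm w1)\<^sup>2 = 1 - b1\<^sup>2"
      using \<nu>0 uu[of 1 1] False unfolding power2_norm_eq_inner w1_def
      by (auto simp: inner_diff_left inner_diff_right b1_def inner_commute power2_eq_square)
    have p0: "inner w0 (u j) = 0" "inner w1 (u j) = 0" if "1 < j" "j < Suc n" for j
      using that u(2,3)[of j] uu[of 0 j] uu[of 1 j] by (auto simp: w0_def w1_def inner_diff_left)
    have d0: "d (\<lambda>k. u (Suc k)) = d ((\<lambda>k. u (Suc k))(0 := w1))"
      unfolding d_def by (rule dt_cong) (auto simp: w1_def perp)
    have d1: "d (\<lambda>k. u (skip 1 k)) = d ((\<lambda>k. u (Suc k))(0 := w0))"
      unfolding d_def by (rule dt_cong) (auto simp: w0_def perp skip_def)
    have "\<bar>L (g * ([:a, l 0 * b:] * d (\<lambda>k. u (Suc k))))\<bar> \<le> norm w1 * (sqrt (a\<^sup>2 + b\<^sup>2) * K)"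
      unfolding d0 by (rule order_trans[OF IH0]) (use False p0 uu in \<open>auto simp: inner_commute[of "u _" w1]\<close>)
    moreover have "\<bar>L (g * ([:0, l 0 * b1:] * d (\<lambda>k. u (skip 1 k))))\<bar> \<le> norm w0 * (sqrt (0\<^sup>2 + b1\<^sup>2) * K)"
      unfolding d1 by (rule order_trans[OF IH0]) (use False p0 uu in \<open>auto simp: inner_commute[of "u _" w0]\<close>)
    moreover have "norm w1 = sqrt (1 - b1\<^sup>2)" "norm w0 = sqrt (1 - (sqrt (a\<^sup>2 + b\<^sup>2))\<^sup>2)"
      using n0 n1 by (auto simp: real_sqrt_unique)
    moreover have "\<bar>sqrt (a\<^sup>2 + b\<^sup>2)\<bar> * sqrt (1 - b1\<^sup>2) + \<bar>b1\<bar> * sqrt (1 - (sqrt (a\<^sup>2 + b\<^sup>2))\<^sup>2) \<le> 1"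
    proof (rule scaled_sum_le_1)
      show "(sqrt (a\<^sup>2 + b\<^sup>2))\<^sup>2 \<le> 1" "b1\<^sup>2 \<le> 1"
        using n0 n1 zero_le_power2[of "norm w0"] zero_le_power2[of "norm w1"] by auto
    qed
    ultimately show ?thesis
      using mult_right_mono[OF _ K0, of "\<bar>sqrt (a\<^sup>2 + b\<^sup>2)\<bar> * sqrt (1 - b1\<^sup>2) + \<bar>b1\<bar> * sqrt (1 - (sqrt (a\<^sup>2 + b\<^sup>2))\<^sup>2)" 1]
      by (simp add: algebra_simps)
  qed
  finally show ?case
    using u_dt minus by auto
qed

section \<open>Square roots of finite-rank perturbations\<close>

hide_const (open) Matrix.unit_vec


section \<open>Orthonormal families and compactness in \<open>Rn n\<close>\<close>

lemma inner_unit_vec: "inner v (unit_vec i) = coord v i"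
proof -
  have "inner (unit_vec i) v = coord v i"
    by (subst inner_Rn[where n = "Suc i"]) (auto simp: Rn_def unit_vec.rep_eq)
  then show ?thesis
    by (simp add: inner_commute)
qed

lemma inner_unit_vec_unit_vec: "inner (unit_vec i) (unit_vec j) = (if i = j then 1 else 0)"
  by (auto simp: inner_unit_vec unit_vec.rep_eq)

lemma unit_vec_in_Rn: "i < n \<Longrightarrow> unit_vec i \<in> Rn n"
  by (auto simp: Rn_def unit_vec.rep_eq)

lemma Rn_expand: "v \<in> Rn n \<Longrightarrow> (\<Sum>i<n. inner v (unit_vec i) *\<^sub>R unit_vec i) = v"
  using proj_Rn_id[of v n] by (simp add: proj_Rn_def)

lemma proj_Rn_in: "proj_Rn n v \<in> Rn n"
  unfolding proj_Rn_def by (intro subspace_sum subspace_scale subspace_Rn unit_vec_in_Rn) auto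

lemma inner_proj_Rn: "u \<in> Rn n \<Longrightarrow> inner (proj_Rn n v) u = inner v u"
  by (subst (2) Rn_expand[symmetric, of u n])
    (simp_all add: proj_Rn_def inner_sum_left inner_sum_right inner_commute mult.commute)

lemma linear_proj_Rn: "linear (proj_Rn n)"
  by (rule linearI)
    (simp_all add: proj_Rn_def inner_add_left scaleR_add_left sum.distrib scaleR_sum_right)

lemma Rn_subset_span: "Rn n \<subseteq> span (unit_vec ` {..<n})"
proof
  fix v assume "v \<in> Rn n"
  then show "v \<in> span (unit_vec ` {..<n})"
    by (subst Rn_expand[symmetric], assumption) (intro span_sum span_scale span_base, auto)
qed

lemma independent_orthogonal_family:
  fixes u :: "'i \<Rightarrow> 'a::real_inner"
  assumes "\<And>i. i \<in> A \<Longrightarrow> u i \<noteq> 0" "\<And>i j. i \<in> A \<Longrightarrow> j \<in> A \<Longrightarrow> i \<noteq> j \<Longrightarrow> inner (u i) (u j) = 0"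
  shows "independent (u ` A)" "inj_on u A"
proof -
  show "inj_on u A"
    using assms by (intro inj_onI) (metis inner_eq_zero_iff)
  show "independent (u ` A)"
    using assms by (intro pairwise_orthogonal_independent) (auto simp: pairwise_def real_inner_class.orthogonal_def)
qed

lemma orthonormal_fam_independent:
  assumes "orthonormal_fam n u"
  shows "independent (u ` {..<n})" "inj_on u {..<n}"
proof -
  have "u i \<noteq> 0" if "i < n" for i
    using orthonormal_famD[OF assms that that] by auto
  then show "independent (u ` {..<n})" "inj_on u {..<n}"
    using orthonormal_famD[OF assms] independent_orthogonal_family[of "{..<n}" u] by auto
qed

lemma orthonormal_fam_unit_vec: "orthonormal_fam n unit_vec"
  by (simp add: orthonormal_fam_def inner_unit_vec_unit_vec)

text \<open>Fewer than \<open>n\<close> vectors cannot span all \<open>n\<close> standard unit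
  vectors; one outside the span is projected and normalised.\<close>

lemma extend_orthonormal:
  assumes u: "orthonormal_fam k u" "\<And>i. i < k \<Longrightarrow> u i \<in> Rn n" and k: "k < n"
  obtains x where "x \<in> Rn n" "norm x = 1" "\<And>i. i < k \<Longrightarrow> inner x (u i) = 0"
proof -
  have "\<exists>j<n. unit_vec j \<notin> span (u ` {..<k})"
  proof (rule ccontr)
    assume "\<not> ?thesis"
    then have "unit_vec ` {..<n} \<subseteq> span (u ` {..<k})" by auto
    then have "card (unit_vec ` {..<n}) \<le> card (u ` {..<k})"
      using orthonormal_fam_independent(1)[OF orthonormal_fam_unit_vec]
        independent_span_bound[of "u ` {..<k}" "unit_vec ` {..<n}"] by simp
    then show False
      using k card_image_le[of "{..<k}" u] orthonormal_fam_independent(2)[OF orthonormal_fam_unit_vec, of n]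
      by (simp add: card_image)
  qed
  then obtain j where j: "j < n" "unit_vec j \<notin> span (u ` {..<k})" by auto
  define y where "y = unit_vec j - (\<Sum>i<k. inner (unit_vec j) (u i) *\<^sub>R u i)"
  have "(\<Sum>i<k. inner (unit_vec j) (u i) *\<^sub>R u i) \<in> span (u ` {..<k})"
    by (intro span_sum span_scale span_base) auto
  then have "y \<noteq> 0"
    using j by (auto simp: y_def)
  moreover have "y \<in> Rn n"
    unfolding y_def using u(2) j
    by (intro subspace_diff subspace_sum subspace_scale subspace_Rn unit_vec_in_Rn) auto
  moreover have "inner y (u i) = 0" if "i < k" for i
    using that by (simp add: y_def inner_diff_left inner_sum_left orthonormal_famD[OF u(1)]
        if_distrib cong: if_cong)
  ultimately show ?thesis
    by (intro that[of "y /\<^sub>R norm y"]) (auto simp: subspace_scale[OF subspace_Rn])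
qed

text \<open>In an infinite-dimensional space closed bounded sets need not be compact. Here the
  sphere is closed in a cube, which is a finite sum of compact segments.\<close>

lemma compact_unit_sphere_Rn: "compact {v \<in> Rn n. norm v = 1}"
proof -
  have "compact {v. \<exists>c. (\<forall>i<n. c i \<in> {-1..1}) \<and> v = (\<Sum>i<n. c i *\<^sub>R unit_vec i)}" (is "compact (?C n)")
  proof (induction n)
    case (Suc n)
    have eq: "?C (Suc n) = {x + y |x y. x \<in> ?C n \<and> y \<in> (\<lambda>t. t *\<^sub>R unit_vec n) ` {-1..1}}"
    proof (intro equalityI subsetI)
      fix v assume "v \<in> {x + y |x y. x \<in> ?C n \<and> y \<in> (\<lambda>t. t *\<^sub>R unit_vec n) ` {-1..1}}"
      then obtain c t where "\<forall>i<n. c i \<in> {-1..1}" "t \<in> {-1..1}" "v = (\<Sum>i<n. c i *\<^sub>R unit_vec i) + t *\<^sub>R unit_vec n"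
        by auto
      then show "v \<in> ?C (Suc n)"
        by (intro CollectI exI[of _ "c(n := t)"]) (auto simp: less_Suc_eq)
    next
      fix v assume "v \<in> ?C (Suc n)"
      then obtain c where c: "\<forall>i<Suc n. c i \<in> {-1..1}" "v = (\<Sum>i<n. c i *\<^sub>R unit_vec i) + c n *\<^sub>R unit_vec n"
        by auto
      moreover have "(\<Sum>i<n. c i *\<^sub>R unit_vec i) \<in> ?C n"
        using c(1) by (intro CollectI exI[of _ c]) auto
      ultimately show "v \<in> {x + y |x y. x \<in> ?C n \<and> y \<in> (\<lambda>t. t *\<^sub>R unit_vec n) ` {-1..1}}"
        using c(1) by blast
    qed
    have "compact ((\<lambda>t::real. t *\<^sub>R unit_vec n) ` {-1..1})"
      by (intro compact_continuous_image continuous_intros) auto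
    then show ?case
      unfolding eq by (rule compact_sums[OF Suc.IH])
  qed simp
  moreover have "{v \<in> Rn n. norm v = 1} = ?C n \<inter> {v. norm v = 1}"
  proof (intro equalityI subsetI)
    fix v assume v: "v \<in> {v \<in> Rn n. norm v = 1}"
    then have "v = (\<Sum>i<n. inner v (unit_vec i) *\<^sub>R unit_vec i)"
      by (simp add: Rn_expand)
    moreover have "inner v (unit_vec i) \<in> {-1..1}" for i
      using Cauchy_Schwarz_ineq2[of v "unit_vec i"] v
      by (simp add: norm_eq_sqrt_inner[of "unit_vec i"] inner_unit_vec_unit_vec abs_le_iff)
    ultimately show "v \<in> ?C n \<inter> {v. norm v = 1}"
      using v by (auto intro!: exI[of _ "\<lambda>i. inner v (unit_vec i)"])
  qed (auto intro!: subspace_sum subspace_scale subspace_Rn unit_vec_in_Rn)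
  moreover have "closed {v::rseq. norm v = 1}"
    by (intro closed_Collect_eq continuous_intros)
  ultimately show ?thesis
    by (simp add: compact_Int_closed)
qed

section \<open>Singular vectors of a finite-rank operator\<close>

lemma quadratic_nonpos_imp_zero:
  fixes a b :: real
  assumes "\<And>t. 2 * t * a + t\<^sup>2 * b \<le> 0"
  shows "a = 0"
proof (rule ccontr)
  assume "a \<noteq> 0"
  \<comment> \<open>For any positive \<open>c\<close> with 2 c + b > 0 the value
    \<open>t = a / c\<close> violates the assumption.\<close>
  define c where "c = 1 + \<bar>b\<bar>"
  have c: "c > 0" "2 * c + b > 0" by (auto simp: c_def)
  have "2 * (a / c) * a + (a / c)\<^sup>2 * b = a\<^sup>2 * (2 * c + b) / c\<^sup>2"
    using c by (simp add: field_simps power2_eq_square)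
  moreover have "a\<^sup>2 * (2 * c + b) / c\<^sup>2 > 0"
    using c \<open>a \<noteq> 0\<close> by simp
  ultimately show False
    using assms[of "a / c"] by linarith
qed

text \<open>The second assumption makes \<open>D\<close> vanish on the orthogonal complement of
  \<open>Rn n\<close>. Continuity and an adjoint, neither automatic for a linear map on this space,
  follow from it.\<close>

locale finite_rank_operator =
  fixes n :: nat and D :: "rseq \<Rightarrow> rseq"
  assumes lin: "linear D" and D_proj: "D (proj_Rn n v) = D v"
begin

lemma D_expand: "D v = (\<Sum>i<n. inner v (unit_vec i) *\<^sub>R D (unit_vec i))"
  by (subst D_proj[symmetric]) (simp add: proj_Rn_def linear_sum[OF lin] linear_scale[OF lin])

lemma continuous_D: "continuous_on S D"
  by (subst D_expand[abs_def]) (intro continuous_intros)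

text \<open>\<open>adjoint\<close> chooses a function with this property, so one has to be
  exhibited; finite rank gives it as an explicit sum.\<close>

lemma adjoint_D: "inner (D x) y = inner x (adjoint D y)"
proof -
  define f where "f y = (\<Sum>i<n. inner y (D (unit_vec i)) *\<^sub>R unit_vec i)" for y
  have "inner (D x) y = inner x (f y)" for x y
    by (subst D_expand) (simp add: f_def inner_sum_left inner_sum_right inner_commute mult.commute)
  then have "adjoint D = f"
    by (intro adjoint_unique) auto
  then show ?thesis
    using \<open>\<And>x y. inner (D x) y = inner x (f y)\<close> by simp
qed

lemma linear_adjoint_D: "linear (adjoint D)"
proof (rule linearI)
  show "adjoint D (x + y) = adjoint D x + adjoint D y" for x y
    by (rule vector_eq_ldot[THEN iffD1], rule allI) (simp add: inner_add_right flip: adjoint_D)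
  show "adjoint D (c *\<^sub>R x) = c *\<^sub>R adjoint D x" for c x
    by (rule vector_eq_ldot[THEN iffD1], rule allI) (simp flip: adjoint_D)
qed

text \<open>The last clause is the variational description of singular vectors. It contains the
  decreasing order, and the orthogonality of the images follows from it.\<close>

definition singular_system :: "nat \<Rightarrow> (nat \<Rightarrow> rseq) \<Rightarrow> bool"
  where "singular_system k u \<longleftrightarrow> orthonormal_fam k u \<and> (\<forall>i<k. u i \<in> Rn n) \<and>
    (\<forall>i<k. \<forall>v\<in>Rn n. (\<forall>j<i. inner v (u j) = 0) \<longrightarrow> norm (D v) \<le> norm (D (u i)) * norm v)"

lemma singular_system_exists: "k \<le> n \<Longrightarrow> \<exists>u. singular_system k u"
proof (induction k)
  case 0
  then show ?case by (simp add: singular_system_def orthonormal_fam_def)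
next
  case (Suc k)
  then obtain u where u: "singular_system k u" by auto
  define K where "K = {v \<in> Rn n. norm v = 1} \<inter> (\<Inter>j<k. {v. inner v (u j) = 0})"
  have "compact K"
    unfolding K_def
    by (intro compact_Int_closed compact_unit_sphere_Rn closed_INT ballI closed_Collect_eq continuous_intros)
  moreover have "K \<noteq> {}"
  proof -
    obtain y where "y \<in> Rn n" "norm y = 1" "\<And>i. i < k \<Longrightarrow> inner y (u i) = 0"
      by (rule extend_orthonormal[of k u n]) (use u Suc.prems in \<open>auto simp: singular_system_def\<close>)
    then have "y \<in> K"
      by (auto simp: K_def)
    then show ?thesis by auto
  qed
  moreover have "continuous_on K (\<lambda>v. norm (D v))"
    by (intro continuous_intros continuous_D)
  ultimately obtain x where x: "x \<in> K" "\<And>v. v \<in> K \<Longrightarrow> norm (D v) \<le> norm (D x)"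
    using continuous_attains_sup[of K "\<lambda>v. norm (D v)"] by auto
  have max: "norm (D v) \<le> norm (D x) * norm v" if v: "v \<in> Rn n" "\<forall>j<k. inner v (u j) = 0" for v
  proof (cases "v = 0")
    case False
    then have "v /\<^sub>R norm v \<in> K"
      using v by (auto simp: K_def subspace_scale[OF subspace_Rn])
    from x(2)[OF this] False show ?thesis
      by (simp add: linear_scale[OF lin] field_simps)
  qed (simp add: linear_0[OF lin])
  define w where "w = u(k := x)"
  have "singular_system (Suc k) w"
    unfolding singular_system_def
  proof (intro conjI allI impI ballI)
    have "inner x x = 1"
      using x(1) by (simp add: K_def dot_square_norm)
    then show "orthonormal_fam (Suc k) w"
      using u x(1) unfolding orthonormal_fam_def singular_system_def w_def K_def
      by (auto simp: less_Suc_eq inner_commute[of "u _" x])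
    show "w i \<in> Rn n" if "i < Suc k" for i
      using that u x(1) by (auto simp: w_def K_def singular_system_def)
    show "norm (D v) \<le> norm (D (w i)) * norm v"
      if "i < Suc k" "v \<in> Rn n" "\<forall>j<i. inner v (w j) = 0" for i v
    proof (cases "i = k")
      case True
      then show ?thesis
        using that max[of v] by (auto simp: w_def)
    next
      case False
      then have "\<forall>j<i. inner v (u j) = 0"
        using that by (auto simp: w_def)
      then show ?thesis
        using False that u by (auto simp: w_def singular_system_def)
    qed
  qed
  then show ?case by blast
qed

text \<open>For every real \<open>t\<close> the vector \<open>u i + t v\<close> competes in the
  maximisation that defines \<open>u i\<close>, so the term linear in \<open>t\<close> has to
  vanish.\<close>

lemma singular_system_orthogonal:
  assumes u: "singular_system k u" and i: "i < k" and v: "v \<in> Rn n" "\<And>j. j \<le> i \<Longrightarrow> inner v (u j) = 0"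
  shows "inner (D (u i)) (D v) = 0"
proof (rule quadratic_nonpos_imp_zero)
  fix t :: real
  have ui: "norm (u i) = 1" "u i \<in> Rn n" "\<And>j. j < i \<Longrightarrow> inner (u i) (u j) = 0"
    using u i by (auto simp: singular_system_def orthonormal_fam_def norm_eq_sqrt_inner)
  define y where "y = u i + t *\<^sub>R v"
  have "norm (D y) \<le> norm (D (u i)) * norm y"
  proof -
    have "y \<in> Rn n"
      unfolding y_def using ui v by (intro subspace_add subspace_scale subspace_Rn)
    moreover have "\<forall>j<i. inner y (u j) = 0"
      using ui v by (simp add: y_def inner_add_left)
    ultimately show ?thesis
      using u i by (simp add: singular_system_def)
  qed
  then have "(norm (D y))\<^sup>2 \<le> (norm (D (u i)))\<^sup>2 * (norm y)\<^sup>2"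
    using power_mono[of "norm (D y)" "norm (D (u i)) * norm y" 2] by (simp add: power_mult_distrib)
  moreover have "(norm y)\<^sup>2 = 1 + t\<^sup>2 * (norm v)\<^sup>2"
  proof -
    have "inner (u i) (u i) = 1"
      using ui by (simp add: dot_square_norm)
    then show ?thesis
      using v(2)[of i] unfolding power2_norm_eq_inner y_def
      by (simp add: inner_add_left inner_add_right inner_commute[of "u i" v] power2_eq_square)
  qed
  moreover have "(norm (D y))\<^sup>2 = (norm (D (u i)))\<^sup>2 + 2 * t * inner (D (u i)) (D v) + t\<^sup>2 * (norm (D v))\<^sup>2"
    unfolding power2_norm_eq_inner y_def linear_add[OF lin] linear_scale[OF lin]
    by (simp add: inner_add_left inner_add_right inner_commute[of "D v" "D (u i)"] power2_eq_square algebra_simps)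
  moreover have "X + s * (W - P * V) \<le> 0" if "A \<le> P * B" "B = 1 + s * V" "A = P + X + s * W"
    for A B P V W X s :: real
  proof -
    have "X + s * (W - P * V) = (P + X + s * W) - P * (1 + s * V)"
      by (simp add: algebra_simps)
    also have "\<dots> = A - P * B"
      by (simp add: that(2,3))
    finally show ?thesis
      using that(1) by simp
  qed
  ultimately show "2 * t * inner (D (u i)) (D v) + t\<^sup>2 * ((norm (D v))\<^sup>2 - (norm (D (u i)))\<^sup>2 * (norm v)\<^sup>2) \<le> 0"
    by blast
qed

end

text \<open>A nonzero remainder, orthogonal to every \<open>u i\<close>, would give
  \<open>n + 1\<close> independent vectors in a space spanned by \<open>n\<close>.\<close>

lemma orthonormal_expand:
  assumes u: "orthonormal_fam n u" "\<And>i. i < n \<Longrightarrow> u i \<in> Rn n" and v: "v \<in> Rn n"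
  shows "(\<Sum>i<n. inner v (u i) *\<^sub>R u i) = v"
proof (rule ccontr)
  define r where "r = v - (\<Sum>i<n. inner v (u i) *\<^sub>R u i)"
  assume "\<not> ?thesis"
  then have "r \<noteq> 0" by (simp add: r_def)
  have r: "inner r (u i) = 0" if "i < n" for i
    using that by (simp add: r_def inner_diff_left inner_sum_left orthonormal_famD[OF u(1)]
        if_distrib cong: if_cong)
  have rR: "r \<in> Rn n"
    unfolding r_def using u v by (intro subspace_diff subspace_sum subspace_scale subspace_Rn) auto
  define w where "w = u(n := r)"
  have u0: "u i \<noteq> 0" if "i < n" for i
    using orthonormal_famD[OF u(1) that that] by auto
  have w: "w i \<noteq> 0" "i \<noteq> j \<Longrightarrow> inner (w i) (w j) = 0" if "i < Suc n" "j < Suc n" for i j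
    using that \<open>r \<noteq> 0\<close> r u0 orthonormal_famD[OF u(1)]
    by (auto simp: w_def less_Suc_eq inner_commute[of _ r])
  have "w ` {..<Suc n} \<subseteq> Rn n"
    using u(2) rR by (auto simp: w_def less_Suc_eq)
  then have "w ` {..<Suc n} \<subseteq> span (unit_vec ` {..<n})"
    by (rule order_trans) (rule Rn_subset_span)
  moreover have "independent (w ` {..<Suc n})" "inj_on w {..<Suc n}"
    by (rule independent_orthogonal_family; use w in auto)+
  ultimately have "card (w ` {..<Suc n}) \<le> card (unit_vec ` {..<n})" "inj_on w {..<Suc n}"
    using independent_span_bound[of "unit_vec ` {..<n}" "w ` {..<Suc n}"] by auto
  then show False
    using card_image_le[of "{..<n}" unit_vec] by (simp add: card_image)
qed

text \<open>Uniqueness of the square root: it has the same eigenvectors as the operator.\<close>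

lemma op_sqrt_eqI:
  fixes S :: "'a::real_inner \<Rightarrow> 'a"
  assumes S: "linear S" "\<And>x y. inner (S x) y = inner x (S y)" "\<And>x. 0 \<le> inner (S x) x" "S \<circ> S = A"
    and eig: "\<And>v. v \<in> span {x. \<exists>\<mu>\<ge>0. S x = \<mu> *\<^sub>R x}"
  shows "op_sqrt A = S"
  unfolding op_sqrt_def
proof (rule the_equality)
  fix T assume T: "linear T \<and> (\<forall>x y. inner (T x) y = inner x (T y)) \<and> (\<forall>x. 0 \<le> inner (T x) x) \<and> T \<circ> T = A"
  have TT: "T (T x) = S (S x)" for x
    using T S(4) by (metis comp_apply)
  have TS: "T x = S x" if x: "\<mu> \<ge> 0" "S x = \<mu> *\<^sub>R x" for x \<mu>
  proof (cases "\<mu> = 0")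
    case True
    have "inner (T x) (T x) = inner x (T (T x))"
      using T by auto
    then show ?thesis
      using True x TT[of x] linear_0[OF S(1)] by simp
  next
    case False
    \<comment> \<open>If nonzero, \<open>w\<close> would be an eigenvector of the nonnegative
      \<open>T\<close> for the negative eigenvalue \<open>- \<mu>\<close>.\<close>
    define w where "w = T x - \<mu> *\<^sub>R x"
    have "T w = - \<mu> *\<^sub>R w"
      using T TT[of x] x linear_scale[OF S(1)] by (simp add: w_def linear_diff linear_scale scaleR_diff_right)
    moreover have "0 \<le> inner (T w) w"
      using T by auto
    ultimately have "\<mu> * inner w w \<le> 0"
      by simp
    then have "inner w w = 0"
      using False x inner_ge_zero[of w] by (simp add: mult_le_0_iff)
    then show ?thesis
      by (simp add: w_def x)
  qed
  have "T v = S v" for v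
    by (rule linear_eq_on_span[of T S "{x. \<exists>\<mu>\<ge>0. S x = \<mu> *\<^sub>R x}"]) (use T S(1) eig[of v] TS in auto)
  then show "T = S" by auto
qed (use S in auto)

text \<open>
  The operator with eigenvalue \<open>f i\<close> at \<open>u i\<close> and \<open>c\<close> on the orthogonal complement. Vanishing
  members of the family \<open>u\<close> are permitted.
\<close>

definition spec_op :: "nat \<Rightarrow> (nat \<Rightarrow> 'a::real_inner) \<Rightarrow> real \<Rightarrow> (nat \<Rightarrow> real) \<Rightarrow> 'a \<Rightarrow> 'a"
  where "spec_op n u c f v = c *\<^sub>R v + (\<Sum>i<n. ((f i - c) * inner v (u i)) *\<^sub>R u i)"

locale orthogonal_units =
  fixes n :: nat and u :: "nat \<Rightarrow> 'a::real_inner"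
  assumes uu: "i < n \<Longrightarrow> j < n \<Longrightarrow> inner (u i) (u j) = (if i = j \<and> u i \<noteq> 0 then 1 else 0)"
begin

lemma linear_spec_op: "linear (spec_op n u c f)"
  by (rule linearI)
    (simp_all add: spec_op_def inner_add_left scaleR_add_right scaleR_add_left distrib_left
      sum.distrib scaleR_sum_right mult.left_commute)

lemma inner_spec_op: "inner (spec_op n u c f v) w = c * inner v w + (\<Sum>i<n. (f i - c) * inner v (u i) * inner w (u i))"
  by (simp add: spec_op_def inner_add_left inner_sum_left inner_commute[of w])

lemma spec_op_self_adjoint: "inner (spec_op n u c f v) w = inner v (spec_op n u c f w)"
  unfolding inner_commute[of v] inner_spec_op by (simp add: inner_commute mult_ac)

lemma spec_op_unit: "i < n \<Longrightarrow> spec_op n u c f (u i) = f i *\<^sub>R u i"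
proof -
  assume i: "i < n"
  have "(\<Sum>j<n. ((f j - c) * inner (u i) (u j)) *\<^sub>R u j) = (\<Sum>j<n. if i = j then (f i - c) *\<^sub>R u i else 0)"
    using i by (intro sum.cong) (auto simp: uu)
  then show ?thesis
    using i by (simp add: spec_op_def flip: scaleR_add_left)
qed

lemma spec_op_complement: "(\<And>i. i < n \<Longrightarrow> inner v (u i) = 0) \<Longrightarrow> spec_op n u c f v = c *\<^sub>R v"
  by (simp add: spec_op_def)

lemma complement: "j < n \<Longrightarrow> inner (v - (\<Sum>i<n. inner v (u i) *\<^sub>R u i)) (u j) = 0"
proof -
  assume j: "j < n"
  have "inner (\<Sum>i<n. inner v (u i) *\<^sub>R u i) (u j) = (\<Sum>i<n. if i = j then inner v (u j) else 0)"
    using j unfolding inner_sum_left by (intro sum.cong) (auto simp: uu)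
  then show ?thesis
    using j by (simp add: inner_diff_left)
qed

lemma in_span_eigenvectors:
  assumes "c \<ge> 0" "\<And>i. i < n \<Longrightarrow> f i \<ge> 0"
  shows "v \<in> span {x. \<exists>\<mu>\<ge>0. spec_op n u c f x = \<mu> *\<^sub>R x}" (is "_ \<in> span ?E")
proof -
  have "(v - (\<Sum>i<n. inner v (u i) *\<^sub>R u i)) + (\<Sum>i<n. inner v (u i) *\<^sub>R u i)
      \<in> span ?E"
  proof (intro span_add span_sum span_scale)
    show "v - (\<Sum>i<n. inner v (u i) *\<^sub>R u i) \<in> span ?E"
      using assms spec_op_complement[OF complement] by (intro span_base) blast
    show "u i \<in> span ?E" if "i \<in> {..<n}" for i
      using assms spec_op_unit that by (intro span_base) blast
  qed
  then show ?thesis by simp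
qed

lemma spec_op_comp: "spec_op n u c f (spec_op n u d g v) = spec_op n u (c * d) (\<lambda>i. f i * g i) v"
proof -
  have "spec_op n u c f (spec_op n u d g v)
      = c *\<^sub>R (d *\<^sub>R v + (\<Sum>i<n. ((g i - d) * inner v (u i)) *\<^sub>R u i))
        + (\<Sum>i<n. ((f i - c) * (g i * inner v (u i))) *\<^sub>R u i)"
  proof -
    have "inner (spec_op n u d g v) (u i) = g i * inner v (u i)" if "i < n" for i
      unfolding spec_op_self_adjoint spec_op_unit[OF that] by simp
    then show ?thesis
      unfolding spec_op_def[of n u c f] by (simp add: spec_op_def[of n u d g])
  qed
  then show ?thesis
    by (simp add: spec_op_def scaleR_add_right scaleR_sum_right algebra_simps flip: sum.distrib)
qed

lemma spec_op_nonneg: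
  assumes "c \<ge> 0" "\<And>i. i < n \<Longrightarrow> f i \<ge> 0"
  shows "0 \<le> inner (spec_op n u c f v) v"
proof -
  define g where "g i = sqrt (f i)" for i
  have "spec_op n u c f v = spec_op n u (sqrt c * sqrt c) (\<lambda>i. g i * g i) v"
    using assms by (simp add: spec_op_def g_def)
  also have "\<dots> = spec_op n u (sqrt c) g (spec_op n u (sqrt c) g v)"
    by (simp add: spec_op_comp)
  finally have eq: "spec_op n u c f v = spec_op n u (sqrt c) g (spec_op n u (sqrt c) g v)" .
  show ?thesis
    unfolding eq by (subst spec_op_self_adjoint) (rule inner_ge_zero)
qed

lemma op_sqrt_spec_op:
  assumes "c \<ge> 0" "\<And>i. i < n \<Longrightarrow> f i \<ge> 0"
  shows "op_sqrt (spec_op n u c f) = spec_op n u (sqrt c) (\<lambda>i. sqrt (f i))"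
proof (rule op_sqrt_eqI)
  show "spec_op n u (sqrt c) (\<lambda>i. sqrt (f i)) \<circ> spec_op n u (sqrt c) (\<lambda>i. sqrt (f i)) = spec_op n u c f"
  proof (rule ext)
    fix v
    show "(spec_op n u (sqrt c) (\<lambda>i. sqrt (f i)) \<circ> spec_op n u (sqrt c) (\<lambda>i. sqrt (f i))) v = spec_op n u c f v"
      unfolding comp_apply spec_op_comp using assms by (simp add: spec_op_def)
  qed
  show "0 \<le> inner (spec_op n u (sqrt c) (\<lambda>i. sqrt (f i)) x) x" for x
    by (rule spec_op_nonneg) (use assms in auto)
qed (use assms in \<open>auto intro!: linear_spec_op in_span_eigenvectors simp: spec_op_self_adjoint\<close>)

lemma inv_spec_op:
  assumes "\<And>i. i < n \<Longrightarrow> f i \<noteq> 0"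
  shows "inv_into UNIV (spec_op n u 1 f) = spec_op n u 1 (\<lambda>i. 1 / f i)"
proof (rule inv_unique_comp)
  show "spec_op n u 1 f \<circ> spec_op n u 1 (\<lambda>i. 1 / f i) = id" "spec_op n u 1 (\<lambda>i. 1 / f i) \<circ> spec_op n u 1 f = id"
    using assms by (auto simp: fun_eq_iff spec_op_comp) (simp_all add: spec_op_def)
qed

end

section \<open>Singular value decomposition of the differential\<close>

locale singular_basis = finite_rank_operator +
  fixes u :: "nat \<Rightarrow> rseq"
  assumes u: "singular_system n u"
begin

definition \<sigma> :: "nat \<Rightarrow> real" where "\<sigma> i = norm (D (u i))"
definition \<rho> :: "nat \<Rightarrow> real" where "\<rho> i = sqrt (1 + (\<sigma> i)\<^sup>2)"
text \<open>For \<open>\<sigma> i = 0\<close> this is the zero vector.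
  \<open>orthogonal_units\<close> permits it, which spares completing the left singular vectors to a
  basis.\<close>

definition w :: "nat \<Rightarrow> rseq" where "w i = D (u i) /\<^sub>R \<sigma> i"

lemma \<sigma>_nonneg: "\<sigma> i \<ge> 0" by (simp add: \<sigma>_def)

lemma \<rho>_pos: "\<rho> i > 0" and \<rho>_square: "\<rho> i * \<rho> i = 1 + (\<sigma> i)\<^sup>2"
  using zero_le_power2[of "\<sigma> i"] by (simp_all add: \<rho>_def add_pos_nonneg)

lemma u_orthonormal: "orthonormal_fam n u" and u_Rn: "i < n \<Longrightarrow> u i \<in> Rn n"
  using u by (auto simp: singular_system_def)

lemma u_nonzero: "i < n \<Longrightarrow> u i \<noteq> 0"
  using orthonormal_famD[OF u_orthonormal, of i i] by auto

lemma expand: "v \<in> Rn n \<Longrightarrow> (\<Sum>i<n. inner v (u i) *\<^sub>R u i) = v"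
  by (rule orthonormal_expand) (auto intro: u_orthonormal u_Rn)

lemma inner_expand: "v \<in> Rn n \<Longrightarrow> inner v x = (\<Sum>i<n. inner v (u i) * inner x (u i))"
proof -
  assume v: "v \<in> Rn n"
  have "inner (\<Sum>i<n. inner v (u i) *\<^sub>R u i) x = (\<Sum>i<n. inner v (u i) * inner x (u i))"
    by (simp add: inner_sum_left inner_commute[of x])
  then show ?thesis
    by (simp add: expand[OF v])
qed

lemma Du_orthogonal: "i < n \<Longrightarrow> j < n \<Longrightarrow> inner (D (u i)) (D (u j)) = (if i = j then (\<sigma> i)\<^sup>2 else 0)"
proof -
  assume ij: "i < n" "j < n"
  have less: "inner (D (u i)) (D (u j)) = 0" if "i < j" "j < n" for i j
    by (rule singular_system_orthogonal[OF u])
      (use that u_Rn orthonormal_famD[OF u_orthonormal] in auto)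
  show ?thesis
    using less[of i j] less[of j i] ij
    by (cases i j rule: linorder_cases) (auto simp: \<sigma>_def dot_square_norm inner_commute)
qed

lemma D_w: "D (u i) = \<sigma> i *\<^sub>R w i"
  by (cases "D (u i) = 0") (simp_all add: w_def \<sigma>_def)

lemma D_u_expand: "D v = (\<Sum>i<n. inner v (u i) *\<^sub>R D (u i))"
proof -
  have "D v = D (\<Sum>i<n. inner (proj_Rn n v) (u i) *\<^sub>R u i)"
    by (subst expand) (simp_all add: proj_Rn_in D_proj)
  then show ?thesis
    by (simp add: linear_sum[OF lin] linear_scale[OF lin] inner_proj_Rn u_Rn)
qed

sublocale U: orthogonal_units n u
  by unfold_locales (use orthonormal_famD[OF u_orthonormal] u_nonzero in auto)

sublocale W: orthogonal_units n w
proof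
  fix i j assume ij: "i < n" "j < n"
  show "inner (w i) (w j) = (if i = j \<and> w i \<noteq> 0 then 1 else 0)"
  proof (cases "\<sigma> i = 0")
    case False
    then have "w i \<noteq> 0"
      by (auto simp: w_def \<sigma>_def)
    with False ij show ?thesis
      by (cases "i = j") (simp_all add: w_def Du_orthogonal power2_eq_square field_simps)
  qed (simp add: w_def)
qed

lemma adjoint_D_D: "adjoint D (D v) = spec_op n u 0 (\<lambda>i. (\<sigma> i)\<^sup>2) v"
proof (rule vector_eq_ldot[THEN iffD1], rule allI)
  fix x
  have "inner x (adjoint D (D v)) = inner (D x) (D v)"
    by (simp add: adjoint_D)
  also have "\<dots> = (\<Sum>i<n. \<Sum>j<n. inner x (u i) * (inner v (u j) * (if i = j then (\<sigma> i)\<^sup>2 else 0)))"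
    by (subst D_u_expand[of x], subst D_u_expand[of v])
      (auto simp: inner_sum_left inner_sum_right Du_orthogonal sum_distrib_left intro!: sum.cong)
  also have "\<dots> = inner x (spec_op n u 0 (\<lambda>i. (\<sigma> i)\<^sup>2) v)"
    unfolding inner_commute[of x "spec_op _ _ _ _ _"] U.inner_spec_op
    by (auto simp: if_distrib mult_ac cong: if_cong intro!: sum.cong)
  finally show "inner x (adjoint D (D v)) = inner x (spec_op n u 0 (\<lambda>i. (\<sigma> i)\<^sup>2) v)" .
qed

lemma adjoint_expand: "adjoint D x = (\<Sum>i<n. inner x (D (u i)) *\<^sub>R u i)"
proof (rule vector_eq_ldot[THEN iffD1], rule allI)
  fix y
  show "inner y (adjoint D x) = inner y (\<Sum>i<n. inner x (D (u i)) *\<^sub>R u i)"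
    by (subst adjoint_D[symmetric], subst D_u_expand)
      (simp add: inner_sum_left inner_sum_right inner_commute mult.commute)
qed

lemma op_sqrt_adjoint: "op_sqrt (adjoint D \<circ> D) = spec_op n u 0 \<sigma>"
proof -
  have "adjoint D \<circ> D = spec_op n u 0 (\<lambda>i. (\<sigma> i)\<^sup>2)"
    by (rule ext) (simp add: adjoint_D_D)
  then show ?thesis
    by (simp add: U.op_sqrt_spec_op \<sigma>_nonneg)
qed

lemma op_sqrt_G: "op_sqrt (G_op D) = spec_op n u 1 \<rho>"
proof -
  have "G_op D = spec_op n u 1 (\<lambda>i. 1 + (\<sigma> i)\<^sup>2)"
    by (rule ext) (simp add: G_op_def adjoint_D_D spec_op_def)
  then show ?thesis
    by (simp add: U.op_sqrt_spec_op \<rho>_def[abs_def])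
qed

lemma op_sqrt_H: "op_sqrt (H_op D) = spec_op n w 1 \<rho>"
proof -
  have "H_op D = spec_op n w 1 (\<lambda>i. 1 + (\<sigma> i)\<^sup>2)"
  proof (rule ext)
    fix x
    have "H_op D x = x + (\<Sum>i<n. inner x (D (u i)) *\<^sub>R D (u i))"
      by (simp add: H_op_def adjoint_expand linear_sum[OF lin] linear_scale[OF lin])
    then show "H_op D x = spec_op n w 1 (\<lambda>i. 1 + (\<sigma> i)\<^sup>2) x"
      by (simp add: D_w spec_op_def power2_eq_square mult_ac)
  qed
  then show ?thesis
    by (simp add: W.op_sqrt_spec_op \<rho>_def[abs_def])
qed

section \<open>The tangent and normal isometries in singular bases\<close>

abbreviation G_inv_sqrt :: "rseq \<Rightarrow> rseq"
  where "G_inv_sqrt \<equiv> spec_op n u 1 (\<lambda>i. 1 / \<rho> i)"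

abbreviation H_inv_sqrt :: "rseq \<Rightarrow> rseq"
  where "H_inv_sqrt \<equiv> spec_op n w 1 (\<lambda>i. 1 / \<rho> i)"

abbreviation J_frame :: "nat \<Rightarrow> rseq \<times> rseq"
  where "J_frame i \<equiv> J_op n D (tangent_frame D i)"

lemma tangent_iso_eq: "tangent_iso D v = (G_inv_sqrt v, D (G_inv_sqrt v))"
  using \<rho>_pos by (simp add: tangent_iso_def op_sqrt_G U.inv_spec_op less_imp_neq[symmetric])

lemma normal_iso_eq: "normal_iso D v = (- adjoint D (H_inv_sqrt v), H_inv_sqrt v)"
  using \<rho>_pos by (simp add: normal_iso_def op_sqrt_H W.inv_spec_op less_imp_neq[symmetric])

lemma linear_tangent_iso: "linear (tangent_iso D)"
proof -
  have "linear (\<lambda>v. D (G_inv_sqrt v))"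
    using linear_compose[OF U.linear_spec_op lin] by (simp add: comp_def)
  then show ?thesis
    using U.linear_spec_op unfolding tangent_iso_eq[abs_def]
    by (auto simp: linear_iff scaleR_Pair)
qed

lemma linear_normal_D: "linear (\<lambda>v. normal_iso D (D v))"
proof -
  have 1: "linear (\<lambda>v. H_inv_sqrt (D v))"
    using linear_compose[OF lin W.linear_spec_op] by (simp add: comp_def)
  have 2: "linear (\<lambda>v. adjoint D (H_inv_sqrt (D v)))"
    using linear_compose[OF 1 linear_adjoint_D] by (simp add: comp_def)
  show ?thesis
    using 1 2 unfolding normal_iso_eq
    by (auto simp: linear_iff scaleR_Pair)
qed

text \<open>The matched pairs for the torus lemma: \<open>J\<close> maps \<open>e' i\<close> to
  \<open>\<sigma> i\<close> times \<open>\<nu> i\<close>.\<close>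

definition e' :: "nat \<Rightarrow> rseq \<times> rseq" where "e' i = (1 / \<rho> i) *\<^sub>R (u i, D (u i))"
definition \<nu> :: "nat \<Rightarrow> rseq \<times> rseq" where "\<nu> i = (if \<sigma> i = 0 then 0 else (1 / \<rho> i) *\<^sub>R (- \<sigma> i *\<^sub>R u i, w i))"

lemma tangent_iso_u: "i < n \<Longrightarrow> tangent_iso D (u i) = e' i"
  by (simp add: tangent_iso_eq U.spec_op_unit linear_scale[OF lin] e'_def)

lemma adjoint_D_u: "i < n \<Longrightarrow> adjoint D (D (u i)) = (\<sigma> i)\<^sup>2 *\<^sub>R u i"
  by (simp add: adjoint_D_D U.spec_op_unit)

lemma normal_iso_Du: "i < n \<Longrightarrow> normal_iso D (D (u i)) = \<sigma> i *\<^sub>R \<nu> i"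
proof -
  assume i: "i < n"
  have S: "H_inv_sqrt (D (u i)) = (1 / \<rho> i) *\<^sub>R D (u i)"
    using i W.spec_op_unit[of i 1 "\<lambda>i. 1 / \<rho> i"] by (simp add: D_w linear_scale[OF W.linear_spec_op])
  show ?thesis
    unfolding normal_iso_eq S linear_scale[OF linear_adjoint_D] adjoint_D_u[OF i]
    by (auto simp: \<nu>_def D_w power2_eq_square zero_prod_def)
qed

lemma split_frame_singular: "split_frame n e' \<nu>"
  unfolding split_frame_def orthonormal_fam_def
proof (intro conjI allI impI)
  fix i j assume ij: "i < n" "j < n"
  have uu: "inner (u i) (u j) = (if i = j then 1 else 0)"
    by (rule orthonormal_famD[OF u_orthonormal ij])
  have \<rho>2: "1 / \<rho> i * (1 / \<rho> i) * (1 + (\<sigma> i)\<^sup>2) = 1"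
    unfolding \<rho>_square[symmetric] using \<rho>_pos[of i] by simp
  show "inner (e' i) (e' j) = (if i = j then 1 else 0)"
    using ij \<rho>2 by (auto simp: e'_def uu Du_orthogonal distrib_left)
  have ww: "inner (w i) (w j) = (if i = j then 1 else 0)" if "\<sigma> i \<noteq> 0" "\<sigma> j \<noteq> 0"
    using W.uu[OF ij] that by (auto simp: w_def \<sigma>_def)
  have Dw: "inner (D (u i)) (w j) = (if i = j then \<sigma> i else 0)" if "\<sigma> j \<noteq> 0"
    using ij that by (simp add: w_def Du_orthogonal power2_eq_square)
  show "inner (e' i) (\<nu> j) = 0"
    by (auto simp: e'_def \<nu>_def uu Dw)
  show "inner (\<nu> i) (\<nu> j) = (if i = j \<and> \<nu> i \<noteq> 0 then 1 else 0)"
  proof (cases "\<sigma> i = 0 \<or> \<sigma> j = 0")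
    case False
    have pos: "1 + \<sigma> k * \<sigma> k \<noteq> 0" for k
      using zero_le_square[of "\<sigma> k"] by linarith
    from False have "inner (\<nu> i) (\<nu> j)
        = 1 / \<rho> i * (1 / \<rho> j) * (inner (w i) (w j) + \<sigma> i * \<sigma> j * inner (u i) (u j))"
      by (simp add: \<nu>_def algebra_simps add_divide_distrib)
    then have "inner (\<nu> i) (\<nu> j) = (if i = j then 1 else 0)"
      using \<rho>2 False uu ww pos by (cases "i = j") (simp_all add: power2_eq_square)
    then show ?thesis by auto
  qed (auto simp: \<nu>_def)
qed

lemma tangent_frame_expand: "i < n \<Longrightarrow> tangent_frame D i = (\<Sum>k<n. inner (unit_vec i) (u k) *\<^sub>R e' k)"
  unfolding tangent_frame_def
  by (subst expand[symmetric, of "unit_vec i"])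
    (simp_all add: unit_vec_in_Rn linear_sum[OF linear_tangent_iso] linear_scale[OF linear_tangent_iso] tangent_iso_u)

text \<open>\<open>J_op\<close> contains an inverse function of the isometry, so its values on the
  frame are known only once injectivity is.\<close>

lemma inj_tangent_iso: "inj (tangent_iso D)"
proof -
  have "inj (G_inv_sqrt)"
  proof (rule inj_on_inverseI)
    show "spec_op n u 1 \<rho> (G_inv_sqrt v) = v" for v
      using \<rho>_pos by (simp add: U.spec_op_comp less_imp_neq[symmetric]) (simp add: spec_op_def)
  qed
  then show ?thesis
    by (auto simp: tangent_iso_eq inj_def)
qed

lemma J_tangent_frame: "i < n \<Longrightarrow> J_frame i = normal_iso D (D (unit_vec i))"
  using inj_tangent_iso unfolding J_op_def tangent_frame_def
  by (subst inv_into_f_f) (auto simp: unit_vec_in_Rn intro: inj_on_subset)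

lemma J_tangent_frame_expand:
  "i < n \<Longrightarrow> J_frame i = (\<Sum>k<n. inner (unit_vec i) (u k) *\<^sub>R (\<sigma> k *\<^sub>R \<nu> k))"
  unfolding J_tangent_frame
  by (subst expand[symmetric, of "unit_vec i"])
    (simp_all add: unit_vec_in_Rn linear_sum[OF linear_normal_D] linear_scale[OF linear_normal_D] normal_iso_Du)

lemma change_of_basis:
  "i < n \<Longrightarrow> j < n \<Longrightarrow> (\<Sum>k<n. inner (unit_vec i) (u k) * inner (unit_vec j) (u k)) = (if i = j then 1 else 0)"
  using inner_expand[OF unit_vec_in_Rn[of i n], of "unit_vec j"] by (simp add: inner_unit_vec_unit_vec)

lemma tangent_frame_orthonormal: "orthonormal_fam n (tangent_frame D)"
proof -
  have "inner (tangent_frame D i) (tangent_frame D j) = (if i = j then 1 else 0)" if "i < n" "j < n" for i j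
  proof -
    have "inner (tangent_frame D i) (tangent_frame D j)
        = (\<Sum>k<n. \<Sum>l<n. inner (unit_vec i) (u k) * (inner (unit_vec j) (u l) * (if k = l then 1 else 0)))"
      using that split_frame_singular
      by (subst (1 2) tangent_frame_expand)
        (auto simp: inner_sum_left inner_sum_right sum_distrib_left split_frame_def orthonormal_fam_def intro!: sum.cong)
    then show ?thesis
      using change_of_basis[OF that] by (simp add: if_distrib cong: if_cong)
  qed
  then show ?thesis
    by (simp add: orthonormal_fam_def)
qed

lemma tangent_frame_J:
  "i < n \<Longrightarrow> j < n \<Longrightarrow> inner (tangent_frame D i) (J_frame j) = 0"
  using split_frame_singular
  by (simp add: tangent_frame_expand[of i] J_tangent_frame_expand inner_sum_left inner_sum_right split_frame_def)

text \<open>One orthogonal matrix expresses both the frame and its image under \<open>J\<close> in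
  singular vectors, so it acts on whole rows of the pencil and costs only a sign.\<close>

lemma dt_pencil_singular:
  "dt n (\<lambda>i j. pencil (tangent_frame D) J_frame (v j) i)
      = dt n (\<lambda>i j. pencil e' (\<lambda>k. \<sigma> k *\<^sub>R \<nu> k) (v j) i) \<or>
   dt n (\<lambda>i j. pencil (tangent_frame D) J_frame (v j) i)
      = - dt n (\<lambda>i j. pencil e' (\<lambda>k. \<sigma> k *\<^sub>R \<nu> k) (v j) i)"
  (is "?d = ?d' \<or> _")
proof -
  let ?Q = "\<lambda>i k. inner (unit_vec i) (u k)"
  have "?d
      = dt n (\<lambda>i j. \<Sum>k<n. [:?Q i k:] * pencil e' (\<lambda>k. \<sigma> k *\<^sub>R \<nu> k) (v j) k)"
  proof (rule dt_cong)
    fix i j assume i: "i < n"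
    show "pencil (tangent_frame D) J_frame (v j) i
        = (\<Sum>k<n. [:?Q i k:] * pencil e' (\<lambda>k. \<sigma> k *\<^sub>R \<nu> k) (v j) k)"
      using i by (simp add: pencil_def J_tangent_frame_expand inner_sum_left sum_pCons)
        (simp add: tangent_frame_expand inner_sum_left mult_ac)
  qed
  also have "\<dots> = dt n (\<lambda>i j. [:?Q i j:]) * ?d'"
    by (rule dt_mult)
  finally show ?thesis
    using dt_poly_orthogonal[of n ?Q] change_of_basis by auto
qed

section \<open>Singular values and rank\<close>

lemma \<sigma>_antimono: "i \<le> j \<Longrightarrow> j < n \<Longrightarrow> \<sigma> j \<le> \<sigma> i"
proof -
  assume ij: "i \<le> j" "j < n"
  have "norm (D (u j)) \<le> norm (D (u i)) * norm (u j)"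
    using u ij orthonormal_famD[OF u_orthonormal] unfolding singular_system_def by auto
  moreover have "norm (u j) = 1"
    using orthonormal_famD[OF u_orthonormal, of j j] ij by (simp add: norm_eq_sqrt_inner)
  ultimately show ?thesis
    by (simp add: \<sigma>_def)
qed

text \<open>Inside \<open>Rn n\<close> the eigenspace of \<open>\<mu>\<close> is spanned by the
  \<open>u i\<close> with \<open>\<sigma> i = \<mu>\<close>; the restriction to \<open>Rn n\<close>
  keeps the multiplicity of 0 finite. Multiplicities fix the multiset, and the order fixes the
  list.\<close>

lemma singular_values_eq: "singular_values n D = map \<sigma> [0..<n]"
  unfolding singular_values_def
proof (rule the_equality)
  let ?V = "\<lambda>\<mu>. {v \<in> Rn n. op_sqrt (adjoint D \<circ> D) v = \<mu> *\<^sub>R v}"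
  have sorted: "sorted_wrt (\<ge>) (map \<sigma> [0..<n])"
    by (auto simp: sorted_wrt_iff_nth_less intro: \<sigma>_antimono)
  have count: "count_list (map \<sigma> [0..<n]) \<mu> = dim (?V \<mu>)" for \<mu>
  proof -
    let ?I = "{i. i < n \<and> \<sigma> i = \<mu>}"
    have "?V \<mu> \<subseteq> span (u ` ?I)"
    proof
      fix v assume v: "v \<in> ?V \<mu>"
      have z: "inner v (u i) = 0" if "i < n" "\<sigma> i \<noteq> \<mu>" for i
      proof -
        have "inner (spec_op n u 0 \<sigma> v) (u i) = \<sigma> i * inner v (u i)"
          by (subst U.spec_op_self_adjoint) (simp add: U.spec_op_unit that)
        moreover have "spec_op n u 0 \<sigma> v = \<mu> *\<^sub>R v"
          using v by (simp add: op_sqrt_adjoint)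
        ultimately show ?thesis
          using that by simp
      qed
      have "(\<Sum>i<n. inner v (u i) *\<^sub>R u i) \<in> span (u ` ?I)"
      proof (intro span_sum)
        fix i assume "i \<in> {..<n}"
        then show "inner v (u i) *\<^sub>R u i \<in> span (u ` ?I)"
          using z[of i] by (cases "\<sigma> i = \<mu>") (simp_all add: span_zero span_scale span_base)
      qed
      then show "v \<in> span (u ` ?I)"
        using expand[of v] v by simp
    qed
    moreover have "u ` ?I \<subseteq> ?V \<mu>"
      by (auto simp: op_sqrt_adjoint U.spec_op_unit u_Rn)
    moreover have "independent (u ` ?I)"
      using orthonormal_fam_independent(1)[OF u_orthonormal] by (rule independent_mono) auto
    moreover have "inj_on u ?I"
      using orthonormal_fam_independent(2)[OF u_orthonormal] by (rule inj_on_subset) auto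
    ultimately have "dim (?V \<mu>) = card ?I"
      by (intro dim_unique[of "u ` ?I"]) (auto simp: card_image)
    moreover have "count_list (map \<sigma> [0..<n]) \<mu> = card ?I"
    proof -
      have "count_list (map \<sigma> [0..<n]) \<mu> = length (filter (\<lambda>i. \<sigma> i = \<mu>) [0..<n])"
        by (simp add: count_list_eq_length_filter filter_map comp_def) (metis (mono_tags))
      also have "\<dots> = card {i. i < n \<and> \<sigma> i = \<mu>}"
        by (subst length_filter_conv_card) (auto intro!: arg_cong[where f = card])
      finally show ?thesis .
    qed
    ultimately show ?thesis by simp
  qed
  show "sorted_wrt (\<ge>) (map \<sigma> [0..<n]) \<and> (\<forall>\<mu>. count_list (map \<sigma> [0..<n]) \<mu> =
      dim (?V \<mu>))"
    using sorted count by blast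
  fix s assume s: "sorted_wrt (\<ge>) s \<and> (\<forall>\<mu>. count_list s \<mu> = dim (?V \<mu>))"
  then have "mset s = mset (map \<sigma> [0..<n])"
    using count by (intro multiset_eqI) (metis count_mset)
  then have "mset (rev s) = mset (rev (map \<sigma> [0..<n]))"
    by simp
  moreover have "sorted (rev s)" "sorted (rev (map \<sigma> [0..<n]))"
    using s sorted by (simp_all only: sorted_wrt_rev)
  ultimately have "rev s = rev (map \<sigma> [0..<n])"
    by (metis properties_for_sort)
  then show "s = map \<sigma> [0..<n]"
    by simp
qed

text \<open>Otherwise \<open>D (u 0)\<close> to \<open>D (u i)\<close> would be more than
  \<open>r\<close> nonzero orthogonal vectors in the image.\<close>

lemma \<sigma>_zero_beyond_rank:
  assumes "op_rank n D \<le> r" "r \<le> i" "i < n"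
  shows "\<sigma> i = 0"
proof (rule ccontr)
  assume ne: "\<sigma> i \<noteq> 0"
  have pos: "\<sigma> j \<noteq> 0" if "j \<le> i" for j
    using \<sigma>_antimono[OF that \<open>i < n\<close>] \<sigma>_nonneg[of i] ne by linarith
  have Du: "D (u j) \<noteq> 0" if "j \<le> i" for j
    using pos[OF that] by (auto simp: \<sigma>_def)
  let ?B = "(\<lambda>j. D (u j)) ` {..i}"
  have ind: "independent ?B" "inj_on (\<lambda>j. D (u j)) {..i}"
    by (rule independent_orthogonal_family; use Du Du_orthogonal \<open>i < n\<close> in auto)+
  have "?B \<subseteq> D ` Rn n"
    using u_Rn \<open>i < n\<close> by auto
  then obtain C where C: "?B \<subseteq> C" "C \<subseteq> D ` Rn n" "independent C" "D ` Rn n \<subseteq> span C"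
    using maximal_independent_subset_extend[OF _ ind(1)] by metis
  have "C \<subseteq> span ((\<lambda>j. D (u j)) ` {..<n})"
  proof
    fix x assume "x \<in> C"
    then obtain v where "x = D v" using C(2) by auto
    then show "x \<in> span ((\<lambda>j. D (u j)) ` {..<n})"
      by (simp only:, subst D_u_expand) (intro span_sum span_scale span_base, auto)
  qed
  then have "finite C"
    using independent_span_bound[of "(\<lambda>j. D (u j)) ` {..<n}" C] C(3) by simp
  moreover have "dim (D ` Rn n) = card C"
    using C by (intro dim_unique) auto
  ultimately have "card ?B \<le> dim (D ` Rn n)"
    using C(1) by (simp add: card_mono)
  then show False
    using assms(1,2) ind(2) by (simp add: card_image op_rank_def)
qed

end

lemma (in finite_rank_operator) obtain_singular_basis:
  obtains u where "singular_basis n D u"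
  using singular_system_exists[OF order_refl] finite_rank_operator_axioms
  by (auto simp: singular_basis_def singular_basis_axioms_def)

section \<open>The form at a point\<close>

lemma nth_delete_nth: "Suc k < length vs \<Longrightarrow> delete_nth j vs ! k = vs ! skip j k"
  by (auto simp: delete_nth_def skip_def nth_append min_def)

lemma length_delete_nth: "j < length vs \<Longrightarrow> length (delete_nth j vs) = length vs - 1"
  by (simp add: delete_nth_def)

lemma set_delete_nth: "set (delete_nth j vs) \<subseteq> set vs"
  unfolding delete_nth_def by (auto dest: in_set_takeD in_set_dropD)

text \<open>\<open>wedge1\<close> is the Laplace expansion along the first row.\<close>

lemma wedge_covectors_eq_dt:
  "length vs = length \<alpha>s \<Longrightarrow> wedge_covectors \<alpha>s vs = dt (length \<alpha>s) (\<lambda>i j. (\<alpha>s ! i) (vs ! j))"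
proof (induction \<alpha>s arbitrary: vs)
  case Nil
  then show ?case by (simp add: wedge_covectors_def)
next
  case (Cons \<alpha> \<alpha>s)
  have "wedge_covectors \<alpha>s (delete_nth j vs)
      = dt (length \<alpha>s) (\<lambda>i k. (\<alpha>s ! i) (vs ! skip j k))" if "j < Suc (length \<alpha>s)" for j
    using that Cons.prems by (subst Cons.IH) (auto simp: length_delete_nth nth_delete_nth intro!: dt_cong)
  then show ?case
    using Cons.prems
    by (simp add: wedge_covectors_def wedge1_def dt_laplace_row del: sum.lessThan_Suc)
qed

section \<open>The series as a functional of one polynomial\<close>

definition theta_at :: "nat \<Rightarrow> (rseq \<Rightarrow> rseq) \<Rightarrow> (rseq \<times> rseq) form"
  where "theta_at n D vs = vol_form n D vs -
    (\<Sum>k. let l = Suc k in (-1) ^ l * ((real l - 1) / fact l) * (Psi_op n D ^^ l) (vol_form n D) vs)"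

lemma Theta_eq_theta_at: "Theta n \<Omega> F p = theta_at n (differential n \<Omega> F (fst p))"
  by (simp add: Theta_def theta_at_def[abs_def] Psi_form_def Let_def)

text \<open>The tangent line at t = -1, evaluated at t = 0. It agrees with the value at 0 up to
  degree one, which is why the error begins with quadratic terms.\<close>

definition legendre :: "real poly \<Rightarrow> real"
  where "legendre p = poly p (-1) + poly (pderiv p) (-1)"

lemma legendre_add: "legendre (p + q) = legendre p + legendre q"
  and legendre_smult: "legendre (Polynomial.smult c p) = c * legendre p"
  by (simp_all add: legendre_def pderiv_add pderiv_smult distrib_left)

lemma poly_eq_sum: "degree q \<le> N \<Longrightarrow> poly q x = (\<Sum>l\<le>N. coeff q l * x ^ l)" for x :: real
  unfolding poly_altdef by (rule sum.mono_neutral_left) (auto simp: coeff_eq_0)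

lemma legendre_eq_sum:
  "degree q \<le> N \<Longrightarrow> legendre q = (\<Sum>l\<le>N. (-1) ^ l * (1 - real l) * coeff q l)"
proof (induction q arbitrary: N)
  case 0
  then show ?case by (simp add: legendre_def)
next
  case (pCons a q)
  show ?case
  proof (cases N)
    case 0
    then have "q = 0"
      using pCons.prems by (metis degree_pCons_eq le_0_eq nat.distinct(1))
    then show ?thesis
      using 0 by (simp add: legendre_def pderiv_pCons)
  next
    case (Suc M)
    then have deg: "degree q \<le> M"
      using pCons.prems by (cases "q = 0") auto
    have "(\<Sum>l\<le>N. (-1) ^ l * (1 - real l) * coeff (pCons a q) l)
        = a + (\<Sum>l\<le>M. (-1) ^ l * real l * coeff q l)"
      unfolding Suc sum.atMost_Suc_shift by simp
    also have "(\<Sum>l\<le>M. (-1) ^ l * real l * coeff q l)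
        = (\<Sum>l\<le>M. coeff q l * (-1) ^ l) - (\<Sum>l\<le>M. (-1) ^ l * (1 - real l) * coeff q l)"
      unfolding sum_subtractf[symmetric] by (rule sum.cong) (auto simp: algebra_simps)
    also have "\<dots> = poly q (-1) - legendre q"
      by (simp add: poly_eq_sum[OF deg] pCons.IH[OF deg])
    finally show ?thesis
      by (simp add: legendre_def pderiv_pCons)
  qed
qed

lemma higher_pderiv_at_0: "poly ((pderiv ^^ l) q) 0 = fact l * coeff q l" for q :: "real poly"
  by (simp add: poly_0_coeff_0 coeff_higher_pderiv pochhammer_fact)

text \<open>The derivative of order \<open>l\<close> at 0 is \<open>fact l\<close> times a
  coefficient, and \<open>poly q 0\<close> supplies the summand \<open>l = 0\<close>.\<close>

lemma legendre_series:
  "poly q 0 - (\<Sum>k. let l = Suc k in (-1) ^ l * ((real l - 1) / fact l) * poly ((pderiv ^^ l) q) 0) = legendre q"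
proof -
  have "(\<Sum>k. let l = Suc k in (-1) ^ l * ((real l - 1) / fact l) * poly ((pderiv ^^ l) q) 0)
      = (\<Sum>k. (-1) ^ Suc k * real k * coeff q (Suc k))"
    by (simp add: higher_pderiv_at_0 Let_def mult.assoc del: funpow.simps power_Suc fact_Suc)
  also have "\<dots> = (\<Sum>k\<le>degree q. (-1) ^ Suc k * real k * coeff q (Suc k))"
    by (rule suminf_finite) (auto simp: coeff_eq_0)
  also have "poly q 0 - \<dots> = (\<Sum>l\<le>Suc (degree q). (-1) ^ l * (1 - real l) * coeff q l)"
    unfolding sum.atMost_Suc_shift by (simp add: poly_0_coeff_0 sum_negf)
  also have "\<dots> = legendre q"
    by (rule legendre_eq_sum[symmetric]) simp
  finally show ?thesis .
qed

context singular_basis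
begin

definition frame_poly :: "(rseq \<times> rseq) list \<Rightarrow> real poly"
  where "frame_poly vs = dt n (\<lambda>i j. pencil (tangent_frame D) J_frame (vs ! j) i)"

lemma vol_form_eq: "length vs = n \<Longrightarrow> vol_form n D vs = poly (frame_poly vs) 0"
  by (simp add: vol_form_def wedge_covectors_eq_dt frame_poly_def poly_dt pencil_def flat_def)
    (auto intro: dt_cong)

text \<open>\<open>\<Psi>\<close> differentiates the pencil \<open>e\<^sub>i + t J e\<^sub>i\<close> with respect to \<open>t\<close>.\<close>

lemma pderiv_frame_poly:
  assumes "length vs = n"
  shows "pderiv (frame_poly vs) = (\<Sum>i<n. \<Sum>j<n. Polynomial.smult ((-1) ^ j * inner (J_frame i) (vs ! j))
    (frame_poly (tangent_frame D i # delete_nth j vs)))"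
proof -
  let ?p = "pencil (tangent_frame D) J_frame"
  have move: "frame_poly (x # delete_nth j vs)
      = (-1) ^ j * dt n (\<lambda>i k. if k = j then ?p x i else ?p (vs ! k) i)" if "j < n" for x j
  proof -
    have "frame_poly (x # delete_nth j vs)
        = dt n (\<lambda>i k. case k of 0 \<Rightarrow> ?p x i | Suc k \<Rightarrow> ?p (vs ! skip j k) i)"
      unfolding frame_poly_def using that assms
      by (intro dt_cong) (auto simp: nth_delete_nth split: nat.split)
    also have "\<dots> = (-1) ^ j * dt n (\<lambda>i k. if k = j then ?p x i else ?p (vs ! k) i)"
      by (rule dt_move_col[OF that])
    finally show ?thesis .
  qed
  \<comment> \<open>\<open>J\<close> has normal values and the frame is orthonormal, so the pencil
    of \<open>tangent_frame D i\<close> is the constant 1 in row \<open>i\<close> and 0 elsewhere.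
    One summand survives: the derivative of the entry.\<close>
  have col: "(\<Sum>i<n. [:inner (J_frame i) x:] * ?p (tangent_frame D i) k) = pderiv (?p x k)" if "k < n" for k x
  proof -
    have "(\<Sum>i<n. [:inner (J_frame i) x:] * ?p (tangent_frame D i) k)
        = (\<Sum>i<n. if k = i then [:inner (J_frame k) x:] else 0)"
      using that orthonormal_famD[OF tangent_frame_orthonormal] tangent_frame_J
      by (intro sum.cong) (auto simp: pencil_def inner_commute[of "J_frame _" "tangent_frame D _"])
    then show ?thesis
      using that by (simp add: pencil_def pderiv_pCons)
  qed
  have "pderiv (frame_poly vs)
      = (\<Sum>j<n. dt n (\<lambda>i k. if k = j then (\<Sum>l<n. [:inner (J_frame l) (vs ! j):] * ?p (tangent_frame D l) i) else ?p (vs ! k) i))"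
    unfolding frame_poly_def pderiv_dt_col
    by (intro sum.cong refl dt_cong) (auto simp only: col split: if_split)
  also have "\<dots> = (\<Sum>j<n. \<Sum>i<n. [:inner (J_frame i) (vs ! j):] *
      dt n (\<lambda>l k. if k = j then ?p (tangent_frame D i) l else ?p (vs ! k) l))"
    by (intro sum.cong refl dt_col_sum) auto
  also have "\<dots> = (\<Sum>j<n. \<Sum>i<n. Polynomial.smult ((-1) ^ j * inner (J_frame i) (vs ! j))
      (frame_poly (tangent_frame D i # delete_nth j vs)))"
  proof (intro sum.cong refl)
    fix i j assume "j \<in> {..<n}"
    show "[:inner (J_frame i) (vs ! j):] * dt n (\<lambda>l k. if k = j then ?p (tangent_frame D i) l else ?p (vs ! k) l)
        = Polynomial.smult ((-1) ^ j * inner (J_frame i) (vs ! j)) (frame_poly (tangent_frame D i # delete_nth j vs))"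
      using \<open>j \<in> {..<n}\<close> by (cases "even j") (simp_all add: move)
  qed
  finally show ?thesis
    by (subst sum.swap)
qed

lemma Psi_power_eq:
  "length vs = n \<Longrightarrow> (Psi_op n D ^^ l) (vol_form n D) vs = poly ((pderiv ^^ l) (frame_poly vs)) 0"
proof (induction l arbitrary: vs)
  case 0
  then show ?case by (simp add: vol_form_eq)
next
  case (Suc l)
  have len: "length (tangent_frame D i # delete_nth j vs) = n" if "j < n" for i j
    using Suc.prems that by (simp add: length_delete_nth)
  have "(Psi_op n D ^^ Suc l) (vol_form n D) vs = (\<Sum>i<n. \<Sum>j<n. (-1) ^ j * inner (J_frame i) (vs ! j) *
      poly ((pderiv ^^ l) (frame_poly (tangent_frame D i # delete_nth j vs))) 0)"
    using Suc.prems by (simp add: Psi_op_def wedge1_def flat_def interior_mult_def Suc.IH[OF len])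
  also have "\<dots> = poly ((pderiv ^^ l) (pderiv (frame_poly vs))) 0"
    by (simp add: pderiv_frame_poly[OF Suc.prems] higher_pderiv_sum higher_pderiv_smult poly_sum)
  finally show ?case
    by (simp add: funpow_swap1)
qed

lemma theta_at_eq_legendre: "length vs = n \<Longrightarrow> theta_at n D vs = legendre (frame_poly vs)"
  unfolding theta_at_def by (simp only: Psi_power_eq vol_form_eq legendre_series)

text \<open>For the functional \<open>legendre\<close>, the values on the torus are exactly the
  expressions bounded in \<open>torus_bound\<close>.\<close>

lemma theta_at_le_1:
  assumes r: "2 \<le> r" "r \<le> n" "op_rank n D \<le> r"
    and small: "\<And>j k. 1 \<le> j \<Longrightarrow> j < k \<Longrightarrow> k \<le> r \<Longrightarrow>
      singular_values n D ! (j - 1) * singular_values n D ! (k - 1) \<le> (1/200) / (real r - 1)"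
    and vs: "length vs = n" "orthonormal_list vs"
  shows "theta_at n D vs \<le> 1"
proof -
  have "\<bar>legendre (1 * dt n (\<lambda>i j. pencil e' (\<lambda>i. \<sigma> i *\<^sub>R \<nu> i) (vs ! j) i))\<bar> \<le> 1"
  proof (rule torus_lemma[OF legendre_add legendre_smult split_frame_singular])
    show "orthonormal_fam n ((!) vs)"
      using vs by (simp add: orthonormal_fam_def orthonormal_list_def)
    fix c s :: "nat \<Rightarrow> real"
    assume cs: "\<And>i. i < n \<Longrightarrow> (c i)\<^sup>2 + (s i)\<^sup>2 = 1"
    have "legendre (\<Prod>i<n. [:c i, \<sigma> i * s i:])
        = (\<Prod>i<n. c i - \<sigma> i * s i) + (\<Sum>k<n. \<sigma> k * s k * (\<Prod>i\<in>{..<n} - {k}. c i - \<sigma> i * s i))"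
      (is "_ = ?v")
      by (simp add: legendre_def poly_prod pderiv_prod poly_sum pderiv_pCons mult.commute)
    moreover have "\<bar>?v\<bar> \<le> 1"
    proof (rule torus_bound[OF r(1,2)])
      fix j k assume "j < k" "k < r"
      then show "\<sigma> j * \<sigma> k \<le> (1/200) / (real r - 1)"
        using small[of "Suc j" "Suc k"] r by (simp add: singular_values_eq)
    qed (use cs r \<sigma>_nonneg \<sigma>_antimono \<sigma>_zero_beyond_rank in auto)
    ultimately show "\<bar>legendre (1 * (\<Prod>i<n. [:c i, \<sigma> i * s i:]))\<bar> \<le> 1"
      by simp
  qed
  moreover have "legendre (- p) = - legendre p" for p
    using legendre_smult[of "-1" p] by simp
  ultimately show ?thesis
    using dt_pencil_singular[of "(!) vs"] vs by (auto simp: theta_at_eq_legendre frame_poly_def)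
qed

end

section \<open>Coordinate expression\<close>

definition gram :: "(nat \<Rightarrow> rseq) \<Rightarrow> nat \<Rightarrow> nat \<Rightarrow> real"
  where "gram f i j = (if i = j then 1 else 0) + inner (f i) (f j)"

text \<open>Cramer's rule: as a quotient of determinants the inverse inherits smoothness from the
  entries.\<close>

definition mat_inverse :: "nat \<Rightarrow> (nat \<Rightarrow> nat \<Rightarrow> real) \<Rightarrow> nat \<Rightarrow> nat \<Rightarrow> real"
  where "mat_inverse n M k l = dt n (\<lambda>i j. if i = l then (if k = j then 1 else 0) else M i j) / dt n M"

definition area :: "nat \<Rightarrow> (nat \<Rightarrow> rseq) \<Rightarrow> real"
  where "area n f = sqrt (dt n (gram f))"

text \<open>The partial derivative of \<open>area\<close> with respect to
  \<open>f k\<close>.\<close>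

definition momentum :: "nat \<Rightarrow> (nat \<Rightarrow> rseq) \<Rightarrow> nat \<Rightarrow> rseq"
  where "momentum n f k = area n f *\<^sub>R (\<Sum>l<n. mat_inverse n (gram f) k l *\<^sub>R f l)"

text \<open>\<open>area\<close> minus the sum of the inner products of \<open>f k\<close> with
  \<open>momentum n f k\<close>. As the Gram matrix exceeds the inner products by the identity, that
  sum is \<open>area\<close> times \<open>n\<close> minus the trace of the inverse.\<close>

definition hamiltonian :: "nat \<Rightarrow> (nat \<Rightarrow> rseq) \<Rightarrow> real"
  where "hamiltonian n f = area n f * (1 - real n + (\<Sum>k<n. mat_inverse n (gram f) k k))"

text \<open>The unit row \<open>k\<close> is the combination of the rows of \<open>M\<close> with
  coefficients \<open>g k l\<close>; put into row \<open>l\<close>, it multiplies the determinant by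
  \<open>g k l\<close>.\<close>

lemma mat_inverse_unique:
  assumes inv: "\<And>k j. k < n \<Longrightarrow> j < n \<Longrightarrow> (\<Sum>l<n. g k l * M l j) = (if k = j then 1 else 0)"
    and "dt n M \<noteq> 0" "k < n" "l < n"
  shows "mat_inverse n M k l = g k l"
proof -
  have "dt n (\<lambda>i j. if i = l then (if k = j then 1 else 0) else M i j)
      = dt n (\<lambda>i j. if i = l then (\<Sum>l<n. g k l * M l j) else M i j)"
    using inv assms(3) by (intro dt_cong) auto
  then show ?thesis
    using assms by (simp add: mat_inverse_def dt_row_combination)
qed

context singular_basis
begin

abbreviation G_inv :: "rseq \<Rightarrow> rseq"
  where "G_inv \<equiv> spec_op n u 1 (\<lambda>i. 1 / (\<rho> i * \<rho> i))"

abbreviation G_sqrt :: "rseq \<Rightarrow> rseq"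
  where "G_sqrt \<equiv> spec_op n u 1 \<rho>"

abbreviation \<phi> :: "nat \<Rightarrow> rseq"
  where "\<phi> i \<equiv> D (unit_vec i)"

lemma \<rho>_nonzero: "\<rho> i \<noteq> 0"
  using \<rho>_pos[of i] by simp

lemma spec_op_Rn: "v \<in> Rn n \<Longrightarrow> spec_op n u c f v \<in> Rn n"
  unfolding spec_op_def by (intro subspace_add subspace_sum subspace_scale subspace_Rn) (auto intro: u_Rn)

lemma spec_op_symmetric: "inner (spec_op n u c f v) x = inner (spec_op n u c f x) v"
  by (subst U.spec_op_self_adjoint) (rule inner_commute)

lemma G_op_eq: "G_op D = spec_op n u 1 (\<lambda>i. \<rho> i * \<rho> i)"
  by (rule ext) (simp add: G_op_def adjoint_D_D spec_op_def \<rho>_square)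

lemma inner_G: "inner x (G_op D y) = inner x y + inner (D x) (D y)"
  by (simp add: G_op_def inner_add_right adjoint_D)

lemma gram_eq: "gram \<phi> i j = inner (unit_vec i) (G_op D (unit_vec j))"
  by (simp add: gram_def inner_G inner_unit_vec_unit_vec)

lemma parseval: "x \<in> Rn n \<Longrightarrow> inner x y = (\<Sum>l<n. inner x (unit_vec l) * inner (unit_vec l) y)"
proof -
  assume "x \<in> Rn n"
  then have "inner x y = inner (\<Sum>i<n. inner x (unit_vec i) *\<^sub>R unit_vec i) y"
    by (simp add: Rn_expand)
  then show ?thesis
    by (simp add: inner_sum_left)
qed

lemma G_inv_gram:
  assumes "k < n" "j < n"
  shows "(\<Sum>l<n. inner (G_inv (unit_vec k)) (unit_vec l) * gram \<phi> l j) = (if k = j then 1 else 0)"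
proof -
  have "(\<Sum>l<n. inner (G_inv (unit_vec k)) (unit_vec l) * gram \<phi> l j) = inner (G_inv (unit_vec k)) (G_op D (unit_vec j))"
    unfolding gram_eq by (rule parseval[symmetric]) (simp add: spec_op_Rn unit_vec_in_Rn assms)
  also have "\<dots> = inner (unit_vec k) (unit_vec j)"
    unfolding U.spec_op_self_adjoint G_op_eq U.spec_op_comp
    by (simp add: \<rho>_nonzero) (simp add: spec_op_def)
  finally show ?thesis
    by (simp add: inner_unit_vec_unit_vec)
qed

text \<open>The matrix of G^(1/2) in the standard basis. Its determinant is the area integrand and
  the common factor of the form.\<close>

definition R :: "nat \<Rightarrow> nat \<Rightarrow> real"
  where "R i k = inner (G_sqrt (unit_vec i)) (unit_vec k)"

text \<open>Singular vectors diagonalise the matrix with entries \<open>\<rho> l\<close>. The sign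
  matters: it selects the positive root of the Gram determinant.\<close>

lemma dt_R_pos: "dt n R > 0"
proof -
  let ?Q = "\<lambda>i k. inner (unit_vec i) (u k)"
  have "dt n R = dt n (\<lambda>i k. \<Sum>l<n. ?Q i l * (\<rho> l * ?Q k l))"
  proof (rule dt_cong)
    fix i k assume ik: "i < n" "k < n"
    have "R i k = (\<Sum>l<n. inner (G_sqrt (unit_vec i)) (u l) * inner (unit_vec k) (u l))"
      unfolding R_def by (rule inner_expand) (simp add: spec_op_Rn unit_vec_in_Rn ik)
    also have "\<dots> = (\<Sum>l<n. ?Q i l * (\<rho> l * ?Q k l))"
      unfolding U.spec_op_self_adjoint by (intro sum.cong) (auto simp: U.spec_op_unit)
    finally show "R i k = (\<Sum>l<n. ?Q i l * (\<rho> l * ?Q k l))" .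
  qed
  also have "\<dots> = dt n ?Q * dt n (\<lambda>l k. \<rho> l * ?Q k l)"
    by (rule dt_mult)
  also have "\<dots> = (\<Prod>l<n. \<rho> l) * (dt n ?Q * dt n ?Q)"
    by (simp only: dt_scale_rows dt_transpose[of n ?Q] mult_ac)
  also have "dt n ?Q * dt n ?Q = 1"
    by (rule dt_orthogonal_square) (rule change_of_basis)
  finally show ?thesis
    using \<rho>_pos by (simp add: prod_pos)
qed

lemma dt_gram: "dt n (gram \<phi>) = dt n R * dt n R"
proof -
  have "dt n (gram \<phi>) = dt n (\<lambda>i j. \<Sum>k<n. R i k * R j k)"
  proof (rule dt_cong)
    fix i j assume ij: "i < n" "j < n"
    have "gram \<phi> i j = inner (G_sqrt (unit_vec i)) (G_sqrt (unit_vec j))"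
      unfolding gram_eq G_op_eq U.spec_op_self_adjoint U.spec_op_comp by simp
    also have "\<dots> = (\<Sum>k<n. R i k * R j k)"
      by (subst parseval) (simp_all add: spec_op_Rn unit_vec_in_Rn ij R_def inner_commute)
    finally show "gram \<phi> i j = (\<Sum>k<n. R i k * R j k)" .
  qed
  also have "\<dots> = dt n R * dt n R"
    by (simp only: dt_mult[of n R "\<lambda>k j. R j k"] dt_transpose[of n R])
  finally show ?thesis .
qed

lemma dt_gram_pos: "dt n (gram \<phi>) > 0"
  using dt_R_pos by (simp add: dt_gram)

lemma area_eq: "area n \<phi> = dt n R"
  using dt_R_pos by (simp add: area_def dt_gram)

lemma mat_inverse_gram:
  "k < n \<Longrightarrow> l < n \<Longrightarrow> mat_inverse n (gram \<phi>) k l = inner (G_inv (unit_vec k)) (unit_vec l)"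
  using dt_gram_pos by (intro mat_inverse_unique) (auto simp: G_inv_gram)

lemma mat_inverse_gram_left:
  "k < n \<Longrightarrow> j < n \<Longrightarrow> (\<Sum>l<n. mat_inverse n (gram \<phi>) k l * gram \<phi> l j) = (if k = j then 1 else 0)"
  using G_inv_gram[of k j] by (simp add: mat_inverse_gram)

lemma mat_inverse_gram_symmetric:
  "k < n \<Longrightarrow> l < n \<Longrightarrow> mat_inverse n (gram \<phi>) k l = mat_inverse n (gram \<phi>) l k"
  by (simp add: mat_inverse_gram) (rule spec_op_symmetric)

text \<open>The first components of the frame are the columns of G^(-1/2). This converts a trace
  over the frame into a trace against the inverse metric.\<close>

lemma tangent_frame_fst_sum:
  assumes "k < n" "l < n"
  shows "(\<Sum>i<n. inner (fst (tangent_frame D i)) (unit_vec k) * inner (fst (tangent_frame D i)) (unit_vec l))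
    = mat_inverse n (gram \<phi>) k l"
proof -
  have "(\<Sum>i<n. inner (fst (tangent_frame D i)) (unit_vec k) * inner (fst (tangent_frame D i)) (unit_vec l))
      = (\<Sum>i<n. inner (G_inv_sqrt (unit_vec k)) (unit_vec i) * inner (unit_vec i) (G_inv_sqrt (unit_vec l)))"
    unfolding tangent_frame_def tangent_iso_eq fst_conv
    by (simp add: spec_op_symmetric[of 1 _ "unit_vec _" "unit_vec k"]
        spec_op_symmetric[of 1 _ "unit_vec _" "unit_vec l"] inner_commute[of "unit_vec _" "spec_op _ _ _ _ _"])
  also have "\<dots> = inner (G_inv_sqrt (unit_vec k)) (G_inv_sqrt (unit_vec l))"
    by (rule parseval[symmetric]) (simp add: spec_op_Rn unit_vec_in_Rn assms)
  also have "\<dots> = inner (G_inv (unit_vec k)) (unit_vec l)"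
    unfolding U.spec_op_self_adjoint U.spec_op_comp by simp
  finally show ?thesis
    using assms by (simp add: mat_inverse_gram)
qed

text \<open>\<open>K v\<close> is minus the normal component of the horizontal vector
  \<open>(v, 0)\<close>, and \<open>(v, 0) + K v\<close> is its tangential component.\<close>

definition K :: "rseq \<Rightarrow> rseq \<times> rseq"
  where "K v = (G_inv v - v, D (G_inv v))"

lemma linear_K: "linear K"
  unfolding K_def
  by (auto simp: linear_iff linear_add[OF U.linear_spec_op] linear_scale[OF U.linear_spec_op]
      linear_add[OF lin] linear_scale[OF lin] scaleR_diff_right)

lemma K_u: "i < n \<Longrightarrow> K (\<rho> i *\<^sub>R u i) = (1 / \<rho> i) *\<^sub>R (- (\<sigma> i)\<^sup>2 *\<^sub>R u i, D (u i))"
proof -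
  assume i: "i < n"
  have "\<rho> i * (1 / (\<rho> i * \<rho> i) - 1) = 1 / \<rho> i * (1 - \<rho> i * \<rho> i)"
    using \<rho>_nonzero[of i] by (simp add: field_simps)
  then have *: "\<rho> i * (1 / (\<rho> i * \<rho> i)) - \<rho> i = 1 / \<rho> i * - (\<sigma> i)\<^sup>2"
    by (simp add: \<rho>_square algebra_simps)
  have "K (u i) = ((1 / (\<rho> i * \<rho> i) - 1) *\<^sub>R u i, (1 / (\<rho> i * \<rho> i)) *\<^sub>R D (u i))"
    by (simp add: K_def U.spec_op_unit i linear_scale[OF lin] scaleR_diff_left)
  then show ?thesis
    using * \<rho>_nonzero[of i] by (simp add: linear_scale[OF linear_K] right_diff_distrib)
qed

text \<open>Both sides are linear in \<open>v\<close>, so they are compared at the singular vectors,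
  where \<open>\<rho>\<^sup>2 = 1 + \<sigma>\<^sup>2\<close> decides.\<close>

lemma
  assumes "v \<in> Rn n"
  shows normal_iso_K: "normal_iso D (D v) = K (G_sqrt v)"
    and tangent_iso_K: "tangent_iso D v = (G_sqrt v, 0) + K (G_sqrt v)"
proof -
  have n: "normal_iso D (D (u i)) = K (G_sqrt (u i))" if "i < n" for i
    using that by (simp add: normal_iso_Du U.spec_op_unit K_u)
      (simp add: \<nu>_def D_w power2_eq_square zero_prod_def)
  have t: "tangent_iso D (u i) = (G_sqrt (u i), 0) + K (G_sqrt (u i))" if "i < n" for i
  proof -
    have "\<rho> i = 1 / \<rho> i * (1 + (\<sigma> i)\<^sup>2)"
      unfolding \<rho>_square[symmetric] using \<rho>_nonzero[of i] by simp
    then have "\<rho> i - (\<sigma> i)\<^sup>2 / \<rho> i = 1 / \<rho> i"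
      by (simp add: add_divide_distrib)
    then have "\<rho> i *\<^sub>R u i - ((\<sigma> i)\<^sup>2 / \<rho> i) *\<^sub>R u i = (1 / \<rho> i) *\<^sub>R u i"
      by (simp only: flip: scaleR_diff_left)
    then show ?thesis
      using that by (simp add: tangent_iso_u e'_def U.spec_op_unit K_u)
  qed
  have linK: "linear (\<lambda>v. K (G_sqrt v))"
    using linear_compose[OF U.linear_spec_op linear_K] by (simp add: comp_def)
  then have lin2: "linear (\<lambda>v. (G_sqrt v, 0) + K (G_sqrt v))"
    by (auto simp: linear_iff linear_add[OF U.linear_spec_op] linear_scale[OF U.linear_spec_op] scaleR_add_right)
  show "normal_iso D (D v) = K (G_sqrt v)"
    using n linear_sum[OF linear_normal_D, of "\<lambda>i. inner v (u i) *\<^sub>R u i" "{..<n}"]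
      linear_sum[OF linK, of "\<lambda>i. inner v (u i) *\<^sub>R u i" "{..<n}"]
    by (simp add: expand[OF assms] linear_scale[OF linear_normal_D] linear_scale[OF linK])
  show "tangent_iso D v = (G_sqrt v, 0) + K (G_sqrt v)"
    using t linear_sum[OF linear_tangent_iso, of "\<lambda>i. inner v (u i) *\<^sub>R u i" "{..<n}"]
      linear_sum[OF lin2, of "\<lambda>i. inner v (u i) *\<^sub>R u i" "{..<n}"]
    by (simp add: expand[OF assms] linear_scale[OF linear_tangent_iso] linear_scale[OF lin2])
qed

lemma G_sqrt_expand: "i < n \<Longrightarrow> G_sqrt (unit_vec i) = (\<Sum>k<n. R i k *\<^sub>R unit_vec k)"
  unfolding R_def by (rule Rn_expand[symmetric]) (simp add: spec_op_Rn unit_vec_in_Rn)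

lemma frame_poly_factor:
  "frame_poly vs = [:dt n R:] *
    dt n (\<lambda>k j. [:inner (unit_vec k) (fst (vs ! j)) + inner (K (unit_vec k)) (vs ! j), inner (K (unit_vec k)) (vs ! j):])"
    (is "_ = _ * dt n ?N")
proof -
  have "frame_poly vs = dt n (\<lambda>i j. \<Sum>k<n. [:R i k:] * ?N k j)"
    unfolding frame_poly_def
  proof (rule dt_cong)
    fix i j assume i: "i < n"
    let ?x = "vs ! j"
    have K: "inner (K (G_sqrt (unit_vec i))) ?x = (\<Sum>k<n. R i k * inner (K (unit_vec k)) ?x)"
      using i by (simp add: G_sqrt_expand linear_sum[OF linear_K] linear_scale[OF linear_K] inner_sum_left)
    have S: "inner (G_sqrt (unit_vec i), 0) ?x = (\<Sum>k<n. R i k * inner (unit_vec k) (fst ?x))"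
      using i by (simp add: G_sqrt_expand inner_sum_left inner_prod_def)
    have "pencil (tangent_frame D) J_frame ?x i
        = [:inner (G_sqrt (unit_vec i), 0) ?x + inner (K (G_sqrt (unit_vec i))) ?x, inner (K (G_sqrt (unit_vec i))) ?x:]"
      using i unit_vec_in_Rn[OF i]
      by (simp add: pencil_def J_tangent_frame normal_iso_K)
        (simp add: tangent_frame_def tangent_iso_K inner_add_left)
    then show "pencil (tangent_frame D) J_frame ?x i = (\<Sum>k<n. [:R i k:] * ?N k j)"
      by (simp add: K S sum_pCons algebra_simps sum.distrib)
  qed
  also have "\<dots> = dt n (\<lambda>i j. [:R i j:]) * dt n ?N"
    by (rule dt_mult)
  also have "dt n (\<lambda>i j. [:R i j:]) = [:dt n R:]"
    by (rule poly_eq_poly_eq_iff[THEN iffD1]) (simp add: fun_eq_iff poly_dt)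
  finally show ?thesis .
qed

text \<open>Without the factor \<open>R\<close>, row \<open>k\<close> of the pencil is
  \<open>dx\<^sub>k\<close> plus (1 + t) times the covector of \<open>K (unit_vec k)\<close>. At t =
  -1 only \<open>dx\<^sub>k\<close> remains, and the derivative replaces a single row; hence at most
  one factor \<open>dy\<close> occurs.\<close>

lemma legendre_frame_poly:
  "legendre (frame_poly vs) = dt n R * (dt n (\<lambda>i j. coord (fst (vs ! j)) i) +
    (\<Sum>k<n. dt n (\<lambda>i j. if i = k then inner (K (unit_vec k)) (vs ! j) else coord (fst (vs ! j)) i)))"
proof -
  have scale: "legendre ([:c:] * p) = c * legendre p" for c p
    using legendre_smult[of c p] by simp
  have poly_if: "poly (if i = k then p else q) x = (if i = k then poly p x else poly q x)"
    for i k :: nat and p q and x :: real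
    by simp
  show ?thesis
    unfolding frame_poly_factor scale
    by (simp add: legendre_def poly_dt pderiv_dt_row poly_sum pderiv_pCons poly_if
        inner_commute[of "unit_vec _" "fst _"] inner_unit_vec cong: if_cong)
qed

lemma inner_K:
  assumes "k < n" "x \<in> Rn n \<times> Rn m"
  shows "inner (K (unit_vec k)) x = (\<Sum>l<n. (mat_inverse n (gram \<phi>) k l - (if l = k then 1 else 0)) * coord (fst x) l)
    + (\<Sum>a<m. (\<Sum>l<n. mat_inverse n (gram \<phi>) k l * inner (\<phi> l) (unit_vec a)) * coord (snd x) a)"
proof -
  have G: "G_inv (unit_vec k) = (\<Sum>l<n. mat_inverse n (gram \<phi>) k l *\<^sub>R unit_vec l)"
    using assms(1) by (simp add: mat_inverse_gram Rn_expand spec_op_Rn unit_vec_in_Rn)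
  have snd: "inner y (snd x) = (\<Sum>a<m. inner y (unit_vec a) * coord (snd x) a)" for y
    using assms(2) inner_Rn[of "snd x" m y] by (auto simp: inner_unit_vec inner_commute[of y] mult.commute)
  have "inner (unit_vec k) (fst x) = (\<Sum>l<n. (if l = k then 1 else 0) * coord (fst x) l)"
    unfolding inner_commute[of "unit_vec k"] inner_unit_vec
    using assms(1) by (simp add: if_distrib[of "\<lambda>c. c * _"] cong: if_cong)
  then have "inner (G_inv (unit_vec k) - unit_vec k) (fst x)
      = (\<Sum>l<n. (mat_inverse n (gram \<phi>) k l - (if l = k then 1 else 0)) * coord (fst x) l)"
    unfolding G inner_diff_left inner_sum_left left_diff_distrib sum_subtractf
    by (simp add: inner_commute[of "unit_vec _" "fst x"] inner_unit_vec)
  moreover have "inner (D (G_inv (unit_vec k))) (snd x)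
      = (\<Sum>a<m. (\<Sum>l<n. mat_inverse n (gram \<phi>) k l * inner (\<phi> l) (unit_vec a)) * coord (snd x) a)"
    unfolding snd G by (simp add: linear_sum[OF lin] linear_scale[OF lin] inner_sum_left)
  ultimately show ?thesis
    by (simp add: K_def inner_prod_def)
qed

text \<open>In the replaced row \<open>k\<close> the horizontal part keeps only its diagonal
  coefficient, as the others repeat a row. The diagonal terms join the leading 1 to form
  \<open>hamiltonian\<close>; the vertical part is the momentum.\<close>

theorem theta_at_formula:
  assumes vs: "length vs = n" "set vs \<subseteq> Rn n \<times> Rn m"
  shows "theta_at n D vs = hamiltonian n \<phi> * dt n (\<lambda>i j. coord (fst (vs ! j)) i)
    + (\<Sum>k<n. \<Sum>a<m. inner (momentum n \<phi> k) (unit_vec a) *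
        dt n (\<lambda>i j. if i = k then coord (snd (vs ! j)) a else coord (fst (vs ! j)) i))"
proof -
  let ?g = "mat_inverse n (gram \<phi>)"
  let ?b = "\<lambda>k a. \<Sum>l<n. mat_inverse n (gram \<phi>) k l * inner (\<phi> l) (unit_vec a)"
  let ?X = "\<lambda>i j. coord (fst (vs ! j)) i" and ?Y = "\<lambda>a j. coord (snd (vs ! j)) a"
  let ?h = "\<lambda>k j. \<Sum>l<n. (?g k l - (if l = k then 1 else 0)) * ?X l j"
  let ?v = "\<lambda>k j. \<Sum>a<m. ?b k a * ?Y a j"
  have row: "dt n (\<lambda>i j. if i = k then inner (K (unit_vec k)) (vs ! j) else ?X i j)
      = (?g k k - 1) * dt n ?X
        + (\<Sum>a<m. ?b k a * dt n (\<lambda>i j. if i = k then ?Y a j else ?X i j))"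
    if k: "k < n" for k
  proof -
    have "dt n (\<lambda>i j. if i = k then inner (K (unit_vec k)) (vs ! j) else ?X i j)
        = dt n (\<lambda>i j. if i = k then ?h k j + 1 * ?v k j else ?X i j)"
    proof (rule dt_cong)
      fix i j assume "j < n"
      then have "vs ! j \<in> Rn n \<times> Rn m"
        using vs by (metis nth_mem subsetD)
      then show "(if i = k then inner (K (unit_vec k)) (vs ! j) else ?X i j)
        = (if i = k then ?h k j + 1 * ?v k j else ?X i j)"
        by (simp only: inner_K[OF k] mult_1)
    qed
    also have "\<dots> = dt n (\<lambda>i j. if i = k then ?h k j else ?X i j)
        + 1 * dt n (\<lambda>i j. if i = k then ?v k j else ?X i j)"
      by (rule dt_row_add[OF k])
    finally show ?thesis
      by (simp only: dt_row_combination[OF k] dt_row_sum[OF k] mult_1) simp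
  qed
  have mom: "inner (momentum n \<phi> k) (unit_vec a) = area n \<phi> * ?b k a" for k a
    by (simp add: momentum_def inner_sum_left)
  have "theta_at n D vs = area n \<phi> * (dt n ?X + (\<Sum>k<n. (?g k k - 1) * dt n ?X
        + (\<Sum>a<m. ?b k a * dt n (\<lambda>i j. if i = k then ?Y a j else ?X i j))))"
    using vs by (simp add: theta_at_eq_legendre legendre_frame_poly area_eq row)
  also have "\<dots> = area n \<phi> * (1 - real n + (\<Sum>k<n. ?g k k)) * dt n ?X
      + (\<Sum>k<n. \<Sum>a<m. (area n \<phi> * ?b k a) *
          dt n (\<lambda>i j. if i = k then ?Y a j else ?X i j))"
    by (simp add: sum.distrib sum_subtractf left_diff_distrib sum_distrib_left[symmetric] sum_distrib_right[symmetric]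
        mult.assoc algebra_simps)
  finally show ?thesis
    by (simp only: hamiltonian_def mom)
qed

end

section \<open>Differentiation along a subspace\<close>

locale rel_open =
  fixes W U :: "'a::real_normed_vector set"
  assumes subspace: "subspace W" and openin: "openin (top_of_set W) U"
begin

lemma U_subset: "x \<in> U \<Longrightarrow> x \<in> W"
  using openin openin_imp_subset by blast

abbreviation deriv_along :: "('a \<Rightarrow> 'b::real_normed_vector) \<Rightarrow> 'a \<Rightarrow> 'a \<Rightarrow> 'b"
  where "deriv_along f v x \<equiv> frechet_derivative f (at x within U) v"

lemma open_line:
  assumes "y \<in> W" "v \<in> W"
  shows "open {t::real. y + t *\<^sub>R v \<in> U}"
proof -
  obtain T where T: "open T" "U = W \<inter> T"
    using openin by (auto simp: openin_open)
  have "{t. y + t *\<^sub>R v \<in> U} = (\<lambda>t. y + t *\<^sub>R v) -` T"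
    using T assms subspace by (auto intro: subspace_add subspace_scale)
  moreover have "open ((\<lambda>t::real. y + t *\<^sub>R v) -` T)"
    by (intro open_vimage T continuous_intros)
  ultimately show ?thesis by simp
qed

lemma has_derivative_line:
  assumes "(f has_derivative f') (at (y + s *\<^sub>R v) within U)" "y + s *\<^sub>R v \<in> U" "v \<in> W"
  shows "((\<lambda>t. f (y + t *\<^sub>R v)) has_derivative (\<lambda>t. f' (t *\<^sub>R v))) (at s)"
proof -
  let ?T = "{t. y + t *\<^sub>R v \<in> U}"
  have "y \<in> W"
    using subspace_diff[OF subspace U_subset[OF assms(2)] subspace_scale[OF subspace assms(3), of s]] by simp
  then have T: "open ?T"
    using assms(3) by (rule open_line)
  have "((\<lambda>t. y + t *\<^sub>R v) has_derivative (\<lambda>t. t *\<^sub>R v)) (at s within ?T)"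
    by (auto intro!: derivative_eq_intros)
  moreover have "(f has_derivative f') (at (y + s *\<^sub>R v) within (\<lambda>t. y + t *\<^sub>R v) ` ?T)"
    by (rule has_derivative_subset[OF assms(1)]) auto
  ultimately have "((\<lambda>t. f (y + t *\<^sub>R v)) has_derivative (\<lambda>t. f' (t *\<^sub>R v))) (at s within ?T)"
    by (rule has_derivative_in_compose)
  moreover have "at s within ?T = at s"
    by (rule at_within_open) (use T assms(2) in auto)
  ultimately show ?thesis
    by (simp only:)
qed

text \<open>A derivative within \<open>U\<close> is not unique off \<open>W\<close>, but along a
  line in \<open>W\<close> it is an ordinary derivative at an interior point.\<close>

lemma deriv_along_eq:
  assumes f: "(f has_derivative f') (at x within U)" and x: "x \<in> U" and v: "v \<in> W"
  shows "deriv_along f v x = f' v"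
proof -
  have "(f has_derivative frechet_derivative f (at x within U)) (at x within U)"
    using f differentiable_def frechet_derivative_works by blast
  from has_derivative_line[of f _ x 0 v] this f x v
  have "((\<lambda>t. f (x + t *\<^sub>R v)) has_derivative (\<lambda>t. deriv_along f (t *\<^sub>R v) x)) (at 0)"
      "((\<lambda>t. f (x + t *\<^sub>R v)) has_derivative (\<lambda>t. f' (t *\<^sub>R v))) (at 0)"
    by simp_all
  then have "(\<lambda>t. deriv_along f (t *\<^sub>R v) x) = (\<lambda>t. f' (t *\<^sub>R v))"
    by (rule has_derivative_unique)
  then show ?thesis
    by (metis scaleR_one)
qed

lemma frechet_works:
  "f differentiable (at x within U) \<Longrightarrow> (f has_derivative (\<lambda>v. deriv_along f v x)) (at x within U)"
  by (simp add: frechet_derivative_works)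

lemma deriv_along_cong:
  assumes "\<And>y. y \<in> U \<Longrightarrow> f y = g y" "x \<in> U"
  shows "deriv_along f v x = deriv_along g v x"
proof -
  have "(f has_derivative D) (at x within U) \<longleftrightarrow> (g has_derivative D) (at x within U)" for D
    using has_derivative_transform[OF assms(2), of g f] has_derivative_transform[OF assms(2), of f g] assms(1)
    by metis
  then show ?thesis
    by (simp add: frechet_derivative_def)
qed

text \<open>Any explicit derivative may stand in for the chosen \<open>frechet_derivative\<close>,
  because only values on \<open>W\<close> enter.\<close>

lemma Ck_on_SucI:
  assumes "\<And>x. x \<in> U \<Longrightarrow> (f has_derivative f' x) (at x within U)"
    and "\<And>v. v \<in> W \<Longrightarrow> Ck_on k W U (\<lambda>x. f' x v)"
    and cong: "\<And>f g :: 'a \<Rightarrow> 'b::real_normed_vector. (\<And>x. x \<in> U \<Longrightarrow> f x = g x) \<Longrightarrow> Ck_on k W U f \<Longrightarrow> Ck_on k W U g"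
  shows "Ck_on (Suc k) W U (f :: 'a \<Rightarrow> 'b)"
  unfolding Ck_on.simps
proof (intro conjI ballI)
  show "f differentiable (at x within U)" if "x \<in> U" for x
    using assms(1)[OF that] by (auto simp: differentiable_def)
  show "Ck_on k W U (\<lambda>x. deriv_along f v x)" if "v \<in> W" for v
    by (rule cong[OF _ assms(2)[OF that]]) (simp add: deriv_along_eq[OF assms(1)] that)
qed

lemma Ck_on_cong:
  fixes f g :: "'a \<Rightarrow> 'b::real_normed_vector"
  shows "(\<And>x. x \<in> U \<Longrightarrow> f x = g x) \<Longrightarrow> Ck_on k W U f \<Longrightarrow> Ck_on k W U g"
proof (induction k arbitrary: f g)
  case 0
  then show ?case by (simp cong: continuous_on_cong)
next
  case (Suc k)
  have "g differentiable (at x within U)" if x: "x \<in> U" for x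
  proof -
    have "f differentiable (at x within U)"
      using Suc.prems(2) x by simp
    then show ?thesis
      using Suc.prems(1) has_derivative_transform[OF x, of g f] unfolding differentiable_def by metis
  qed
  moreover have "Ck_on k W U (\<lambda>x. deriv_along g v x)" if "v \<in> W" for v
    by (rule Suc.IH[of "\<lambda>x. deriv_along f v x"]) (use Suc.prems that in \<open>auto intro: deriv_along_cong\<close>)
  ultimately show ?case by simp
qed

lemmas Ck_on_Suc_intro = Ck_on_SucI[OF _ _ Ck_on_cong]

lemma Ck_on_SucD: "Ck_on (Suc k) W U f \<Longrightarrow> Ck_on k W U f"
proof (induction k arbitrary: f)
  case 0
  then have "f differentiable_on U"
    by (auto simp: differentiable_on_def)
  then show ?case
    by (simp add: differentiable_imp_continuous_on)
qed auto

lemma Ck_on_differentiable: "Ck_on (Suc k) W U f \<Longrightarrow> x \<in> U \<Longrightarrow> f differentiable (at x within U)"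
  by simp

lemma Ck_on_has_derivative:
  "Ck_on (Suc k) W U f \<Longrightarrow> x \<in> U \<Longrightarrow> (f has_derivative (\<lambda>v. deriv_along f v x)) (at x within U)"
  by (simp add: frechet_works)

lemma Ck_on_deriv_along: "Ck_on (Suc k) W U f \<Longrightarrow> v \<in> W \<Longrightarrow> Ck_on k W U (\<lambda>x. deriv_along f v x)"
  by simp

section \<open>Closure properties of \<open>Ck_on\<close>\<close>

lemma Ck_on_const: "Ck_on k W U (\<lambda>_. c)"
proof (induction k arbitrary: c)
  case (Suc k)
  show ?case
    by (rule Ck_on_Suc_intro[where f' = "\<lambda>_ _. 0"]) (auto intro: Suc derivative_intros)
qed simp

lemma Ck_on_bounded_linear:
  assumes L: "bounded_linear L"
  shows "Ck_on k W U f \<Longrightarrow> Ck_on k W U (\<lambda>x. L (f x))"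
proof (induction k arbitrary: f)
  case 0
  then show ?case
    by (auto intro: bounded_linear.continuous_on[OF L])
next
  case (Suc k)
  show ?case
    by (rule Ck_on_Suc_intro[where f' = "\<lambda>x v. L (deriv_along f v x)"])
      (use Suc in \<open>auto intro!: bounded_linear.has_derivative[OF L] frechet_works\<close>)
qed

lemma Ck_on_add: "Ck_on k W U f \<Longrightarrow> Ck_on k W U g \<Longrightarrow> Ck_on k W U (\<lambda>x. f x + g x)"
proof (induction k arbitrary: f g)
  case 0
  then show ?case by (auto intro: continuous_on_add)
next
  case (Suc k)
  show ?case
    by (rule Ck_on_Suc_intro[where f' = "\<lambda>x v. deriv_along f v x + deriv_along g v x"])
      (use Suc in \<open>auto intro!: has_derivative_add frechet_works\<close>)
qed

lemma Ck_on_sum: "(\<And>i. i \<in> A \<Longrightarrow> Ck_on k W U (f i)) \<Longrightarrow> Ck_on k W U (\<lambda>x. \<Sum>i\<in>A. f i x)"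
  by (induction A rule: infinite_finite_induct) (auto intro: Ck_on_const Ck_on_add)

lemma Ck_on_bilinear:
  assumes P: "bounded_bilinear P"
  shows "Ck_on k W U f \<Longrightarrow> Ck_on k W U g \<Longrightarrow> Ck_on k W U (\<lambda>x. P (f x) (g x))"
proof (induction k arbitrary: f g)
  case 0
  then show ?case
    by (auto intro: bounded_bilinear.continuous_on[OF P])
next
  case (Suc k)
  show ?case
  proof (rule Ck_on_Suc_intro[where f' = "\<lambda>x v. P (f x) (deriv_along g v x) + P (deriv_along f v x) (g x)"])
    show "((\<lambda>x. P (f x) (g x)) has_derivative (\<lambda>v. P (f x) (deriv_along g v x) + P (deriv_along f v x) (g x))) (at x within U)"
      if "x \<in> U" for x
      using Suc.prems that by (intro bounded_bilinear.FDERIV[OF P] frechet_works) auto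
    show "Ck_on k W U (\<lambda>x. P (f x) (deriv_along g v x) + P (deriv_along f v x) (g x))" if "v \<in> W" for v
      using Suc.prems that Ck_on_SucD[OF Suc.prems(1)] Ck_on_SucD[OF Suc.prems(2)]
      by (intro Ck_on_add Suc.IH) auto
  qed
qed

lemmas Ck_on_mult = Ck_on_bilinear[OF bounded_bilinear_mult]
lemmas Ck_on_scaleR = Ck_on_bilinear[OF bounded_bilinear_scaleR]
lemmas Ck_on_inner = Ck_on_bilinear[OF bounded_bilinear_inner]

lemma Ck_on_prod: "(\<And>i. i \<in> A \<Longrightarrow> Ck_on k W U (f i)) \<Longrightarrow> Ck_on k W U (\<lambda>x. \<Prod>i\<in>A. f i x :: real)"
  by (induction A rule: infinite_finite_induct) (auto intro: Ck_on_const Ck_on_mult)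

lemma Ck_on_dt:
  assumes "\<And>i j. i < n \<Longrightarrow> j < n \<Longrightarrow> Ck_on k W U (\<lambda>x. M x i j)"
  shows "Ck_on k W U (\<lambda>x. dt n (M x) :: real)"
  unfolding dt_leibniz using assms
  by (intro Ck_on_sum Ck_on_mult Ck_on_const Ck_on_prod) (auto dest: permutes_in_image)

lemma Ck_on_inverse:
  fixes f :: "'a \<Rightarrow> real"
  assumes "\<And>x. x \<in> U \<Longrightarrow> f x \<noteq> 0"
  shows "Ck_on k W U f \<Longrightarrow> Ck_on k W U (\<lambda>x. inverse (f x))"
proof (induction k)
  case 0
  then show ?case using assms by (auto intro: continuous_on_inverse)
next
  case (Suc k)
  show ?case
  proof (rule Ck_on_Suc_intro[where f' = "\<lambda>x v. (- 1) * (inverse (f x) * deriv_along f v x * inverse (f x))"])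
    show "((\<lambda>x. inverse (f x)) has_derivative (\<lambda>v. (- 1) * (inverse (f x) * deriv_along f v x * inverse (f x)))) (at x within U)"
      if "x \<in> U" for x
      using Suc.prems that assms by (auto intro!: derivative_eq_intros frechet_works)
    show "Ck_on k W U (\<lambda>x. (- 1) * (inverse (f x) * deriv_along f v x * inverse (f x)))" if "v \<in> W" for v
      using that Suc.IH[OF Ck_on_SucD[OF Suc.prems]] Suc.prems by (intro Ck_on_mult Ck_on_const) auto
  qed
qed

lemma Ck_on_sqrt:
  fixes f :: "'a \<Rightarrow> real"
  assumes pos: "\<And>x. x \<in> U \<Longrightarrow> f x > 0"
  shows "Ck_on k W U f \<Longrightarrow> Ck_on k W U (\<lambda>x. sqrt (f x))"
proof (induction k)
  case 0
  then show ?case by (auto intro: continuous_on_real_sqrt)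
next
  case (Suc k)
  show ?case
  proof (rule Ck_on_Suc_intro[where f' = "\<lambda>x v. deriv_along f v x * (inverse (sqrt (f x)) * (1/2))"])
    show "((\<lambda>x. sqrt (f x)) has_derivative (\<lambda>v. deriv_along f v x * (inverse (sqrt (f x)) * (1/2)))) (at x within U)"
      if "x \<in> U" for x
      using Suc.prems that pos by (auto intro!: derivative_eq_intros frechet_works simp: field_simps)
    have "Ck_on k W U (\<lambda>x. inverse (sqrt (f x)))"
      using pos Suc.IH[OF Ck_on_SucD[OF Suc.prems]] by (intro Ck_on_inverse) (auto simp: less_imp_neq[symmetric])
    then show "Ck_on k W U (\<lambda>x. deriv_along f v x * (inverse (sqrt (f x)) * (1/2)))" if "v \<in> W" for v
      using that Suc.prems by (intro Ck_on_mult Ck_on_const) auto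
  qed
qed

lemma deriv_along_linear:
  assumes "f differentiable (at x within U)"
  shows "linear (\<lambda>v. deriv_along f v x)"
  using linear_frechet_derivative[OF assms] by simp

lemma real_derivative_line:
  fixes f :: "'a \<Rightarrow> real"
  assumes f: "f differentiable (at (y + s *\<^sub>R v) within U)" and "y + s *\<^sub>R v \<in> U" "v \<in> W"
  shows "((\<lambda>s. f (y + s *\<^sub>R v)) has_real_derivative deriv_along f v (y + s *\<^sub>R v)) (at s)"
  using has_derivative_line[OF frechet_works[OF f] assms(2,3)] linear_scale[OF deriv_along_linear[OF f]]
  by (simp add: has_field_derivative_def mult_commute_abs)

section \<open>Symmetry of second derivatives\<close>

lemma mvt_line:
  fixes f :: "'a \<Rightarrow> real"
  assumes f: "\<And>y. y \<in> U \<Longrightarrow> f differentiable (at y within U)"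
    and t: "t > 0" and seg: "\<And>s. 0 \<le> s \<Longrightarrow> s \<le> t \<Longrightarrow> y + s *\<^sub>R v \<in> U" and v: "v \<in> W"
  obtains s where "0 < s" "s < t" "f (y + t *\<^sub>R v) - f y = t * deriv_along f v (y + s *\<^sub>R v)"
  using MVT2[of 0 t "\<lambda>s. f (y + s *\<^sub>R v)" "\<lambda>s. deriv_along f v (y + s *\<^sub>R v)"] t
    real_derivative_line[OF f[OF seg] seg v] that by auto

text \<open>Both mixed derivatives are limits of the same second difference quotient.\<close>

lemma mixed_difference:
  fixes f :: "'a \<Rightarrow> real"
  assumes f: "Ck_on (Suc (Suc 0)) W U f" and t: "t > 0" and u: "u \<in> W" and v: "v \<in> W"
    and sq: "\<And>a b. 0 \<le> a \<Longrightarrow> a \<le> t \<Longrightarrow> 0 \<le> b \<Longrightarrow> b \<le> t \<Longrightarrow> x + a *\<^sub>R u + b *\<^sub>R v \<in> U"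
  obtains a b where "0 < a" "a < t" "0 < b" "b < t"
    "f (x + t *\<^sub>R u + t *\<^sub>R v) - f (x + t *\<^sub>R u) - f (x + t *\<^sub>R v) + f x
      = t * t * deriv_along (\<lambda>y. deriv_along f u y) v (x + a *\<^sub>R u + b *\<^sub>R v)"
proof -
  define g where "g s = f (x + s *\<^sub>R u + t *\<^sub>R v) - f (x + s *\<^sub>R u)" for s
  have diff: "f differentiable (at y within U)" "(\<lambda>y. deriv_along f u y) differentiable (at y within U)" if "y \<in> U" for y
    using f that u by auto
  have g: "(g has_real_derivative deriv_along f u (x + s *\<^sub>R u + t *\<^sub>R v) - deriv_along f u (x + s *\<^sub>R u)) (at s)"
    if s: "0 \<le> s" "s \<le> t" for s
  proof -
    have U: "(x + b *\<^sub>R v) + s *\<^sub>R u \<in> U" if "0 \<le> b" "b \<le> t" for b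
      using sq[OF s that] by (simp add: algebra_simps)
    note real_derivative_line[OF diff(1)[OF U] U u]
    from DERIV_diff[OF this[of t] this[of 0]] t show ?thesis
      by (simp add: g_def[abs_def] add.commute add.left_commute)
  qed
  obtain a where a: "0 < a" "a < t"
      "g t - g 0 = t * (deriv_along f u (x + a *\<^sub>R u + t *\<^sub>R v) - deriv_along f u (x + a *\<^sub>R u))"
    using MVT2[of 0 t g "\<lambda>s. deriv_along f u (x + s *\<^sub>R u + t *\<^sub>R v) - deriv_along f u (x + s *\<^sub>R u)"] t g
    by auto
  obtain b where b: "0 < b" "b < t"
      "deriv_along f u (x + a *\<^sub>R u + t *\<^sub>R v) - deriv_along f u (x + a *\<^sub>R u)
        = t * deriv_along (\<lambda>y. deriv_along f u y) v (x + a *\<^sub>R u + b *\<^sub>R v)"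
    using mvt_line[of "\<lambda>y. deriv_along f u y" t "x + a *\<^sub>R u" v] diff t sq a v by auto
  show ?thesis
    by (rule that[OF a(1,2) b(1,2)]) (use a(3) b(3) in \<open>simp add: g_def\<close>)
qed

text \<open>Continuity would keep two different values apart near \<open>x\<close>, yet arbitrarily
  close to \<open>x\<close> there are points where the two mixed derivatives agree.\<close>

lemma mixed_derivatives_real:
  fixes f :: "'a \<Rightarrow> real"
  assumes f: "Ck_on (Suc (Suc 0)) W U f" and x: "x \<in> U" and u: "u \<in> W" and v: "v \<in> W"
  shows "deriv_along (\<lambda>y. deriv_along f u y) v x = deriv_along (\<lambda>y. deriv_along f v y) u x"
proof (rule ccontr)
  let ?A = "\<lambda>y. deriv_along (\<lambda>y. deriv_along f u y) v y" and ?B = "\<lambda>y. deriv_along (\<lambda>y. deriv_along f v y) u y"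
  assume ne: "?A x \<noteq> ?B x"
  define d where "d = \<bar>?A x - ?B x\<bar> / 2"
  have d: "d > 0" using ne by (simp add: d_def)
  have "continuous_on U ?A" "continuous_on U ?B"
    using f u v by auto
  then obtain r1 r2 where r: "r1 > 0" "\<And>y. y \<in> U \<Longrightarrow> dist y x < r1 \<Longrightarrow> dist (?A y) (?A x) < d"
      "r2 > 0" "\<And>y. y \<in> U \<Longrightarrow> dist y x < r2 \<Longrightarrow> dist (?B y) (?B x) < d"
    using x d unfolding continuous_on_iff by metis
  obtain r3 where r3: "r3 > 0" "ball x r3 \<inter> W \<subseteq> U"
    using openin x by (auto simp: openin_contains_ball)
  define r where "r = min r1 (min r2 r3)"
  \<comment> \<open>This side length keeps the parallelogram within distance \<open>r / 2\<close> of
    \<open>x\<close>; the summand 1 covers \<open>u = v = 0\<close>.\<close>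
  define t where "t = r / (2 * (norm u + norm v + 1))"
  have rp: "r > 0" using r r3 by (simp add: r_def)
  have N: "norm u + norm v + 1 > 0"
    by (simp add: add_nonneg_pos)
  have t: "t > 0" using rp N by (simp add: t_def)
  have near: "x + a *\<^sub>R u + b *\<^sub>R v \<in> U \<and> dist (x + a *\<^sub>R u + b *\<^sub>R v) x < r"
    if "0 \<le> a" "a \<le> t" "0 \<le> b" "b \<le> t" for a b
  proof -
    have "dist (x + a *\<^sub>R u + b *\<^sub>R v) x = norm (a *\<^sub>R u + b *\<^sub>R v)"
      by (simp add: dist_norm add.assoc)
    also have "\<dots> \<le> a * norm u + b * norm v"
      using that norm_triangle_ineq[of "a *\<^sub>R u" "b *\<^sub>R v"] by simp
    also have "\<dots> \<le> t * norm u + t * norm v"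
      using that by (intro add_mono mult_right_mono) auto
    also have "\<dots> \<le> t * (norm u + norm v + 1)"
      using t by (simp add: algebra_simps)
    also have "\<dots> = r / 2"
    proof -
      have "r / (2 * M) * M = r / 2" if "M > 0" for M
        using that by simp
      from this[OF N] show ?thesis
        by (simp only: t_def)
    qed
    also have "\<dots> < r"
      using rp by simp
    finally have *: "dist (x + a *\<^sub>R u + b *\<^sub>R v) x < r" .
    moreover have "x + a *\<^sub>R u + b *\<^sub>R v \<in> W"
      using u v U_subset[OF x] by (intro subspace_add subspace_scale subspace)
    ultimately show ?thesis
      using r3(2) by (auto simp: r_def dist_commute)
  qed
  obtain a b where ab: "0 < a" "a < t" "0 < b" "b < t"
    "f (x + t *\<^sub>R u + t *\<^sub>R v) - f (x + t *\<^sub>R u) - f (x + t *\<^sub>R v) + f x = t * t * ?A (x + a *\<^sub>R u + b *\<^sub>R v)"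
    by (rule mixed_difference[OF f t u v, of x]) (use near in auto)
  obtain a' b' where ab': "0 < a'" "a' < t" "0 < b'" "b' < t"
    "f (x + t *\<^sub>R v + t *\<^sub>R u) - f (x + t *\<^sub>R v) - f (x + t *\<^sub>R u) + f x = t * t * ?B (x + a' *\<^sub>R v + b' *\<^sub>R u)"
  proof (rule mixed_difference[OF f t v u, of x])
    show "x + a *\<^sub>R v + b *\<^sub>R u \<in> U" if "0 \<le> a" "a \<le> t" "0 \<le> b" "b \<le> t" for a b
      using near[of b a] that by (simp add: algebra_simps)
  qed auto
  have "t * t * ?A (x + a *\<^sub>R u + b *\<^sub>R v) = t * t * ?B (x + a' *\<^sub>R v + b' *\<^sub>R u)"
    using ab(5) ab'(5) by (simp add: algebra_simps)
  then have "?A (x + a *\<^sub>R u + b *\<^sub>R v) = ?B (x + a' *\<^sub>R v + b' *\<^sub>R u)"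
    using t by simp
  moreover have "dist (?A (x + a *\<^sub>R u + b *\<^sub>R v)) (?A x) < d"
    using near[of a b] ab by (intro r(2)) (auto simp: r_def)
  moreover have "dist (?B (x + a' *\<^sub>R v + b' *\<^sub>R u)) (?B x) < d"
    using near[of b' a'] ab' by (intro r(4)) (auto simp: r_def algebra_simps)
  ultimately show False
    unfolding d_def dist_real_def by (simp add: abs_if field_simps split: if_splits)
qed

text \<open>Vectors are determined by their inner products, so the real case applies to
  \<open>f\<close> paired with a fixed vector.\<close>

lemma mixed_derivatives:
  fixes f :: "'a \<Rightarrow> 'b::real_inner"
  assumes f: "Ck_on (Suc (Suc 0)) W U f" and x: "x \<in> U" and u: "u \<in> W" and v: "v \<in> W"
  shows "deriv_along (\<lambda>y. deriv_along f u y) v x = deriv_along (\<lambda>y. deriv_along f v y) u x"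
proof (rule vector_eq_ldot[THEN iffD1], rule allI)
  fix c :: 'b
  have L: "bounded_linear (inner c)"
    by (rule bounded_linear_inner_right)
  have first: "deriv_along (\<lambda>y. inner c (g y)) w y = inner c (deriv_along g w y)"
    if "g differentiable (at y within U)" "y \<in> U" "w \<in> W" for g :: "'a \<Rightarrow> 'b" and w y
    using that by (intro deriv_along_eq bounded_linear.has_derivative[OF L] frechet_works)
  have second: "deriv_along (\<lambda>y. deriv_along (\<lambda>y. inner c (f y)) p y) q x
      = inner c (deriv_along (\<lambda>y. deriv_along f p y) q x)" if "p \<in> W" "q \<in> W" for p q
  proof -
    have "deriv_along (\<lambda>y. deriv_along (\<lambda>y. inner c (f y)) p y) q x
        = deriv_along (\<lambda>y. inner c (deriv_along f p y)) q x"
      using f that by (intro deriv_along_cong x first) auto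
    also have "\<dots> = inner c (deriv_along (\<lambda>y. deriv_along f p y) q x)"
      using f that x by (intro first) auto
    finally show ?thesis .
  qed
  have "Ck_on (Suc (Suc 0)) W U (\<lambda>y. inner c (f y))"
    by (rule Ck_on_bounded_linear[OF L f])
  from mixed_derivatives_real[OF this x u v]
  show "inner c (deriv_along (\<lambda>y. deriv_along f u y) v x) = inner c (deriv_along (\<lambda>y. deriv_along f v y) u x)"
    by (simp only: second u v)
qed

end

section \<open>Minimality in divergence form\<close>

lemma sum3_rotate:
  fixes f :: "'a \<Rightarrow> 'b \<Rightarrow> 'c \<Rightarrow> 'd::comm_monoid_add"
  shows "(\<Sum>k\<in>A. \<Sum>i\<in>B. \<Sum>j\<in>C. f k i j) = (\<Sum>j\<in>C. \<Sum>k\<in>A. \<Sum>i\<in>B. f k i j)"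
  by (subst (2) sum.swap, subst sum.swap) simp

text \<open>
  The divergence of the momentum is a combination of the trace \<open>\<Sum> g k i *\<^sub>R S k i\<close> of the second
  derivatives \<open>S\<close> with respect to the inverse metric \<open>g\<close>; the remaining terms cancel by the
  symmetry of \<open>S\<close>.
\<close>

lemma divergence_cancels:
  fixes g :: "nat \<Rightarrow> nat \<Rightarrow> real" and S :: "nat \<Rightarrow> nat \<Rightarrow> 'a::real_inner"
  assumes g: "\<And>k l. k < n \<Longrightarrow> l < n \<Longrightarrow> g k l = g l k"
    and S: "\<And>k l. k < n \<Longrightarrow> l < n \<Longrightarrow> S k l = S l k"
    and trace: "(\<Sum>k<n. \<Sum>i<n. g k i *\<^sub>R S k i) = 0"
    and A': "\<And>k. k < n \<Longrightarrow> A' k = A / 2 * (\<Sum>i<n. \<Sum>j<n. (inner (S k i) (f j) + inner (f i) (S k j)) * g j i)"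
    and g': "\<And>k l. k < n \<Longrightarrow> l < n \<Longrightarrow> g' k l = - (\<Sum>i<n. \<Sum>j<n. g k i * (inner (S k i) (f j) + inner (f i) (S k j)) * g j l)"
  shows "(\<Sum>k<n. A' k *\<^sub>R (\<Sum>l<n. g k l *\<^sub>R f l) + A *\<^sub>R (\<Sum>l<n. g k l *\<^sub>R S k l + g' k l *\<^sub>R f l)) = 0"
proof -
  define s where "s k i j = inner (S k i) (f j)" for k i j
  have A'_s: "A' k = A * (\<Sum>i<n. \<Sum>j<n. s k i j * g i j)" if k: "k < n" for k
  proof -
    have "(\<Sum>i<n. \<Sum>j<n. inner (f i) (S k j) * g j i) = (\<Sum>j<n. \<Sum>i<n. s k j i * g j i)"
      unfolding s_def by (subst sum.swap) (simp add: inner_commute)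
    moreover have "(\<Sum>i<n. \<Sum>j<n. inner (S k i) (f j) * g j i) = (\<Sum>i<n. \<Sum>j<n. s k i j * g i j)"
      by (intro sum.cong refl) (simp add: s_def g)
    ultimately show ?thesis
      by (simp add: A'[OF k] distrib_right sum.distrib)
  qed
  have coeff: "(\<Sum>k<n. A' k * g k l + A * g' k l) = 0" if l: "l < n" for l
  proof -
    let ?s1 = "\<Sum>k<n. \<Sum>i<n. \<Sum>j<n. g k i * s k i j * g j l" and ?s2 = "\<Sum>k<n. \<Sum>i<n. \<Sum>j<n. g k i * s k j i * g j l"
    have first: "?s1 = 0"
    proof -
      have "?s1 = (\<Sum>j<n. \<Sum>k<n. \<Sum>i<n. g k i * s k i j * g j l)"
        by (rule sum3_rotate)
      also have "\<dots> = (\<Sum>j<n. inner (\<Sum>k<n. \<Sum>i<n. g k i *\<^sub>R S k i) (f j) * g j l)"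
        by (simp add: s_def inner_sum_left sum_distrib_right)
      finally show ?thesis
        by (simp add: trace)
    qed
    \<comment> \<open>Symmetry of \<open>S\<close> exchanges the differentiation index with a
      summation index, which turns \<open>?s2\<close> into the contribution of
      \<open>A'\<close>.\<close>
    have "?s2 = (\<Sum>k<n. \<Sum>i<n. \<Sum>j<n. g k i * s j k i * g j l)"
      by (intro sum.cong refl) (simp add: s_def S)
    also have "\<dots> = (\<Sum>j<n. \<Sum>k<n. \<Sum>i<n. g k i * s j k i * g j l)"
      by (rule sum3_rotate)
    also have "\<dots> = (\<Sum>k<n. \<Sum>i<n. \<Sum>j<n. s k i j * g i j * g k l)"
      by (simp add: mult_ac)
    finally have second: "?s2 = (\<Sum>k<n. (\<Sum>i<n. \<Sum>j<n. s k i j * g i j) * g k l)"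
      by (simp add: sum_distrib_right)
    have "(\<Sum>k<n. g' k l) = - ?s1 - ?s2"
      using l by (simp add: g' s_def inner_commute[of "f _" "S _ _"] distrib_left distrib_right sum.distrib sum_subtractf sum_negf)
    then have "(\<Sum>k<n. g' k l) = - (\<Sum>k<n. (\<Sum>i<n. \<Sum>j<n. s k i j * g i j) * g k l)"
      by (simp add: first second)
    then show ?thesis
      by (simp add: sum.distrib A'_s mult.assoc flip: sum_distrib_left)
  qed
  have "(\<Sum>k<n. A' k *\<^sub>R (\<Sum>l<n. g k l *\<^sub>R f l) + A *\<^sub>R (\<Sum>l<n. g k l *\<^sub>R S k l + g' k l *\<^sub>R f l))
      = A *\<^sub>R (\<Sum>k<n. \<Sum>l<n. g k l *\<^sub>R S k l) + (\<Sum>k<n. \<Sum>l<n. (A' k * g k l + A * g' k l) *\<^sub>R f l)"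
    by (simp add: sum.distrib scaleR_add_right scaleR_sum_right scaleR_add_left)
  also have "(\<Sum>k<n. \<Sum>l<n. (A' k * g k l + A * g' k l) *\<^sub>R f l) = (\<Sum>l<n. (\<Sum>k<n. A' k * g k l + A * g' k l) *\<^sub>R f l)"
    by (subst sum.swap) (simp add: scaleR_sum_left)
  finally show ?thesis
    by (simp add: trace coeff)
qed

section \<open>Normal components relative to the tangent space\<close>

context singular_basis
begin

lemma linear_graph: "linear (\<lambda>v. (v, D v))"
  by (auto simp: linear_iff linear_add[OF lin] linear_scale[OF lin])

lemma subspace_tangent_space: "subspace (tangent_space n D)"
proof -
  have "tangent_space n D = (\<lambda>v. (v, D v)) ` Rn n"
    by (auto simp: tangent_space_def)
  then show ?thesis
    by (simp add: linear_subspace_image[OF linear_graph subspace_Rn])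
qed

lemma e'_tangent: "i < n \<Longrightarrow> e' i \<in> tangent_space n D"
  unfolding e'_def
  by (rule subspace_scale[OF subspace_tangent_space]) (auto simp: tangent_space_def u_Rn)

lemma tangent_space_expand:
  assumes "X \<in> tangent_space n D"
  shows "X = (\<Sum>i<n. (inner (fst X) (u i) * \<rho> i) *\<^sub>R e' i)"
proof -
  obtain v where v: "v \<in> Rn n" "X = (v, D v)"
    using assms by (auto simp: tangent_space_def)
  have "(\<Sum>i<n. (inner v (u i) * \<rho> i) *\<^sub>R e' i) = (\<Sum>i<n. inner v (u i) *\<^sub>R (u i, D (u i)))"
    by (simp add: e'_def \<rho>_nonzero)
  also have "\<dots> = (v, D v)"
    using linear_sum[OF linear_graph, of "\<lambda>i. inner v (u i) *\<^sub>R u i" "{..<n}"]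
    by (simp add: expand[OF v(1)] linear_scale[OF linear_graph] linear_scale[OF lin])
  finally show ?thesis
    by (simp add: v(2))
qed

text \<open>\<open>normal_part\<close> is a definite description, so the projection is built from
  the frame and shown to be unique.\<close>

lemma normal_part_diff: "Z - normal_part (tangent_space n D) Z \<in> tangent_space n D"
proof -
  let ?T = "tangent_space n D"
  define Y where "Y = Z - (\<Sum>i<n. inner (e' i) Z *\<^sub>R e' i)"
  have e'Y: "inner (e' j) Y = 0" if "j < n" for j
  proof -
    have "(\<Sum>i<n. inner (e' i) Z * inner (e' j) (e' i)) = (\<Sum>i<n. if i = j then inner (e' j) Z else 0)"
      using that split_frame_singular
      by (intro sum.cong refl) (auto simp: split_frame_def orthonormal_fam_def)
    then show ?thesis
      using that by (simp add: Y_def inner_diff_right inner_sum_right)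
  qed
  have "inner X Y = 0" if "X \<in> ?T" for X
    by (subst tangent_space_expand[OF that]) (simp add: inner_sum_left e'Y)
  moreover have "Z - Y \<in> ?T"
    using e'_tangent by (auto simp: Y_def intro!: subspace_sum subspace_scale subspace_tangent_space)
  moreover have "Y' = Y" if Y': "\<forall>X\<in>?T. inner X Y' = 0" "Z - Y' \<in> ?T" for Y'
  proof -
    have "Y' - Y \<in> ?T"
      using subspace_diff[OF subspace_tangent_space \<open>Z - Y \<in> ?T\<close> Y'(2)] by simp
    then have "inner (Y' - Y) (Y' - Y) = 0"
      using Y'(1) \<open>\<And>X. X \<in> ?T \<Longrightarrow> inner X Y = 0\<close> by (simp add: inner_diff_right)
    then show ?thesis by simp
  qed
  ultimately have "\<exists>!Y. (\<forall>X\<in>?T. inner X Y = 0) \<and> Z - Y \<in> ?T"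
    by blast
  from theI'[OF this] show ?thesis
    by (simp add: normal_part_def)
qed

lemma vertical_tangent: "(0, x) \<in> tangent_space n D \<Longrightarrow> x = 0"
  by (auto simp: tangent_space_def linear_0[OF lin])

end

lemma Ck_on_fst:
  assumes A: "rel_open W U" and B: "rel_open (W \<times> V) (U \<times> V)"
  shows "Ck_on k W U c \<Longrightarrow> Ck_on k (W \<times> V) (U \<times> V) (\<lambda>p. c (fst p))"
proof (induction k arbitrary: c)
  case 0
  then show ?case
    by (auto intro!: continuous_on_compose2[of U c] continuous_intros)
next
  case (Suc k)
  show ?case
  proof (rule rel_open.Ck_on_Suc_intro[OF B])
    show "((\<lambda>p. c (fst p)) has_derivative (\<lambda>h. frechet_derivative c (at (fst p) within U) (fst h))) (at p within U \<times> V)"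
      if p: "p \<in> U \<times> V" for p
    proof (rule has_derivative_in_compose[where f = fst and f' = fst])
      show "(fst has_derivative fst) (at p within U \<times> V)"
        by (auto intro!: derivative_eq_intros)
      show "(c has_derivative frechet_derivative c (at (fst p) within U)) (at (fst p) within fst ` (U \<times> V))"
        using rel_open.Ck_on_has_derivative[OF A Suc.prems, of "fst p"] p
        by (auto intro: has_derivative_subset)
    qed
    show "Ck_on k (W \<times> V) (U \<times> V) (\<lambda>p. frechet_derivative c (at (fst p) within U) (fst v))" if "v \<in> W \<times> V" for v
      by (rule Suc.IH) (use Suc.prems that in auto)
  qed
qed

section \<open>Smooth coefficients along the graph\<close>

locale smooth_graph =
  fixes n :: nat and \<Omega> :: "rseq set" and F :: "rseq \<Rightarrow> rseq"
  assumes domain: "euclid_domain n \<Omega>" and smooth: "smooth_on (Rn n) \<Omega> F"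
begin

sublocale B: rel_open "Rn n" \<Omega>
  by unfold_locales (use domain in \<open>auto simp: subspace_Rn euclid_domain_def\<close>)

abbreviation d :: "(rseq \<Rightarrow> 'b::real_normed_vector) \<Rightarrow> rseq \<Rightarrow> rseq \<Rightarrow> 'b"
  where "d f v x \<equiv> frechet_derivative f (at x within \<Omega>) v"

lemma Ck_F: "Ck_on k (Rn n) \<Omega> F"
  using smooth by (simp add: smooth_on_def)

lemma finite_rank: "x \<in> \<Omega> \<Longrightarrow> finite_rank_operator n (differential n \<Omega> F x)"
proof (rule finite_rank_operator.intro)
  assume x: "x \<in> \<Omega>"
  have "linear (\<lambda>v. d F v x)"
    using B.deriv_along_linear B.Ck_on_differentiable[OF Ck_F x] by blast
  then show "linear (differential n \<Omega> F x)"
    using linear_compose[OF linear_proj_Rn[of n]] unfolding differential_def[abs_def] comp_def by blast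
  show "differential n \<Omega> F x (proj_Rn n v) = differential n \<Omega> F x v" for v
    by (simp add: differential_def proj_Rn_id proj_Rn_in)
qed

lemma singular: assumes "x \<in> \<Omega>" obtains u where "singular_basis n (differential n \<Omega> F x) u"
  using finite_rank_operator.obtain_singular_basis[OF finite_rank[OF assms]] .

definition partial :: "rseq \<Rightarrow> nat \<Rightarrow> rseq"
  where "partial x i = differential n \<Omega> F x (unit_vec i)"

lemma partial_eq: "i < n \<Longrightarrow> partial x i = d F (unit_vec i) x"
  by (simp add: partial_def differential_def proj_Rn_id unit_vec_in_Rn)

lemma Ck_partial: "i < n \<Longrightarrow> Ck_on k (Rn n) \<Omega> (\<lambda>x. partial x i)"
  using B.Ck_on_deriv_along[OF Ck_F unit_vec_in_Rn] by (simp add: partial_eq)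

lemma Ck_gram: "i < n \<Longrightarrow> j < n \<Longrightarrow> Ck_on k (Rn n) \<Omega> (\<lambda>x. gram (partial x) i j)"
  unfolding gram_def by (intro B.Ck_on_add B.Ck_on_const B.Ck_on_inner Ck_partial)

lemma gram_pos: "x \<in> \<Omega> \<Longrightarrow> dt n (gram (partial x)) > 0"
  by (rule singular) (use singular_basis.dt_gram_pos in \<open>auto simp: partial_def[abs_def]\<close>)

lemma Ck_dt_gram: "Ck_on k (Rn n) \<Omega> (\<lambda>x. dt n (gram (partial x)))"
  by (intro B.Ck_on_dt Ck_gram)

lemma Ck_area: "Ck_on k (Rn n) \<Omega> (\<lambda>x. area n (partial x))"
  unfolding area_def by (intro B.Ck_on_sqrt Ck_dt_gram gram_pos)

abbreviation g :: "rseq \<Rightarrow> nat \<Rightarrow> nat \<Rightarrow> real"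
  where "g x \<equiv> mat_inverse n (gram (partial x))"

lemma Ck_g: "k < n \<Longrightarrow> l < n \<Longrightarrow> Ck_on N (Rn n) \<Omega> (\<lambda>x. g x k l)"
proof -
  assume kl: "k < n" "l < n"
  have entries: "Ck_on N (Rn n) \<Omega> (\<lambda>x. if i = l then (if k = j then 1 else 0) else gram (partial x) i j)"
    if "i < n" "j < n" for i j
    using that by (cases "i = l") (simp_all add: B.Ck_on_const Ck_gram)
  show ?thesis
    unfolding mat_inverse_def divide_inverse
    by (intro B.Ck_on_mult B.Ck_on_dt entries B.Ck_on_inverse Ck_dt_gram)
      (use gram_pos in \<open>auto simp: less_imp_neq[symmetric]\<close>)
qed

lemma Ck_momentum: "k < n \<Longrightarrow> Ck_on N (Rn n) \<Omega> (\<lambda>x. momentum n (partial x) k)"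
  unfolding momentum_def by (intro B.Ck_on_scaleR Ck_area B.Ck_on_sum Ck_g Ck_partial) auto

lemma Ck_hamiltonian: "Ck_on N (Rn n) \<Omega> (\<lambda>x. hamiltonian n (partial x))"
  unfolding hamiltonian_def
  by (intro B.Ck_on_mult Ck_area B.Ck_on_add B.Ck_on_const B.Ck_on_sum Ck_g) auto

lemma g_left_inverse:
  "x \<in> \<Omega> \<Longrightarrow> k < n \<Longrightarrow> j < n \<Longrightarrow> (\<Sum>l<n. g x k l * gram (partial x) l j) = (if k = j then 1 else 0)"
  by (rule singular, assumption) (use singular_basis.mat_inverse_gram_left in \<open>auto simp: partial_def[abs_def]\<close>)

lemma g_symmetric: "x \<in> \<Omega> \<Longrightarrow> k < n \<Longrightarrow> l < n \<Longrightarrow> g x k l = g x l k"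
  by (rule singular, assumption) (use singular_basis.mat_inverse_gram_symmetric in \<open>auto simp: partial_def[abs_def]\<close>)

lemma gram_symmetric: "gram f i j = gram f j i"
  by (simp add: gram_def inner_commute)

lemma g_right_inverse:
  assumes "x \<in> \<Omega>" "k < n" "j < n"
  shows "(\<Sum>l<n. gram (partial x) k l * g x l j) = (if k = j then 1 else 0)"
proof -
  have "(\<Sum>l<n. gram (partial x) k l * g x l j) = (\<Sum>l<n. g x j l * gram (partial x) l k)"
    using assms by (intro sum.cong refl) (simp add: gram_symmetric[of _ k] g_symmetric[of x j] mult.commute)
  then show ?thesis
    using g_left_inverse[of x j k] assms by auto
qed

lemma partial_deriv: "i < n \<Longrightarrow> x \<in> \<Omega> \<Longrightarrow> ((\<lambda>y. partial y i) has_derivative (\<lambda>v. d (\<lambda>y. partial y i) v x)) (at x within \<Omega>)"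
  by (rule B.Ck_on_has_derivative[OF Ck_partial])

section \<open>Derivatives of the area and of the inverse metric\<close>

definition gram' :: "rseq \<Rightarrow> rseq \<Rightarrow> nat \<Rightarrow> nat \<Rightarrow> real"
  where "gram' x v i j = inner (d (\<lambda>y. partial y i) v x) (partial x j) + inner (partial x i) (d (\<lambda>y. partial y j) v x)"

lemma gram_deriv:
  assumes "i < n" "j < n" "x \<in> \<Omega>"
  shows "((\<lambda>y. gram (partial y) i j) has_derivative (\<lambda>v. gram' x v i j)) (at x within \<Omega>)"
  unfolding gram_def gram'_def using partial_deriv assms
  by (auto intro!: derivative_eq_intros simp: add.commute)

text \<open>Jacobi's formula: the differentiated row \<open>k\<close> is a combination of the Gram
  rows, and only its coefficient at row \<open>k\<close> survives.\<close>

lemma area_deriv: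
  assumes x: "x \<in> \<Omega>" and v: "v \<in> Rn n"
  shows "d (\<lambda>y. area n (partial y)) v x = area n (partial x) / 2 * (\<Sum>i<n. \<Sum>j<n. gram' x v i j * g x j i)"
proof -
  let ?M = "gram (partial x)"
  have det: "((\<lambda>y. dt n (gram (partial y))) has_derivative
      (\<lambda>v. \<Sum>k<n. dt n (\<lambda>i j. if i = k then gram' x v i j else ?M i j))) (at x within \<Omega>)"
    by (rule has_derivative_dt) (rule gram_deriv[OF _ _ x])
  have row: "dt n (\<lambda>i j. if i = k then gram' x v i j else ?M i j) = (\<Sum>j<n. gram' x v k j * g x j k) * dt n ?M"
    if k: "k < n" for k
  proof -
    have expand: "gram' x v k j = (\<Sum>l<n. (\<Sum>i<n. gram' x v k i * g x i l) * ?M l j)" if j: "j < n" for j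
    proof -
      have "(\<Sum>l<n. (\<Sum>i<n. gram' x v k i * g x i l) * ?M l j) = (\<Sum>i<n. gram' x v k i * (\<Sum>l<n. g x i l * ?M l j))"
        unfolding sum_distrib_right sum_distrib_left by (subst sum.swap) (simp add: mult.assoc)
      also have "\<dots> = (\<Sum>i<n. if i = j then gram' x v k j else 0)"
        by (intro sum.cong refl) (auto simp: g_left_inverse x j)
      finally show ?thesis
        using j by simp
    qed
    have "dt n (\<lambda>i j. if i = k then gram' x v i j else ?M i j)
        = dt n (\<lambda>i j. if i = k then (\<Sum>l<n. (\<Sum>i<n. gram' x v k i * g x i l) * ?M l j) else ?M i j)"
      by (rule dt_cong) (auto simp: expand)
    then show ?thesis
      by (simp add: dt_row_combination[OF k])
  qed
  have "((\<lambda>y. area n (partial y)) has_derivative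
      (\<lambda>v. (\<Sum>k<n. dt n (\<lambda>i j. if i = k then gram' x v i j else ?M i j)) * (inverse (sqrt (dt n ?M)) / 2))) (at x within \<Omega>)"
    unfolding area_def using det gram_pos[OF x]
    by (auto intro!: derivative_eq_intros simp: field_simps)
  then have "d (\<lambda>y. area n (partial y)) v x
      = (\<Sum>k<n. dt n (\<lambda>i j. if i = k then gram' x v i j else ?M i j)) * (inverse (sqrt (dt n ?M)) / 2)"
    using x v by (rule B.deriv_along_eq)
  also have "\<dots> = (\<Sum>i<n. \<Sum>j<n. gram' x v i j * g x j i) * (dt n ?M * inverse (sqrt (dt n ?M)) / 2)"
    by (simp add: row sum_distrib_right[symmetric])
  also have "dt n ?M * inverse (sqrt (dt n ?M)) = area n (partial x)"
    using gram_pos[OF x] by (simp add: area_def real_div_sqrt flip: divide_inverse)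
  finally show ?thesis
    by simp
qed

text \<open>The relation between \<open>g\<close> and the Gram matrix is differentiated, then
  multiplied by \<open>g\<close> on the right.\<close>

lemma g_deriv:
  assumes x: "x \<in> \<Omega>" and v: "v \<in> Rn n" and k: "k < n" and m: "m < n"
  shows "d (\<lambda>y. g y k m) v x = - (\<Sum>i<n. \<Sum>j<n. g x k i * gram' x v i j * g x j m)"
proof -
  let ?M = "gram (partial x)"
  define g' where "g' l = d (\<lambda>y. g y k l) v x" for l
  have eq: "(\<Sum>l<n. g' l * ?M l j) = - (\<Sum>l<n. g x k l * gram' x v l j)" if j: "j < n" for j
  proof -
    have "((\<lambda>y. \<Sum>l<n. g y k l * gram (partial y) l j) has_derivative
        (\<lambda>v. \<Sum>l<n. g x k l * gram' x v l j + d (\<lambda>y. g y k l) v x * ?M l j)) (at x within \<Omega>)"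
      using k j x
      by (intro has_derivative_sum has_derivative_mult gram_deriv B.Ck_on_has_derivative[OF Ck_g]) auto
    then have "d (\<lambda>y. \<Sum>l<n. g y k l * gram (partial y) l j) v x
        = (\<Sum>l<n. g x k l * gram' x v l j + g' l * ?M l j)"
      unfolding g'_def using x v by (rule B.deriv_along_eq)
    moreover have "d (\<lambda>y. \<Sum>l<n. g y k l * gram (partial y) l j) v x = d (\<lambda>y. if k = j then 1 else 0) v x"
      by (rule B.deriv_along_cong) (use g_left_inverse k j x in auto)
    moreover have "d (\<lambda>y. if k = j then 1 else (0::real)) v x = 0"
      by (rule B.deriv_along_eq[OF _ x v]) (rule has_derivative_const)
    ultimately show ?thesis
      by (simp add: sum.distrib)
  qed
  have "g' m = (\<Sum>l<n. g' l * (\<Sum>j<n. ?M l j * g x j m))"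
    using m by (simp add: g_right_inverse[OF x] if_distrib cong: if_cong)
  also have "\<dots> = (\<Sum>j<n. (\<Sum>l<n. g' l * ?M l j) * g x j m)"
    unfolding sum_distrib_left sum_distrib_right by (subst sum.swap) (simp add: mult.assoc)
  also have "\<dots> = (\<Sum>j<n. \<Sum>i<n. - (g x k i * gram' x v i j * g x j m))"
    by (simp add: eq sum_distrib_right sum_negf)
  also have "\<dots> = - (\<Sum>i<n. \<Sum>j<n. g x k i * gram' x v i j * g x j m)"
    by (subst sum.swap) (simp add: sum_negf)
  finally show ?thesis
    by (simp add: g'_def)
qed

definition hessian :: "rseq \<Rightarrow> nat \<Rightarrow> nat \<Rightarrow> rseq"
  where "hessian x k l = d (\<lambda>y. partial y l) (unit_vec k) x"

lemma hessian_symmetric: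
  assumes "x \<in> \<Omega>" "k < n" "l < n"
  shows "hessian x k l = hessian x l k"
  using B.mixed_derivatives[OF Ck_F assms(1) unit_vec_in_Rn[OF assms(3)] unit_vec_in_Rn[OF assms(2)]] assms(2,3)
  by (simp add: hessian_def partial_eq)

lemma second_derivative_expand:
  assumes x: "x \<in> \<Omega>" and u: "u \<in> Rn n" and v: "v \<in> Rn n"
  shows "d (\<lambda>y. d F v y) u x = (\<Sum>k<n. \<Sum>l<n. (inner u (unit_vec k) * inner v (unit_vec l)) *\<^sub>R hessian x k l)"
proof -
  have lin: "linear (\<lambda>w. d F w y)" if "y \<in> \<Omega>" for y
    using B.deriv_along_linear B.Ck_on_differentiable[OF Ck_F that] by blast
  have "d F v y = (\<Sum>l<n. inner v (unit_vec l) *\<^sub>R partial y l)" if "y \<in> \<Omega>" for y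
    using linear_sum[OF lin[OF that], of "\<lambda>l. inner v (unit_vec l) *\<^sub>R unit_vec l" "{..<n}"]
    by (simp add: Rn_expand[OF v] linear_scale[OF lin[OF that]] partial_eq)
  then have "d (\<lambda>y. d F v y) u x = d (\<lambda>y. \<Sum>l<n. inner v (unit_vec l) *\<^sub>R partial y l) u x"
    by (rule B.deriv_along_cong) (simp_all add: x)
  also have "\<dots> = (\<Sum>l<n. inner v (unit_vec l) *\<^sub>R d (\<lambda>y. partial y l) u x)"
    by (rule B.deriv_along_eq[OF _ x u])
      (use partial_deriv x in \<open>auto intro!: has_derivative_sum has_derivative_scaleR_right\<close>)
  also have "\<dots> = (\<Sum>l<n. inner v (unit_vec l) *\<^sub>R (\<Sum>k<n. inner u (unit_vec k) *\<^sub>R hessian x k l))"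
  proof (intro sum.cong refl arg_cong2[where f = scaleR])
    fix l assume "l \<in> {..<n}"
    then have "linear (\<lambda>w. d (\<lambda>y. partial y l) w x)"
      using B.deriv_along_linear B.Ck_on_differentiable[OF Ck_partial x] by blast
    from linear_sum[OF this, of "\<lambda>k. inner u (unit_vec k) *\<^sub>R unit_vec k" "{..<n}"] linear_scale[OF this]
    show "d (\<lambda>y. partial y l) u x = (\<Sum>k<n. inner u (unit_vec k) *\<^sub>R hessian x k l)"
      by (simp add: Rn_expand[OF u] hessian_def)
  qed
  also have "\<dots> = (\<Sum>k<n. \<Sum>l<n. (inner u (unit_vec k) * inner v (unit_vec l)) *\<^sub>R hessian x k l)"
    by (subst sum.swap) (simp add: scaleR_sum_right mult.commute)
  finally show ?thesis .
qed

text \<open>The first component of the parametrisation is the identity, so its second derivative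
  vanishes.\<close>

lemma second_differential_graph:
  assumes x: "x \<in> \<Omega>" and u: "u \<in> Rn n" and v: "v \<in> Rn n"
  shows "second_differential n \<Omega> (graph_map F) x u v = (0, d (\<lambda>y. d F v y) u x)"
proof -
  have "differential n \<Omega> (graph_map F) y v = (v, d F v y)" if y: "y \<in> \<Omega>" for y
  proof -
    have "(graph_map F has_derivative (\<lambda>h. (h, d F h y))) (at y within \<Omega>)"
      unfolding graph_map_def[abs_def]
      by (intro has_derivative_Pair has_derivative_ident B.Ck_on_has_derivative[OF Ck_F y])
    then show ?thesis
      using B.deriv_along_eq[OF _ y v] by (simp add: differential_def proj_Rn_id v)
  qed
  then have "second_differential n \<Omega> (graph_map F) x u v = d (\<lambda>y. (v, d F v y)) u x"
    using x u by (auto simp: second_differential_def differential_def[of n \<Omega> _ x u] proj_Rn_id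
        intro!: B.deriv_along_cong)
  also have "\<dots> = (0, d (\<lambda>y. d F v y) u x)"
    by (rule B.deriv_along_eq[OF _ x u], rule has_derivative_Pair[OF has_derivative_const])
      (rule B.Ck_on_has_derivative[OF B.Ck_on_deriv_along[OF Ck_F v] x])
  finally show ?thesis .
qed

text \<open>
  The tangential part of the trace of the second derivatives of \<open>(x, F x)\<close> has vanishing first
  component, so it vanishes.
\<close>

lemma minimal_trace_zero:
  assumes min: "minimal_graph n \<Omega> F" and x: "x \<in> \<Omega>"
  shows "(\<Sum>k<n. \<Sum>l<n. g x k l *\<^sub>R hessian x k l) = 0"
proof -
  let ?D = "differential n \<Omega> F x"
  obtain u where "singular_basis n ?D u"
    using singular[OF x] .
  then interpret S: singular_basis n ?D u .
  let ?T = "tangent_space n ?D"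
  define f where "f i = fst (tangent_frame ?D i)" for i
  define Z where "Z i = (0 :: rseq, d (\<lambda>y. d F (f i) y) (f i) x)" for i
  have f: "f i \<in> Rn n" if "i < n" for i
    using that by (simp add: f_def tangent_frame_def S.tangent_iso_eq S.spec_op_Rn unit_vec_in_Rn)
  have "(\<Sum>i<n. normal_part ?T (Z i)) = mean_curvature n \<Omega> F x"
    unfolding mean_curvature_def second_fundamental_form_def Let_def
    using f by (intro sum.cong refl arg_cong2[where f = normal_part])
      (simp add: Z_def f_def second_differential_graph[OF x])
  then have "(\<Sum>i<n. Z i) = (\<Sum>i<n. Z i - normal_part ?T (Z i))"
    using min x by (simp add: minimal_graph_def sum_subtractf)
  also have "\<dots> \<in> ?T"
    by (intro subspace_sum S.subspace_tangent_space S.normal_part_diff)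
  finally have "(0, \<Sum>i<n. d (\<lambda>y. d F (f i) y) (f i) x) \<in> ?T"
    by (simp add: Z_def sum_prod)
  then have "(\<Sum>i<n. d (\<lambda>y. d F (f i) y) (f i) x) = 0"
    by (rule S.vertical_tangent)
  moreover have "(\<Sum>i<n. d (\<lambda>y. d F (f i) y) (f i) x)
      = (\<Sum>i<n. \<Sum>k<n. \<Sum>l<n. (inner (f i) (unit_vec k) * inner (f i) (unit_vec l)) *\<^sub>R hessian x k l)"
    by (intro sum.cong refl second_derivative_expand x f) auto
  moreover have "\<dots> = (\<Sum>k<n. \<Sum>l<n. (\<Sum>i<n. inner (f i) (unit_vec k) * inner (f i) (unit_vec l)) *\<^sub>R hessian x k l)"
    by (subst sum3_rotate[symmetric]) (simp add: scaleR_sum_left)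
  moreover have "\<dots> = (\<Sum>k<n. \<Sum>l<n. g x k l *\<^sub>R hessian x k l)"
    unfolding f_def partial_def[abs_def]
    by (intro sum.cong refl) (simp add: S.tangent_frame_fst_sum)
  ultimately show ?thesis
    by simp
qed

text \<open>The Euler-Lagrange system of the area integrand, derived from the vanishing trace
  instead of a variation.\<close>

lemma momentum_divergence_free:
  assumes min: "minimal_graph n \<Omega> F" and x: "x \<in> \<Omega>"
  shows "(\<Sum>k<n. d (\<lambda>y. momentum n (partial y) k) (unit_vec k) x) = 0"
proof -
  let ?e = "unit_vec :: nat \<Rightarrow> rseq"
  have "d (\<lambda>y. momentum n (partial y) k) (?e k) x
      = d (\<lambda>y. area n (partial y)) (?e k) x *\<^sub>R (\<Sum>l<n. g x k l *\<^sub>R partial x l)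
        + area n (partial x) *\<^sub>R (\<Sum>l<n. g x k l *\<^sub>R hessian x k l + d (\<lambda>y. g y k l) (?e k) x *\<^sub>R partial x l)"
    if k: "k < n" for k
  proof -
    have "((\<lambda>y. momentum n (partial y) k) has_derivative
        (\<lambda>v. area n (partial x) *\<^sub>R (\<Sum>l<n. g x k l *\<^sub>R d (\<lambda>y. partial y l) v x + d (\<lambda>y. g y k l) v x *\<^sub>R partial x l)
          + d (\<lambda>y. area n (partial y)) v x *\<^sub>R (\<Sum>l<n. g x k l *\<^sub>R partial x l))) (at x within \<Omega>)"
      unfolding momentum_def using k x
      by (intro has_derivative_scaleR has_derivative_sum partial_deriv
          B.Ck_on_has_derivative[OF Ck_area] B.Ck_on_has_derivative[OF Ck_g]) auto
    from B.deriv_along_eq[OF this x unit_vec_in_Rn[OF k]] show ?thesis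
      by (simp add: hessian_def add.commute)
  qed
  then have "(\<Sum>k<n. d (\<lambda>y. momentum n (partial y) k) (?e k) x)
      = (\<Sum>k<n. d (\<lambda>y. area n (partial y)) (?e k) x *\<^sub>R (\<Sum>l<n. g x k l *\<^sub>R partial x l)
        + area n (partial x) *\<^sub>R (\<Sum>l<n. g x k l *\<^sub>R hessian x k l + d (\<lambda>y. g y k l) (?e k) x *\<^sub>R partial x l))"
    by simp
  also have "\<dots> = 0"
  proof (rule divergence_cancels)
    show "(\<Sum>k<n. \<Sum>i<n. g x k i *\<^sub>R hessian x k i) = 0"
      by (rule minimal_trace_zero[OF min x])
    show "g x k l = g x l k" "hessian x k l = hessian x l k" if "k < n" "l < n" for k l
      using that x by (simp_all add: g_symmetric[of x k l] hessian_symmetric[of x k l])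
  qed (simp_all add: area_deriv[OF x] g_deriv[OF x] unit_vec_in_Rn gram'_def hessian_def)
  finally show ?thesis .
qed

end

section \<open>The calibration\<close>

lemma dt_swap_rows:
  fixes M :: "nat \<Rightarrow> nat \<Rightarrow> 'a::comm_ring_1"
  assumes "a < n" "b < n" "a \<noteq> b"
  shows "dt n (\<lambda>i j. if i = a then M b j else if i = b then M a j else M i j) = - dt n M"
proof -
  have "Matrix.mat n n (\<lambda>(i, j). if i = a then M b j else if i = b then M a j else M i j)
      = swaprows a b (Matrix.mat n n (\<lambda>(i, j). M i j))"
    using assms by (auto intro!: eq_matI simp: mat_swaprows_def)
  then show ?thesis
    unfolding dt_def using assms by (simp add: det_swaprows)
qed

lemma alternating_form_dt:
  fixes V :: "'a::real_vector set"
  assumes lin: "\<And>\<iota> i. \<iota> \<in> S \<Longrightarrow> i < n \<Longrightarrow> linear (\<alpha> \<iota> i)"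
    and \<xi>: "\<And>vs. length vs = n \<Longrightarrow> set vs \<subseteq> V \<Longrightarrow> \<xi> vs = (\<Sum>\<iota>\<in>S. c \<iota> * dt n (\<lambda>i j. \<alpha> \<iota> i (vs ! j)))"
    and V: "subspace V"
  shows "alternating_form V n \<xi>"
  unfolding alternating_form_def
proof (intro conjI allI impI ballI)
  fix vs :: "'a list" and k and a b :: 'a and r :: real
  assume vs: "length vs = n \<and> set vs \<subseteq> V \<and> k < n" and ab: "a \<in> V" "b \<in> V"
  have upd: "\<xi> (vs[k := x]) = (\<Sum>\<iota>\<in>S. c \<iota> * dt n (\<lambda>i j. if j = k then \<alpha> \<iota> i x else \<alpha> \<iota> i (vs ! j)))"
    if "x \<in> V" for x
  proof -
    have "set (vs[k := x]) \<subseteq> V"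
      using vs that set_update_subset_insert[of vs k x] by auto
    then show ?thesis
      using vs by (subst \<xi>) (auto simp: nth_list_update intro!: sum.cong arg_cong2[where f = "(*)"] dt_cong)
  qed
  have "dt n (\<lambda>i j. if j = k then \<alpha> \<iota> i (a + r *\<^sub>R b) else \<alpha> \<iota> i (vs ! j))
      = dt n (\<lambda>i j. if j = k then \<alpha> \<iota> i a else \<alpha> \<iota> i (vs ! j))
        + r * dt n (\<lambda>i j. if j = k then \<alpha> \<iota> i b else \<alpha> \<iota> i (vs ! j))" if "\<iota> \<in> S" for \<iota>
  proof -
    have "dt n (\<lambda>i j. if j = k then \<alpha> \<iota> i (a + r *\<^sub>R b) else \<alpha> \<iota> i (vs ! j))
        = dt n (\<lambda>i j. if j = k then \<alpha> \<iota> i a + r * \<alpha> \<iota> i b else \<alpha> \<iota> i (vs ! j))"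
      using lin[OF that] by (intro dt_cong) (simp add: linear_add linear_scale)
    then show ?thesis
      using vs by (simp add: dt_col_add)
  qed
  then show "\<xi> (vs[k := a + r *\<^sub>R b]) = \<xi> (vs[k := a]) + r * \<xi> (vs[k := b])"
    using ab by (simp add: upd subspace_add[OF V] subspace_scale[OF V] distrib_left sum.distrib sum_distrib_left mult.left_commute)
next
  fix vs :: "'a list" and i j
  assume vs: "length vs = n \<and> set vs \<subseteq> V \<and> i < j \<and> j < n \<and> vs ! i = vs ! j"
  then have "dt n (\<lambda>k l. \<alpha> \<iota> k (vs ! l)) = 0" for \<iota>
    by (intro dt_equal_cols[of i _ j]) auto
  then show "\<xi> vs = 0"
    using vs by (simp add: \<xi>)
qed

context smooth_graph
begin

context
  fixes m :: nat
begin

abbreviation V :: "(rseq \<times> rseq) set" where "V \<equiv> Rn n \<times> Rn m"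
abbreviation U :: "(rseq \<times> rseq) set" where "U \<equiv> \<Omega> \<times> Rn m"

lemma subspace_V: "subspace V"
  by (intro subspace_Times subspace_Rn)

lemma rel_open_product: "rel_open V U"
proof (rule rel_open.intro[OF subspace_V])
  obtain T where T: "open T" "\<Omega> = Rn n \<inter> T"
    using B.openin by (auto simp: openin_open)
  have "U = V \<inter> (T \<times> UNIV)"
    using T by auto
  moreover have "open (T \<times> (UNIV :: rseq set))"
    using T by (intro open_Times) auto
  ultimately show "openin (top_of_set V) U"
    by (auto simp: openin_open)
qed

interpretation P: rel_open V U
  by (rule rel_open_product)

text \<open>
  \<open>None\<close> stands for the summand \<open>dx\<^sub>1 \<and> \<dots> \<and> dx\<^sub>n\<close>, \<open>Some (k, a)\<close> for the one in which \<open>dx\<^sub>k\<close>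
  is replaced by \<open>dy\<^sub>a\<close>.
\<close>

definition terms :: "(nat \<times> nat) option set"
  where "terms = insert None (Some ` ({..<n} \<times> {..<m}))"

primrec covector :: "(nat \<times> nat) option \<Rightarrow> nat \<Rightarrow> rseq \<times> rseq \<Rightarrow> real"
  where
    "covector None i = (\<lambda>x. coord (fst x) i)"
  | "covector (Some ka) i = (\<lambda>x. if i = fst ka then coord (snd x) (snd ka) else coord (fst x) i)"

primrec coefficient :: "(nat \<times> nat) option \<Rightarrow> rseq \<Rightarrow> real"
  where
    "coefficient None = (\<lambda>x. hamiltonian n (partial x))"
  | "coefficient (Some ka) = (\<lambda>x. inner (momentum n (partial x) (fst ka)) (unit_vec (snd ka)))"

lemma sum_terms: "(\<Sum>\<iota>\<in>terms. f \<iota>) = f None + (\<Sum>k<n. \<Sum>a<m. f (Some (k, a)))"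
  unfolding terms_def
  by (subst sum.insert) (auto simp: sum.reindex sum.cartesian_product)

lemma linear_covector: "linear (covector \<iota> i)"
  by (cases \<iota>) (auto simp: linear_iff plus_rseq.rep_eq scaleR_rseq.rep_eq)

lemma Theta_formula:
  assumes "p \<in> U" "length vs = n" "set vs \<subseteq> V"
  shows "Theta n \<Omega> F p vs = (\<Sum>\<iota>\<in>terms. coefficient \<iota> (fst p) * dt n (\<lambda>i j. covector \<iota> i (vs ! j)))"
proof -
  have x: "fst p \<in> \<Omega>"
    using assms(1) by auto
  obtain u where "singular_basis n (differential n \<Omega> F (fst p)) u"
    using singular[OF x] .
  from singular_basis.theta_at_formula[OF this assms(2,3)] show ?thesis
    by (simp add: Theta_eq_theta_at sum_terms partial_def[abs_def] cong: if_cong)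
qed

lemma Ck_coefficient: "\<iota> \<in> terms \<Longrightarrow> Ck_on N (Rn n) \<Omega> (coefficient \<iota>)"
  by (cases \<iota>) (auto simp: terms_def Ck_hamiltonian intro!: B.Ck_on_inner Ck_momentum B.Ck_on_const)

lemma Ck_coefficient_fst: "\<iota> \<in> terms \<Longrightarrow> Ck_on N V U (\<lambda>p. coefficient \<iota> (fst p))"
  by (intro Ck_on_fst B.rel_open_axioms rel_open_product Ck_coefficient)

lemma smooth_form_Theta: "smooth_form V U n (Theta n \<Omega> F)"
  unfolding smooth_form_def
proof (intro conjI ballI allI impI)
  show "alternating_form V n (Theta n \<Omega> F p)" if "p \<in> U" for p
    by (rule alternating_form_dt[OF linear_covector Theta_formula[OF that] subspace_V])
  show "smooth_on V U (\<lambda>p. Theta n \<Omega> F p vs)" if "length vs = n \<and> set vs \<subseteq> V" for vs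
    unfolding smooth_on_def
  proof
    fix N
    have "Ck_on N V U (\<lambda>p. \<Sum>\<iota>\<in>terms. coefficient \<iota> (fst p) * dt n (\<lambda>i j. covector \<iota> i (vs ! j)))"
      by (intro P.Ck_on_sum P.Ck_on_mult P.Ck_on_const Ck_coefficient_fst)
    then show "Ck_on N V U (\<lambda>p. Theta n \<Omega> F p vs)"
      by (rule P.Ck_on_cong[rotated]) (use that in \<open>simp add: Theta_formula\<close>)
  qed
qed

lemma coefficient_deriv:
  assumes p: "p \<in> U" and \<iota>: "\<iota> \<in> terms"
  shows "((\<lambda>q. coefficient \<iota> (fst q)) has_derivative (\<lambda>h. d (coefficient \<iota>) (fst h) (fst p))) (at p within U)"
proof (rule has_derivative_in_compose[where f = fst and f' = fst])
  show "(fst has_derivative fst) (at p within U)"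
    by (auto intro!: derivative_eq_intros)
  show "(coefficient \<iota> has_derivative (\<lambda>h. d (coefficient \<iota>) h (fst p))) (at (fst p) within fst ` U)"
    using B.Ck_on_has_derivative[OF Ck_coefficient[OF \<iota>], of "fst p"] p
    by (auto intro: has_derivative_subset)
qed

lemma coefficient_deriv_expand:
  assumes x: "x \<in> \<Omega>" and \<iota>: "\<iota> \<in> terms" and h: "h \<in> Rn n"
  shows "d (coefficient \<iota>) h x = (\<Sum>l<n. coord h l * d (coefficient \<iota>) (unit_vec l) x)"
proof -
  have lin: "linear (\<lambda>v. d (coefficient \<iota>) v x)"
    using B.deriv_along_linear B.Ck_on_differentiable[OF Ck_coefficient[OF \<iota>] x] by blast
  show ?thesis
    using linear_sum[OF lin, of "\<lambda>l. inner h (unit_vec l) *\<^sub>R unit_vec l" "{..<n}"]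
    unfolding Rn_expand[OF h] by (simp add: linear_scale[OF lin] inner_unit_vec)
qed

text \<open>The coefficients depend on the base point alone, so only some \<open>dx\<^sub>l\<close>
  can be put in front. The signed sum over deleted arguments is the expansion of a larger
  determinant along that row.\<close>

lemma ext_deriv_Theta:
  assumes p: "p \<in> U" and vs: "length vs = Suc n" "set vs \<subseteq> V"
  shows "ext_deriv U (Theta n \<Omega> F) p vs = (\<Sum>\<iota>\<in>terms. \<Sum>l<n. d (coefficient \<iota>) (unit_vec l) (fst p) *
    dt (Suc n) (\<lambda>i j. case i of 0 \<Rightarrow> coord (fst (vs ! j)) l | Suc i \<Rightarrow> covector \<iota> i (vs ! j)))"
proof -
  define A where "A \<iota> i = dt n (\<lambda>r k. covector \<iota> r (vs ! skip i k))" for \<iota> i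
  let ?t = "\<lambda>\<iota> l i. d (coefficient \<iota>) (unit_vec l) (fst p) * ((-1) ^ i * coord (fst (vs ! i)) l * A \<iota> i)"
  have x: "fst p \<in> \<Omega>"
    using p by auto
  have summand: "frechet_derivative (\<lambda>q. Theta n \<Omega> F q (delete_nth i vs)) (at p within U) (vs ! i)
      = (\<Sum>\<iota>\<in>terms. \<Sum>l<n. coord (fst (vs ! i)) l * d (coefficient \<iota>) (unit_vec l) (fst p) * A \<iota> i)"
    if i: "i < Suc n" for i
  proof -
    have del: "length (delete_nth i vs) = n" "set (delete_nth i vs) \<subseteq> V"
      using i vs set_delete_nth[of i vs] by (auto simp: length_delete_nth)
    have vi: "vs ! i \<in> V"
      using i vs nth_mem[of i vs] by auto
    have "dt n (\<lambda>r k. covector \<iota> r (delete_nth i vs ! k)) = A \<iota> i" for \<iota>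
      unfolding A_def using vs by (intro dt_cong) (simp add: nth_delete_nth)
    then have "P.deriv_along (\<lambda>q. Theta n \<Omega> F q (delete_nth i vs)) (vs ! i) p
        = P.deriv_along (\<lambda>q. \<Sum>\<iota>\<in>terms. coefficient \<iota> (fst q) * A \<iota> i) (vs ! i) p"
      using del by (intro P.deriv_along_cong p) (simp add: Theta_formula)
    also have "\<dots> = (\<Sum>\<iota>\<in>terms. d (coefficient \<iota>) (fst (vs ! i)) (fst p) * A \<iota> i)"
      by (rule P.deriv_along_eq[OF _ p vi])
        (intro has_derivative_sum has_derivative_mult_left coefficient_deriv p)
    also have "\<dots> = (\<Sum>\<iota>\<in>terms. \<Sum>l<n. coord (fst (vs ! i)) l * d (coefficient \<iota>) (unit_vec l) (fst p) * A \<iota> i)"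
      using vi by (intro sum.cong refl) (auto simp: coefficient_deriv_expand[OF x] sum_distrib_right)
    finally show ?thesis .
  qed
  have "ext_deriv U (Theta n \<Omega> F) p vs
      = (\<Sum>i<Suc n. \<Sum>\<iota>\<in>terms. \<Sum>l<n. ?t \<iota> l i)"
    unfolding ext_deriv_def vs(1)
    by (intro sum.cong refl) (simp add: summand sum_distrib_left mult_ac)
  also have "\<dots> = (\<Sum>\<iota>\<in>terms. \<Sum>i<Suc n. \<Sum>l<n. ?t \<iota> l i)"
    by (rule sum.swap)
  also have "\<dots> = (\<Sum>\<iota>\<in>terms. \<Sum>l<n. \<Sum>i<Suc n. ?t \<iota> l i)"
    by (intro sum.cong refl sum.swap)
  also have "\<dots> = (\<Sum>\<iota>\<in>terms. \<Sum>l<n. d (coefficient \<iota>) (unit_vec l) (fst p) *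
      dt (Suc n) (\<lambda>i j. case i of 0 \<Rightarrow> coord (fst (vs ! j)) l | Suc i \<Rightarrow> covector \<iota> i (vs ! j)))"
    unfolding dt_laplace_row A_def by (simp only: sum_distrib_left nat.case)
  finally show ?thesis .
qed

text \<open>A leading \<open>dx\<^sub>l\<close> repeats a factor except in
  \<open>Some (k, a)\<close> with \<open>l = k\<close>. What remains are the components of minus the
  divergence of the momentum, times \<open>dy\<^sub>a \<and> dx\<^sub>1 \<and> \<dots> \<and>
  dx\<^sub>n\<close>.\<close>

lemma closed_form_Theta:
  assumes min: "minimal_graph n \<Omega> F"
  shows "closed_form V U n (Theta n \<Omega> F)"
  unfolding closed_form_def
proof (intro ballI allI impI)
  fix p vs
  assume p: "p \<in> U" and vs: "length vs = Suc n \<and> set vs \<subseteq> V"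
  define M where "M \<iota> l i j = (case i of 0 \<Rightarrow> coord (fst (vs ! j)) l | Suc i \<Rightarrow> covector \<iota> i (vs ! j))" for \<iota> l i j
  define N where "N a = dt (Suc n) (\<lambda>i j. case i of 0 \<Rightarrow> coord (snd (vs ! j)) a | Suc i \<Rightarrow> coord (fst (vs ! j)) i)" for a
  let ?c = "\<lambda>k a l. d (coefficient (Some (k, a))) (unit_vec l) (fst p)"
  have x: "fst p \<in> \<Omega>"
    using p by auto
  have None: "dt (Suc n) (M None l) = 0" if "l < n" for l
    by (rule dt_equal_rows[of 0 _ "Suc l"]) (use that in \<open>auto simp: M_def\<close>)
  have off: "dt (Suc n) (M (Some (k, a)) l) = 0" if "l < n" "l \<noteq> k" for k a l
    by (rule dt_equal_rows[of 0 _ "Suc l"]) (use that in \<open>auto simp: M_def\<close>)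
  have diag: "dt (Suc n) (M (Some (k, a)) k) = - N a" if k: "k < n" for k a
  proof -
    \<comment> \<open>Here \<open>dx\<^sub>k\<close> stands in front and \<open>dy\<^sub>a\<close>
      in its place; one exchange of rows gives the sign.\<close>
    let ?K = "\<lambda>i j. case i of 0 \<Rightarrow> coord (snd (vs ! j)) a | Suc i \<Rightarrow> coord (fst (vs ! j)) i"
    have "M (Some (k, a)) k i j = (if i = 0 then ?K (Suc k) j else if i = Suc k then ?K 0 j else ?K i j)" for i j
      by (cases i) (auto simp: M_def)
    then have "dt (Suc n) (M (Some (k, a)) k)
        = dt (Suc n) (\<lambda>i j. if i = 0 then ?K (Suc k) j else if i = Suc k then ?K 0 j else ?K i j)"
      by (intro dt_cong) simp
    also have "\<dots> = - dt (Suc n) ?K"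
      by (rule dt_swap_rows) (use k in auto)
    finally show ?thesis
      by (simp add: N_def)
  qed
  have coeff: "?c k a k
      = inner (d (\<lambda>y. momentum n (partial y) k) (unit_vec k) (fst p)) (unit_vec a)" if k: "k < n" for k a
  proof -
    have "((\<lambda>y. coefficient (Some (k, a)) y) has_derivative
        (\<lambda>v. inner (d (\<lambda>y. momentum n (partial y) k) v (fst p)) (unit_vec a))) (at (fst p) within \<Omega>)"
      by (simp, intro has_derivative_inner_left B.Ck_on_has_derivative[OF Ck_momentum[OF k] x])
    from B.deriv_along_eq[OF this x unit_vec_in_Rn[OF k]] show ?thesis .
  qed
  have "ext_deriv U (Theta n \<Omega> F) p vs
      = (\<Sum>\<iota>\<in>terms. \<Sum>l<n. d (coefficient \<iota>) (unit_vec l) (fst p) * dt (Suc n) (M \<iota> l))"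
    unfolding M_def[abs_def] by (rule ext_deriv_Theta) (use p vs in auto)
  also have "\<dots> = (\<Sum>k<n. \<Sum>a<m. \<Sum>l<n. ?c k a l * dt (Suc n) (M (Some (k, a)) l))"
    by (simp add: sum_terms None)
  also have "\<dots> = (\<Sum>k<n. \<Sum>a<m. ?c k a k * - N a)"
  proof (intro sum.cong refl)
    fix k a assume "k \<in> {..<n}"
    then have "(\<Sum>l<n. ?c k a l * dt (Suc n) (M (Some (k, a)) l))
        = (\<Sum>l<n. if l = k then ?c k a k * - N a else 0)"
      by (intro sum.cong refl) (auto simp: off diag)
    then show "(\<Sum>l<n. ?c k a l * dt (Suc n) (M (Some (k, a)) l))
        = ?c k a k * - N a"
      using \<open>k \<in> {..<n}\<close> by simp
  qed
  also have "\<dots> = (\<Sum>a<m. inner (\<Sum>k<n. d (\<lambda>y. momentum n (partial y) k) (unit_vec k) (fst p)) (unit_vec a) * - N a)"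
    by (subst sum.swap) (simp add: coeff[unfolded coefficient.simps fst_conv snd_conv] inner_sum_left sum_distrib_right sum_negf)
  also have "\<dots> = 0"
    by (simp add: momentum_divergence_free[OF min x])
  finally show "ext_deriv U (Theta n \<Omega> F) p vs = 0" .
qed

end

section \<open>Rank and comass\<close>

lemma op_rank_le: "op_rank n (differential n \<Omega> F x) \<le> n" if x: "x \<in> \<Omega>"
proof -
  interpret finite_rank_operator n "differential n \<Omega> F x"
    by (rule finite_rank[OF x])
  let ?D = "differential n \<Omega> F x"
  have "?D ` Rn n \<subseteq> span ((\<lambda>i. ?D (unit_vec i)) ` {..<n})"
  proof
    fix y assume "y \<in> ?D ` Rn n"
    then obtain v where "y = ?D v" by auto
    then show "y \<in> span ((\<lambda>i. ?D (unit_vec i)) ` {..<n})"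
      by (simp only:, subst D_expand) (intro span_sum span_scale span_base, auto)
  qed
  then have "dim (?D ` Rn n) \<le> card ((\<lambda>i. ?D (unit_vec i)) ` {..<n})"
    by (rule dim_le_card) simp
  also have "\<dots> \<le> n"
    using card_image_le[of "{..<n}" "\<lambda>i. ?D (unit_vec i)"] by simp
  finally show ?thesis
    by (simp add: op_rank_def)
qed

lemma max_rank_le: "max_rank n \<Omega> F \<le> n"
  unfolding max_rank_def using domain op_rank_le
  by (intro cSUP_least) (auto simp: euclid_domain_def)

text \<open>A supremum of natural numbers is an upper bound only for a bounded set; the ranks are
  bounded by \<open>n\<close>.\<close>

lemma op_rank_le_max_rank: "x \<in> \<Omega> \<Longrightarrow> op_rank n (differential n \<Omega> F x) \<le> max_rank n \<Omega> F"
  unfolding max_rank_def using op_rank_le by (intro cSUP_upper) (auto intro!: bdd_aboveI[of _ n])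

lemma comass_Theta:
  assumes r: "r = max_rank n \<Omega> F" "2 \<le> r" and p: "p \<in> \<Omega> \<times> Rn m"
    and small: "\<And>j k. 1 \<le> j \<Longrightarrow> j < k \<Longrightarrow> k \<le> r \<Longrightarrow>
      singular_values n (differential n \<Omega> F (fst p)) ! (j - 1) *
      singular_values n (differential n \<Omega> F (fst p)) ! (k - 1) \<le> (1/200) / (real r - 1)"
  shows "comass (Rn n \<times> Rn m) n (Theta n \<Omega> F p) \<le> 1"
  unfolding comass_def
proof (rule cSUP_least)
  have x: "fst p \<in> \<Omega>"
    using p by auto
  \<comment> \<open>The horizontal standard frame shows that the supremum runs over a nonempty set,
    as \<open>cSUP_least\<close> requires.\<close>
  have "0 \<in> Rn m"
    by (rule subspace_0[OF subspace_Rn])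
  then have "map (\<lambda>i. (unit_vec i, 0)) [0..<n]
      \<in> {vs. length vs = n \<and> set vs \<subseteq> Rn n \<times> Rn m \<and> orthonormal_list vs}"
    by (auto simp: orthonormal_list_def inner_unit_vec_unit_vec unit_vec_in_Rn)
  then show "{vs. length vs = n \<and> set vs \<subseteq> Rn n \<times> Rn m \<and> orthonormal_list vs} \<noteq> {}"
    by blast
  fix vs :: "(rseq \<times> rseq) list"
  assume vs: "vs \<in> {vs. length vs = n \<and> set vs \<subseteq> Rn n \<times> Rn m \<and> orthonormal_list vs}"
  obtain u where "singular_basis n (differential n \<Omega> F (fst p)) u"
    using singular[OF x] .
  then show "Theta n \<Omega> F p vs \<le> 1"
    unfolding Theta_eq_theta_at
    by (rule singular_basis.theta_at_le_1[of _ _ _ r])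
      (use r vs small max_rank_le op_rank_le_max_rank[OF x] in auto)
qed

end

theorem theorem4p5:
  shows "\<exists>\<epsilon>::real. \<epsilon> > 0 \<and>
    (\<forall>(n::nat) (m::nat) (\<Omega>::rseq set) (F::rseq \<Rightarrow> rseq) (r::nat).
      n \<ge> 1 \<longrightarrow> m \<ge> 1 \<longrightarrow>
      euclid_domain n \<Omega> \<longrightarrow>
      F ` \<Omega> \<subseteq> Rn m \<longrightarrow>
      smooth_on (Rn n) \<Omega> F \<longrightarrow>
      minimal_graph n \<Omega> F \<longrightarrow>
      r = max_rank n \<Omega> F \<longrightarrow> r \<ge> 2 \<longrightarrow>
      (\<forall>x\<in>\<Omega>. \<forall>j k. 1 \<le> j \<and> j < k \<and> k \<le> r \<longrightarrow>
        singular_values n (differential n \<Omega> F x) ! (j - 1) *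
        singular_values n (differential n \<Omega> F x) ! (k - 1) \<le> \<epsilon> / (real r - 1)) \<longrightarrow>
      calibration (Rn n \<times> Rn m) (\<Omega> \<times> Rn m) n (Theta n \<Omega> F))"
proof (intro exI[of _ "1/200"] conjI allI impI)
  fix n m :: nat and \<Omega> :: "rseq set" and F :: "rseq \<Rightarrow> rseq" and r :: nat
  assume \<Omega>: "euclid_domain n \<Omega>" and F: "smooth_on (Rn n) \<Omega> F" and min: "minimal_graph n \<Omega> F"
    and r: "r = max_rank n \<Omega> F" "2 \<le> r"
    and small: "\<forall>x\<in>\<Omega>. \<forall>j k. 1 \<le> j \<and> j < k \<and> k \<le> r \<longrightarrow>
      singular_values n (differential n \<Omega> F x) ! (j - 1) *
      singular_values n (differential n \<Omega> F x) ! (k - 1) \<le> 1/200 / (real r - 1)"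
  interpret smooth_graph n \<Omega> F
    using \<Omega> F by (rule smooth_graph.intro)
  show "calibration (Rn n \<times> Rn m) (\<Omega> \<times> Rn m) n (Theta n \<Omega> F)"
    unfolding calibration_def
  proof (intro conjI ballI smooth_form_Theta closed_form_Theta min)
    show "comass (Rn n \<times> Rn m) n (Theta n \<Omega> F p) \<le> 1" if "p \<in> \<Omega> \<times> Rn m" for p
      by (rule comass_Theta[OF r that]) (use small that in auto)
  qed
qed simp

end
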